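(* For any $m\ge 3$, the variety $\mathcal X=\overline{G\cdot\det}\subset Q$ is not normal.
   Context: All varieties are over $\mathbb C$. Let $\mathfrak v$ be a complex vector space of dimension $m$, $E=\operatorname{End}\mathfrak v$ (so $\dim E=m^2$), $G=\operatorname{GL}(E)$, and $Q=S^m(E^* )$, the space of homogeneous polynomial functions of degree $m$ on $E$. $G$ acts on $Q$ by $(g\cdot q)(X)=q(g^{-1}X)$. The function $\det\in Q$ is $X\mapsto\det X$ for $X\in\operatorname{End}\mathfrak v$. $\mathcal X$ is the Zariski closure in $Q$ of the orbit $G\cdot\det$, with its reduced structure. *)

theory Defs
  imports
    "HOL-Analysis.Analysis"
    "HOL-Library.Function_Algebras"
    "HOL-Algebra.Algebra"
begin

section \<open>Localization and integral closure\<close>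

text \<open>
  The localization of \<open>R\<close> at a multiplicative set \<open>S\<close>: the fractions \<open>a/s\<close> are the classes of
  pairs \<open>(a, s)\<close>, where \<open>(a, s)\<close> and \<open>(b, t)\<close> are identified iff \<open>u (t a - s b) = 0\<close>
  for some \<open>u\<close> in \<open>S\<close>.
\<close>

definition frac_rel :: "('a, 'b) ring_scheme \<Rightarrow> 'a set \<Rightarrow> (('a \<times> 'a) \<times> ('a \<times> 'a)) set" where
  "frac_rel R S = {((a, s), (b, t)).
     a \<in> carrier R \<and> s \<in> S \<and> b \<in> carrier R \<and> t \<in> S \<and>
     (\<exists>u\<in>S. u \<otimes>\<^bsub>R\<^esub> (t \<otimes>\<^bsub>R\<^esub> a) = u \<otimes>\<^bsub>R\<^esub> (s \<otimes>\<^bsub>R\<^esub> b))}"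

definition mk_frac :: "('a, 'b) ring_scheme \<Rightarrow> 'a set \<Rightarrow> 'a \<Rightarrow> 'a \<Rightarrow> ('a \<times> 'a) set" where
  "mk_frac R S a s = frac_rel R S `` {(a, s)}"

definition localization :: "('a, 'b) ring_scheme \<Rightarrow> 'a set \<Rightarrow> ('a \<times> 'a) set ring" where
  "localization R S =
    \<lparr> carrier = (carrier R \<times> S) // frac_rel R S,
      mult = (\<lambda>x y. \<Union>(a, s)\<in>x. \<Union>(b, t)\<in>y. mk_frac R S (a \<otimes>\<^bsub>R\<^esub> b) (s \<otimes>\<^bsub>R\<^esub> t)),
      one = mk_frac R S \<one>\<^bsub>R\<^esub> \<one>\<^bsub>R\<^esub>,
      ring.zero = mk_frac R S \<zero>\<^bsub>R\<^esub> \<one>\<^bsub>R\<^esub>,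
      ring.add = (\<lambda>x y. \<Union>(a, s)\<in>x. \<Union>(b, t)\<in>y.
               mk_frac R S (t \<otimes>\<^bsub>R\<^esub> a \<oplus>\<^bsub>R\<^esub> s \<otimes>\<^bsub>R\<^esub> b) (s \<otimes>\<^bsub>R\<^esub> t)) \<rparr>"

definition fraction_field :: "('a, 'b) ring_scheme \<Rightarrow> ('a \<times> 'a) set ring" where
  "fraction_field R = localization R (carrier R - {\<zero>\<^bsub>R\<^esub>})"

definition in_fraction_field :: "('a, 'b) ring_scheme \<Rightarrow> 'a \<Rightarrow> ('a \<times> 'a) set" where
  "in_fraction_field R a = mk_frac R (carrier R - {\<zero>\<^bsub>R\<^esub>}) a \<one>\<^bsub>R\<^esub>"

text \<open>Polynomials are coefficient lists, leading coefficient first.\<close>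

definition integral_over :: "('a, 'b) ring_scheme \<Rightarrow> 'a set \<Rightarrow> 'a \<Rightarrow> bool" where
  "integral_over L K z \<longleftrightarrow>
     (\<exists>p. polynomial\<^bsub>L\<^esub> K p \<and> p \<noteq> [] \<and> hd p = \<one>\<^bsub>L\<^esub> \<and> ring.eval L p z = \<zero>\<^bsub>L\<^esub>)"

definition integrally_closed_domain :: "('a, 'b) ring_scheme \<Rightarrow> bool" where
  "integrally_closed_domain R \<longleftrightarrow> domain R \<and>
     (\<forall>z\<in>carrier (fraction_field R).
        integral_over (fraction_field R) (in_fraction_field R ` carrier R) z \<longrightarrow>
        z \<in> in_fraction_field R ` carrier R)"

section \<open>Affine varieties in a complex vector space\<close>

text \<open>
  A complex vector space is given by a scalar multiplication \<open>s\<close> and a subspace \<open>V\<close> of the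
  underlying type.  Only the values on \<open>V\<close> of the functions below are relevant.
\<close>

definition linear_form ::
    "(complex \<Rightarrow> 'v \<Rightarrow> 'v) \<Rightarrow> 'v set \<Rightarrow> ('v::ab_group_add \<Rightarrow> complex) \<Rightarrow> bool" where
  "linear_form s V f \<longleftrightarrow>
     (\<forall>x\<in>V. \<forall>y\<in>V. f (x + y) = f x + f y) \<and> (\<forall>c. \<forall>x\<in>V. f (s c x) = c * f x)"

inductive_set poly_funs ::
    "(complex \<Rightarrow> 'v \<Rightarrow> 'v) \<Rightarrow> 'v set \<Rightarrow> ('v::ab_group_add \<Rightarrow> complex) set"
  for s :: "complex \<Rightarrow> 'v \<Rightarrow> 'v" and V :: "'v set" where
  const: "(\<lambda>_. c) \<in> poly_funs s V"
| linear: "linear_form s V f \<Longrightarrow> f \<in> poly_funs s V"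
| add: "f \<in> poly_funs s V \<Longrightarrow> g \<in> poly_funs s V \<Longrightarrow> (\<lambda>x. f x + g x) \<in> poly_funs s V"
| mult: "f \<in> poly_funs s V \<Longrightarrow> g \<in> poly_funs s V \<Longrightarrow> (\<lambda>x. f x * g x) \<in> poly_funs s V"

definition zariski_closed ::
    "(complex \<Rightarrow> 'v \<Rightarrow> 'v) \<Rightarrow> 'v set \<Rightarrow> ('v::ab_group_add) set \<Rightarrow> bool" where
  "zariski_closed s V Z \<longleftrightarrow> (\<exists>F \<subseteq> poly_funs s V. Z = {x \<in> V. \<forall>f\<in>F. f x = 0})"

definition zariski_closure ::
    "(complex \<Rightarrow> 'v \<Rightarrow> 'v) \<Rightarrow> 'v set \<Rightarrow> ('v::ab_group_add) set \<Rightarrow> 'v set" where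
  "zariski_closure s V A = \<Inter>{Z. zariski_closed s V Z \<and> A \<subseteq> Z}"

text \<open>
  The coordinate ring of a Zariski closed set \<open>Z\<close> with its reduced structure:
  polynomial functions on \<open>V\<close> restricted to \<open>Z\<close>.
\<close>

definition coord_ring ::
    "(complex \<Rightarrow> 'v \<Rightarrow> 'v) \<Rightarrow> 'v set \<Rightarrow> ('v::ab_group_add) set \<Rightarrow> ('v \<Rightarrow> complex) ring" where
  "coord_ring s V Z =
    \<lparr> carrier = (\<lambda>f. restrict f Z) ` poly_funs s V,
      mult = (\<lambda>f g. \<lambda>x\<in>Z. f x * g x),
      one = (\<lambda>x\<in>Z. 1),
      ring.zero = (\<lambda>x\<in>Z. 0),
      ring.add = (\<lambda>f g. \<lambda>x\<in>Z. f x + g x) \<rparr>"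

definition local_ring ::
    "(complex \<Rightarrow> 'v \<Rightarrow> 'v) \<Rightarrow> 'v set \<Rightarrow> ('v::ab_group_add) set \<Rightarrow> 'v \<Rightarrow>
     (('v \<Rightarrow> complex) \<times> ('v \<Rightarrow> complex)) set ring" where
  "local_ring s V Z x =
     localization (coord_ring s V Z) {f \<in> carrier (coord_ring s V Z). f x \<noteq> 0}"

definition normal_variety ::
    "(complex \<Rightarrow> 'v \<Rightarrow> 'v) \<Rightarrow> 'v set \<Rightarrow> ('v::ab_group_add) set \<Rightarrow> bool" where
  "normal_variety s V Z \<longleftrightarrow> (\<forall>x\<in>Z. integrally_closed_domain (local_ring s V Z x))"

section \<open>The orbit closure of the determinant\<close>

text \<open>
  \<open>E = End (\<complex>\<^sup>m)\<close> is the type \<open>complex^'n^'n\<close> of square matrices, with \<open>m = CARD('n)\<close>.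
  Note that the library's \<open>linear\<close> and \<open>span\<close> are over the reals, hence the explicit
  complex scalar multiplications.
\<close>

definition mat_scale :: "complex \<Rightarrow> complex^'n^'n \<Rightarrow> complex^'n^'n" where
  "mat_scale c A = map_matrix (\<lambda>z. c * z) A"

definition fun_scale :: "complex \<Rightarrow> ('a \<Rightarrow> complex) \<Rightarrow> 'a \<Rightarrow> complex" where
  "fun_scale c f = (\<lambda>x. c * f x)"

definition GL_E :: "(complex^'n^'n \<Rightarrow> complex^'n^'n) set" where
  "GL_E = {g. Vector_Spaces.linear mat_scale mat_scale g \<and> bij g}"

text \<open>\<open>S\<^sup>d(E\<^sup>*)\<close>, as the complex span of the \<open>d\<close>-fold products of linear forms on \<open>E\<close>.\<close>

definition hom_polys_E :: "nat \<Rightarrow> (complex^'n^'n \<Rightarrow> complex) set" where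
  "hom_polys_E d = module.span fun_scale
     {(\<lambda>A. \<Prod>i<d. l i A) | l. \<forall>i<d. linear_form mat_scale UNIV (l i)}"

definition Q_space :: "(complex^'n^'n \<Rightarrow> complex) set" where
  "Q_space = hom_polys_E CARD('n)"

definition act :: "(complex^'n^'n \<Rightarrow> complex^'n^'n) \<Rightarrow>
    (complex^'n^'n \<Rightarrow> complex) \<Rightarrow> complex^'n^'n \<Rightarrow> complex" where
  "act g q = (\<lambda>A. q (inv_into UNIV g A))"

definition det_orbit :: "(complex^'n^'n \<Rightarrow> complex) set" where
  "det_orbit = {act g det | g. g \<in> GL_E}"

definition det_orbit_closure :: "(complex^'n^'n \<Rightarrow> complex) set" where
  "det_orbit_closure = zariski_closure fun_scale Q_space det_orbit"

section \<open>Well-definedness\<close>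

lemma localization_cring:
  fixes R (structure)
  assumes "cring R" and S: "S \<subseteq> carrier R" "\<one>\<^bsub>R\<^esub> \<in> S" "\<And>s t. s \<in> S \<Longrightarrow> t \<in> S \<Longrightarrow> s \<otimes>\<^bsub>R\<^esub> t \<in> S"
  shows equiv_frac_rel: "equiv (carrier R \<times> S) (frac_rel R S)"
    and mult_mk_frac: "\<And>a s b t. \<lbrakk>a \<in> carrier R; s \<in> S; b \<in> carrier R; t \<in> S\<rbrakk> \<Longrightarrow>
      mk_frac R S a s \<otimes>\<^bsub>localization R S\<^esub> mk_frac R S b t = mk_frac R S (a \<otimes>\<^bsub>R\<^esub> b) (s \<otimes>\<^bsub>R\<^esub> t)"
    and add_mk_frac: "\<And>a s b t. \<lbrakk>a \<in> carrier R; s \<in> S; b \<in> carrier R; t \<in> S\<rbrakk> \<Longrightarrow>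
      mk_frac R S a s \<oplus>\<^bsub>localization R S\<^esub> mk_frac R S b t =
      mk_frac R S (t \<otimes>\<^bsub>R\<^esub> a \<oplus>\<^bsub>R\<^esub> s \<otimes>\<^bsub>R\<^esub> b) (s \<otimes>\<^bsub>R\<^esub> t)"
    and cring_localization: "cring (localization R S)"
proof -
  interpret cring R by fact
  let ?L = "localization R S" and ?r = "frac_rel R S"
  have SR [simp]: "s \<in> S \<Longrightarrow> s \<in> carrier R" for s using S(1) by auto
  note ac = m_assoc m_comm m_lcomm
  show eq: "equiv (carrier R \<times> S) ?r"
  proof (rule equivI)
    show "?r \<subseteq> (carrier R \<times> S) \<times> (carrier R \<times> S)" by (auto simp: frac_rel_def)
    show "refl_on (carrier R \<times> S) ?r" using S(2) by (auto simp: frac_rel_def refl_on_def)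
    show "sym ?r" by (auto simp: frac_rel_def sym_def) metis
    show "trans ?r"
    proof (rule transI, clarify)
      fix a s b t c w assume A: "((a, s), (b, t)) \<in> ?r" "((b, t), (c, w)) \<in> ?r"
      then obtain u v where u: "u \<in> S" "u \<otimes> (t \<otimes> a) = u \<otimes> (s \<otimes> b)"
        and v: "v \<in> S" "v \<otimes> (w \<otimes> b) = v \<otimes> (t \<otimes> c)" by (auto simp: frac_rel_def)
      have C: "a \<in> carrier R" "b \<in> carrier R" "c \<in> carrier R" "s \<in> S" "t \<in> S" "w \<in> S"
        using A by (auto simp: frac_rel_def)
      have "(u \<otimes> v \<otimes> t) \<otimes> (w \<otimes> a) = (v \<otimes> w) \<otimes> (u \<otimes> (t \<otimes> a))"
        using C u(1) v(1) by (simp add: ac)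
      also have "\<dots> = (u \<otimes> s) \<otimes> (v \<otimes> (w \<otimes> b))" unfolding u(2) using C u(1) v(1) by (simp add: ac)
      also have "\<dots> = (u \<otimes> v \<otimes> t) \<otimes> (s \<otimes> c)" unfolding v(2) using C u(1) v(1) by (simp add: ac)
      finally show "((a, s), (c, w)) \<in> ?r"
        using C u(1) v(1) S(3) by (auto simp: frac_rel_def intro!: bexI[of _ "u \<otimes> v \<otimes> t"])
    qed
  qed
  have mk_eq: "mk_frac R S a s = mk_frac R S b t"
    if "a \<in> carrier R" "s \<in> S" "b \<in> carrier R" "t \<in> S" "u \<in> S" "u \<otimes> (t \<otimes> a) = u \<otimes> (s \<otimes> b)" for a s b t u
    unfolding mk_frac_def using that by (intro equiv_class_eq[OF eq]) (auto simp: frac_rel_def)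
  have mk_eq1: "mk_frac R S a s = mk_frac R S b t"
    if "a \<in> carrier R" "s \<in> S" "b \<in> carrier R" "t \<in> S" "t \<otimes> a = s \<otimes> b" for a s b t
    using mk_eq[of a s b t \<one>] that S(2) by simp
  have cm: "congruent2 ?r ?r (\<lambda>(a, s) (b, t). mk_frac R S (a \<otimes> b) (s \<otimes> t))"
  proof (rule congruent2I', clarify)
    fix a s a' s' b t b' t' assume A: "((a, s), (a', s')) \<in> ?r" "((b, t), (b', t')) \<in> ?r"
    then obtain u v where u: "u \<in> S" "u \<otimes> (s' \<otimes> a) = u \<otimes> (s \<otimes> a')"
      and v: "v \<in> S" "v \<otimes> (t' \<otimes> b) = v \<otimes> (t \<otimes> b')" by (auto simp: frac_rel_def)
    have C: "a \<in> carrier R" "b \<in> carrier R" "a' \<in> carrier R" "b' \<in> carrier R" "s \<in> S" "t \<in> S" "s' \<in> S" "t' \<in> S"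
      using A by (auto simp: frac_rel_def)
    have "(u \<otimes> v) \<otimes> ((s' \<otimes> t') \<otimes> (a \<otimes> b)) = (u \<otimes> (s' \<otimes> a)) \<otimes> (v \<otimes> (t' \<otimes> b))"
      using C u(1) v(1) by (simp add: ac)
    also have "\<dots> = (u \<otimes> v) \<otimes> ((s \<otimes> t) \<otimes> (a' \<otimes> b'))"
      unfolding u(2) v(2) using C u(1) v(1) by (simp add: ac)
    finally show "mk_frac R S (a \<otimes> b) (s \<otimes> t) = mk_frac R S (a' \<otimes> b') (s' \<otimes> t')"
      using C u(1) v(1) S(3) by (intro mk_eq[of _ _ _ _ "u \<otimes> v"]) auto
  qed
  have ca: "congruent2 ?r ?r (\<lambda>(a, s) (b, t). mk_frac R S (t \<otimes> a \<oplus> s \<otimes> b) (s \<otimes> t))"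
  proof (rule congruent2I', clarify)
    fix a s a' s' b t b' t' assume A: "((a, s), (a', s')) \<in> ?r" "((b, t), (b', t')) \<in> ?r"
    then obtain u v where u: "u \<in> S" "u \<otimes> (s' \<otimes> a) = u \<otimes> (s \<otimes> a')"
      and v: "v \<in> S" "v \<otimes> (t' \<otimes> b) = v \<otimes> (t \<otimes> b')" by (auto simp: frac_rel_def)
    have C: "a \<in> carrier R" "b \<in> carrier R" "a' \<in> carrier R" "b' \<in> carrier R" "s \<in> S" "t \<in> S" "s' \<in> S" "t' \<in> S"
      using A by (auto simp: frac_rel_def)
    have "(u \<otimes> v) \<otimes> ((s' \<otimes> t') \<otimes> (t \<otimes> a \<oplus> s \<otimes> b)) =
        (v \<otimes> (t \<otimes> t')) \<otimes> (u \<otimes> (s' \<otimes> a)) \<oplus> (u \<otimes> (s \<otimes> s')) \<otimes> (v \<otimes> (t' \<otimes> b))"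
      using C u(1) v(1) by (simp add: ac r_distr)
    also have "\<dots> = (u \<otimes> v) \<otimes> ((s \<otimes> t) \<otimes> (t' \<otimes> a' \<oplus> s' \<otimes> b'))"
      unfolding u(2) v(2) using C u(1) v(1) by (simp add: ac r_distr)
    finally show "mk_frac R S (t \<otimes> a \<oplus> s \<otimes> b) (s \<otimes> t) = mk_frac R S (t' \<otimes> a' \<oplus> s' \<otimes> b') (s' \<otimes> t')"
      using C u(1) v(1) S(3) by (intro mk_eq[of _ _ _ _ "u \<otimes> v"]) auto
  qed
  show mult: "mk_frac R S a s \<otimes>\<^bsub>?L\<^esub> mk_frac R S b t = mk_frac R S (a \<otimes> b) (s \<otimes> t)"
    if "a \<in> carrier R" "s \<in> S" "b \<in> carrier R" "t \<in> S" for a s b t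
    using UN_equiv_class2[OF eq eq cm, of "(a, s)" "(b, t)"] that
    by (simp add: localization_def mk_frac_def[of R S a s] mk_frac_def[of R S b t] case_prod_unfold)
  show add: "mk_frac R S a s \<oplus>\<^bsub>?L\<^esub> mk_frac R S b t = mk_frac R S (t \<otimes> a \<oplus> s \<otimes> b) (s \<otimes> t)"
    if "a \<in> carrier R" "s \<in> S" "b \<in> carrier R" "t \<in> S" for a s b t
    using UN_equiv_class2[OF eq eq ca, of "(a, s)" "(b, t)"] that
    by (simp add: localization_def mk_frac_def[of R S a s] mk_frac_def[of R S b t] case_prod_unfold)
  have car: "carrier ?L = {mk_frac R S a s | a s. a \<in> carrier R \<and> s \<in> S}"
    by (auto simp: localization_def quotient_def mk_frac_def)
  have one: "\<one>\<^bsub>?L\<^esub> = mk_frac R S \<one> \<one>" and zero: "\<zero>\<^bsub>?L\<^esub> = mk_frac R S \<zero> \<one>"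
    by (simp_all add: localization_def)
  have E: thesis if "x \<in> carrier ?L"
    "\<And>a s. \<lbrakk>x = mk_frac R S a s; a \<in> carrier R; s \<in> S\<rbrakk> \<Longrightarrow> thesis" for x thesis
    using that by (auto simp: car)
  have I: "mk_frac R S a s \<in> carrier ?L" if "a \<in> carrier R" "s \<in> S" for a s
    using that by (auto simp: car)
  show "cring ?L"
  proof (intro cringI abelian_groupI comm_monoidI)
    show "\<zero>\<^bsub>?L\<^esub> \<in> carrier ?L" "\<one>\<^bsub>?L\<^esub> \<in> carrier ?L"
      using S by (simp_all add: one zero I)
  next
    fix x assume "x \<in> carrier ?L"
    then obtain a s where x: "x = mk_frac R S a s" "a \<in> carrier R" "s \<in> S" by (rule E)
    have "mk_frac R S (\<ominus> a) s \<oplus>\<^bsub>?L\<^esub> x = mk_frac R S (s \<otimes> \<ominus> a \<oplus> s \<otimes> a) (s \<otimes> s)"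
      using x by (simp add: add)
    also have "\<dots> = \<zero>\<^bsub>?L\<^esub>"
      unfolding zero using x S by (intro mk_eq1) (auto simp: r_minus l_neg)
    finally show "\<exists>y\<in>carrier ?L. y \<oplus>\<^bsub>?L\<^esub> x = \<zero>\<^bsub>?L\<^esub>" using x I[of "\<ominus> a" s] by auto
    show "\<zero>\<^bsub>?L\<^esub> \<oplus>\<^bsub>?L\<^esub> x = x" "\<one>\<^bsub>?L\<^esub> \<otimes>\<^bsub>?L\<^esub> x = x"
      using x by (simp_all add: one zero add mult S)
    fix y assume "y \<in> carrier ?L"
    then obtain b t where y: "y = mk_frac R S b t" "b \<in> carrier R" "t \<in> S" by (rule E)
    show "x \<oplus>\<^bsub>?L\<^esub> y \<in> carrier ?L" "x \<otimes>\<^bsub>?L\<^esub> y \<in> carrier ?L"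
      using x y S by (simp_all add: add mult I)
    show "x \<oplus>\<^bsub>?L\<^esub> y = y \<oplus>\<^bsub>?L\<^esub> x" "x \<otimes>\<^bsub>?L\<^esub> y = y \<otimes>\<^bsub>?L\<^esub> x"
      using x y by (simp_all add: add mult m_comm a_comm)
    fix z assume "z \<in> carrier ?L"
    then obtain c w where z: "z = mk_frac R S c w" "c \<in> carrier R" "w \<in> S" by (rule E)
    show "x \<oplus>\<^bsub>?L\<^esub> y \<oplus>\<^bsub>?L\<^esub> z = x \<oplus>\<^bsub>?L\<^esub> (y \<oplus>\<^bsub>?L\<^esub> z)"
      using x y z by (simp add: add S r_distr a_assoc ac)
    show "x \<otimes>\<^bsub>?L\<^esub> y \<otimes>\<^bsub>?L\<^esub> z = x \<otimes>\<^bsub>?L\<^esub> (y \<otimes>\<^bsub>?L\<^esub> z)"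
      using x y z by (simp add: mult S m_assoc)
    have "(x \<oplus>\<^bsub>?L\<^esub> y) \<otimes>\<^bsub>?L\<^esub> z = mk_frac R S ((t \<otimes> a \<oplus> s \<otimes> b) \<otimes> c) (s \<otimes> t \<otimes> w)"
      using x y z by (simp add: add mult S)
    also have "\<dots> = mk_frac R S (t \<otimes> w \<otimes> (a \<otimes> c) \<oplus> s \<otimes> w \<otimes> (b \<otimes> c)) (s \<otimes> w \<otimes> (t \<otimes> w))"
      using x y z by (intro mk_eq1) (simp_all add: S l_distr r_distr ac)
    also have "\<dots> = x \<otimes>\<^bsub>?L\<^esub> z \<oplus>\<^bsub>?L\<^esub> y \<otimes>\<^bsub>?L\<^esub> z"
      using x y z by (simp add: add mult S)
    finally show "(x \<oplus>\<^bsub>?L\<^esub> y) \<otimes>\<^bsub>?L\<^esub> z = x \<otimes>\<^bsub>?L\<^esub> z \<oplus>\<^bsub>?L\<^esub> y \<otimes>\<^bsub>?L\<^esub> z" .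
  qed
qed

lemma vector_space_mat_scale: "vector_space mat_scale"
  by unfold_locales (simp_all add: mat_scale_def vec_eq_iff algebra_simps)

lemma vector_space_fun_scale: "vector_space fun_scale"
  by unfold_locales (simp_all add: fun_scale_def fun_eq_iff algebra_simps)

lemma det_in_Q_space: "(det :: complex^'n^'n \<Rightarrow> complex) \<in> Q_space"
proof -
  interpret vector_space "fun_scale :: complex \<Rightarrow> (complex^'n^'n \<Rightarrow> complex) \<Rightarrow> _"
    by (rule vector_space_fun_scale)
  obtain h where h: "bij_betw h {..<CARD('n)} (UNIV :: 'n set)"
    by (metis atLeast0LessThan ex_bij_betw_nat_finite finite)
  let ?B = "{(\<lambda>A. \<Prod>i<CARD('n). l i A) | l. \<forall>i<CARD('n). linear_form mat_scale UNIV (l i)}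
    :: (complex^'n^'n \<Rightarrow> complex) set"
  have "(\<lambda>A. \<Prod>i\<in>UNIV. A $ i $ p i) \<in> ?B" for p
  proof -
    have "(\<lambda>A::complex^'n^'n. \<Prod>i\<in>UNIV. A $ i $ p i) = (\<lambda>A. \<Prod>i<CARD('n). A $ h i $ p (h i))"
      by (rule ext, rule prod.reindex_bij_betw[OF h, symmetric])
    moreover have "linear_form mat_scale UNIV (\<lambda>A. A $ h i $ p (h i))" for i
      by (simp add: linear_form_def mat_scale_def)
    ultimately show ?thesis
      by (intro CollectI exI[of _ "\<lambda>i A. A $ h i $ p (h i)"]) simp
  qed
  then have "(\<Sum>p | p permutes (UNIV::'n set). fun_scale (of_int (sign p))
      (\<lambda>A. \<Prod>i\<in>UNIV. A $ i $ p i)) \<in> span ?B"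
    by (intro span_sum span_scale span_base)
  moreover have "(\<Sum>p | p permutes (UNIV::'n set). fun_scale (of_int (sign p))
      (\<lambda>A::complex^'n^'n. \<Prod>i\<in>UNIV. A $ i $ p i)) = det"
  proof -
    have "sum F S A = (\<Sum>p\<in>S. F p A)" for F :: "('n \<Rightarrow> 'n) \<Rightarrow> complex^'n^'n \<Rightarrow> complex" and S A
      by (induct S rule: infinite_finite_induct) auto
    then show ?thesis by (simp add: fun_eq_iff det_def fun_scale_def)
  qed
  ultimately show ?thesis by (simp add: Q_space_def hom_polys_E_def)
qed

lemma act_in_Q_space:
  fixes g :: "complex^'n^'n \<Rightarrow> complex^'n^'n"
  assumes "g \<in> GL_E" and "q \<in> Q_space"
  shows "act g q \<in> Q_space"
proof -
  interpret vector_space "fun_scale :: complex \<Rightarrow> (complex^'n^'n \<Rightarrow> complex) \<Rightarrow> _"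
    by (rule vector_space_fun_scale)
  interpret L: Vector_Spaces.linear mat_scale mat_scale g
    using assms(1) by (simp add: GL_E_def)
  define k where "k = inv_into UNIV g"
  have gk: "g (k x) = x" and kg: "k (g x) = x" for x
    using assms(1) by (auto simp: GL_E_def k_def bij_is_surj surj_f_inv_f bij_is_inj)
  have k: "k (x + y) = k x + k y" "k (mat_scale c x) = mat_scale c (k x)" for x y c
    by (metis gk kg L.add, metis gk kg L.scale)
  let ?B = "{(\<lambda>A. \<Prod>i<CARD('n). l i A) | l. \<forall>i<CARD('n). linear_form mat_scale UNIV (l i)}
    :: (complex^'n^'n \<Rightarrow> complex) set"
  have "q \<in> span ?B" using assms(2) by (simp add: Q_space_def hom_polys_E_def)
  then have "act g q \<in> span ?B"
  proof (induct rule: span_induct_alt)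
    case base
    then show ?case using span_zero by (simp add: act_def zero_fun_def)
  next
    case (step c f q)
    then obtain l where l: "f = (\<lambda>A. \<Prod>i<CARD('n). l i A)"
      "\<forall>i<CARD('n). linear_form mat_scale UNIV (l i)" by auto
    then have "act g f \<in> ?B"
      by (intro CollectI exI[of _ "\<lambda>i A. l i (k A)"]) (simp add: act_def linear_form_def k k_def[symmetric])
    then have "fun_scale c (act g f) + act g q \<in> span ?B"
      by (rule span_add[OF span_scale[OF span_base] step(2)])
    moreover have "act g (fun_scale c f + q) = fun_scale c (act g f) + act g q"
      by (simp add: act_def fun_scale_def plus_fun_def)
    ultimately show ?case by (simp only:)
  qed
  then show ?thesis by (simp add: Q_space_def hom_polys_E_def)
qed

lemma zariski_closed_det_orbit_closure:
  "zariski_closed fun_scale Q_space (det_orbit_closure :: (complex^'n^'n \<Rightarrow> complex) set)"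
  "det_orbit \<subseteq> (det_orbit_closure :: (complex^'n^'n \<Rightarrow> complex) set)"
proof -
  let ?Z = "{Z. zariski_closed fun_scale Q_space Z \<and> (det_orbit :: (complex^'n^'n \<Rightarrow> complex) set) \<subseteq> Z}"
  let ?F = "{f \<in> poly_funs fun_scale (Q_space :: (complex^'n^'n \<Rightarrow> complex) set). \<forall>x\<in>det_orbit. f x = 0}"
  have o: "det_orbit \<subseteq> (Q_space :: (complex^'n^'n \<Rightarrow> complex) set)"
    using act_in_Q_space det_in_Q_space by (auto simp: det_orbit_def)
  have "\<Inter>?Z = {x \<in> Q_space. \<forall>f\<in>?F. f x = 0}"
  proof (rule antisym)
    have "{x \<in> Q_space. \<forall>f\<in>?F. f x = 0} \<in> ?Z"
      using o by (auto simp: zariski_closed_def intro!: exI[of _ ?F])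
    then show "\<Inter>?Z \<subseteq> {x \<in> Q_space. \<forall>f\<in>?F. f x = 0}" by (rule Inter_lower)
    show "{x \<in> Q_space. \<forall>f\<in>?F. f x = 0} \<subseteq> \<Inter>?Z"
      unfolding zariski_closed_def by blast
  qed
  then show "zariski_closed fun_scale Q_space (det_orbit_closure :: (complex^'n^'n \<Rightarrow> complex) set)"
    unfolding zariski_closed_def det_orbit_closure_def zariski_closure_def
    by (intro exI[of _ ?F]) (simp add: zariski_closed_def)
  show "det_orbit \<subseteq> (det_orbit_closure :: (complex^'n^'n \<Rightarrow> complex) set)"
    by (auto simp: det_orbit_closure_def zariski_closure_def)
qed

lemma cring_coord_ring: "cring (coord_ring s V Z)"
proof -
  let ?R = "coord_ring s V Z"
  have neg: "(\<lambda>x. - f x) \<in> poly_funs s V" if "f \<in> poly_funs s V" for f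
    using poly_funs.mult[OF poly_funs.const[of "-1"] that] by simp
  have E: thesis if "f \<in> carrier ?R"
    "\<And>h. \<lbrakk>h \<in> poly_funs s V; f = restrict h Z\<rbrakk> \<Longrightarrow> thesis" for f thesis
    using that by (auto simp: coord_ring_def)
  have I: "restrict h Z \<in> carrier ?R" if "h \<in> poly_funs s V" for h
    using that by (auto simp: coord_ring_def)
  have add: "restrict f Z \<oplus>\<^bsub>?R\<^esub> restrict g Z = restrict (\<lambda>x. f x + g x) Z"
    and mult: "restrict f Z \<otimes>\<^bsub>?R\<^esub> restrict g Z = restrict (\<lambda>x. f x * g x) Z" for f g
    by (auto simp: coord_ring_def fun_eq_iff)
  have zero: "\<zero>\<^bsub>?R\<^esub> = restrict (\<lambda>_. 0) Z" and one: "\<one>\<^bsub>?R\<^esub> = restrict (\<lambda>_. 1) Z"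
    by (simp_all add: coord_ring_def)
  show ?thesis
  proof (intro cringI abelian_groupI comm_monoidI)
    show "\<zero>\<^bsub>?R\<^esub> \<in> carrier ?R" "\<one>\<^bsub>?R\<^esub> \<in> carrier ?R"
      unfolding zero one by (rule I[OF poly_funs.const])+
  next
    fix x assume "x \<in> carrier ?R"
    then obtain f where x: "x = restrict f Z" "f \<in> poly_funs s V" by (rule E)
    show "\<zero>\<^bsub>?R\<^esub> \<oplus>\<^bsub>?R\<^esub> x = x" "\<one>\<^bsub>?R\<^esub> \<otimes>\<^bsub>?R\<^esub> x = x"
      by (simp_all add: x zero one add mult)
    have "restrict (\<lambda>x. - f x) Z \<oplus>\<^bsub>?R\<^esub> x = \<zero>\<^bsub>?R\<^esub>"
      by (simp add: x zero add)
    then show "\<exists>y\<in>carrier ?R. y \<oplus>\<^bsub>?R\<^esub> x = \<zero>\<^bsub>?R\<^esub>"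
      using I[OF neg[OF x(2)]] by blast
    fix y assume "y \<in> carrier ?R"
    then obtain g where y: "y = restrict g Z" "g \<in> poly_funs s V" by (rule E)
    show "x \<oplus>\<^bsub>?R\<^esub> y \<in> carrier ?R" "x \<otimes>\<^bsub>?R\<^esub> y \<in> carrier ?R"
      using x y by (auto simp: add mult intro!: I poly_funs.add poly_funs.mult)
    show "x \<oplus>\<^bsub>?R\<^esub> y = y \<oplus>\<^bsub>?R\<^esub> x" "x \<otimes>\<^bsub>?R\<^esub> y = y \<otimes>\<^bsub>?R\<^esub> x"
      by (simp_all add: x y add mult add.commute mult.commute)
    fix z assume "z \<in> carrier ?R"
    then obtain h where z: "z = restrict h Z" "h \<in> poly_funs s V" by (rule E)
    show "x \<oplus>\<^bsub>?R\<^esub> y \<oplus>\<^bsub>?R\<^esub> z = x \<oplus>\<^bsub>?R\<^esub> (y \<oplus>\<^bsub>?R\<^esub> z)"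
      "x \<otimes>\<^bsub>?R\<^esub> y \<otimes>\<^bsub>?R\<^esub> z = x \<otimes>\<^bsub>?R\<^esub> (y \<otimes>\<^bsub>?R\<^esub> z)"
      "(x \<oplus>\<^bsub>?R\<^esub> y) \<otimes>\<^bsub>?R\<^esub> z = x \<otimes>\<^bsub>?R\<^esub> z \<oplus>\<^bsub>?R\<^esub> y \<otimes>\<^bsub>?R\<^esub> z"
      by (simp_all add: x y z add mult add.assoc mult.assoc distrib_right)
  qed
qed

lemma cring_local_ring: "x \<in> Z \<Longrightarrow> cring (local_ring s V Z x)"
  unfolding local_ring_def
proof (rule cring_localization[OF cring_coord_ring])
  interpret cring "coord_ring s V Z" by (rule cring_coord_ring)
  assume x: "x \<in> Z"
  show "\<one>\<^bsub>coord_ring s V Z\<^esub> \<in> {f \<in> carrier (coord_ring s V Z). f x \<noteq> 0}"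
    using one_closed x by (simp add: coord_ring_def)
  show "f \<otimes>\<^bsub>coord_ring s V Z\<^esub> g \<in> {f \<in> carrier (coord_ring s V Z). f x \<noteq> 0}"
    if "f \<in> {f \<in> carrier (coord_ring s V Z). f x \<noteq> 0}"
       "g \<in> {f \<in> carrier (coord_ring s V Z). f x \<noteq> 0}" for f g
    using m_closed[of f g] that x by (simp add: coord_ring_def)
qed auto

end

theory Submission
  imports Defs
begin

text \<open>
  Write \<open>n = m\<^sup>2\<close> and \<open>q\<^sub>M = det \<circ> M\<close> for \<open>M \<in> End E\<close>, so that the orbit consists of the \<open>q\<^sub>M\<close> with
  \<open>det M \<noteq> 0\<close>.  The function \<open>h : q\<^sub>M \<mapsto> (det M)\<^sup>2\<close> on the orbit (homogeneous of degree \<open>2m\<close> in \<open>q\<close>) shows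
  that the local ring of the orbit closure at \<open>0\<close> is not integrally closed.

  The Hessian determinant of \<open>det\<close> is \<open>c det\<^sup>N\<close> with \<open>N = n - 2m\<close> and \<open>c \<noteq> 0\<close>, hence
  \<open>Hess q = c h q\<^sup>N\<close> on the orbit, where both \<open>Hess q (x)\<close> and \<open>q(x)\<close> are polynomial functions of \<open>q\<close>.
  Thus \<open>h\<close> is a rational function.  It is integral: if the evaluations at \<open>x\<^sub>1, \<dots>, x\<^sub>r\<close> span all
  evaluations and \<open>D\<close> is large, every product of \<open>D\<close> values \<open>q(x\<^sub>i)\<close> contains some \<open>q(x\<^sub>i)\<^sup>N\<close>, and so \<open>h\<close>
  maps the ideal spanned by these products into itself.

  If \<open>h\<close> were in the local ring at \<open>0\<close>, comparing homogeneous components would give a polynomial \<open>P\<close> of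
  degree \<open>2m\<close> with \<open>(det M)\<^sup>2 = P(q\<^sub>M)\<close> for all \<open>M\<close>.  An antisymmetrization over the columns of \<open>M\<close> kills
  \<open>P(q\<^sub>M)\<close>, because two of \<open>n\<close> columns must be fed into the same of the \<open>2m < n\<close> symmetric factors (this is
  where \<open>m \<ge> 3\<close> enters), but does not kill \<open>(det M)\<^sup>2\<close>.
\<close>

section \<open>An alternating functional on polynomials in a matrix\<close>

lemma prod_sum_UNIV:
  fixes f :: "'a::finite \<Rightarrow> 'b::finite \<Rightarrow> 'c::comm_semiring_1"
  shows "(\<Prod>j\<in>UNIV. \<Sum>b\<in>UNIV. f j b) = (\<Sum>\<beta>\<in>UNIV. \<Prod>j\<in>UNIV. f j (\<beta> j))"
  using prod_sum_PiE[of "UNIV :: 'a set" "\<lambda>_. UNIV :: 'b set" f] by (simp add: PiE_UNIV_domain)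

lemma prod_of_bool:
  "finite A \<Longrightarrow> (\<Prod>j\<in>A. of_bool (Q j)) = (of_bool (\<forall>j\<in>A. Q j) :: 'c::comm_semiring_1)"
  by (induction A rule: finite_induct) auto

text \<open>If \<open>R\<close> misses a point \<open>x\<close>, adding or removing \<open>x\<close>
  changes the parity of \<open>card U\<close> but not whether \<open>R \<subseteq> U\<close>, so the
  terms cancel in pairs. This is the inclusion-exclusion step of Ryser's formula.\<close>

lemma sum_alternating_supersets:
  fixes R :: "'a::finite set"
  shows "(\<Sum>U\<in>UNIV. (-1) ^ card U * of_bool (R \<subseteq> U)) =
    (if R = UNIV then (-1) ^ CARD('a) else 0 :: complex)"
proof (cases "R = UNIV")
  case True
  then have eq: "R \<subseteq> U \<longleftrightarrow> U = UNIV" for U by auto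
  have "(\<Sum>U\<in>UNIV. (-1) ^ card U * of_bool (R \<subseteq> U)) =
      (\<Sum>U\<in>UNIV. if U = (UNIV :: 'a set) then (-1) ^ CARD('a) else 0 :: complex)"
    unfolding eq by (rule sum.cong) auto
  then show ?thesis using True by (simp only: sum.delta[OF finite]) simp
next
  case False
  then obtain x where x: "x \<notin> R" by auto
  define g where "g U = (if x \<in> U then U - {x} else insert x U)" for U
  let ?f = "\<lambda>U. (-1) ^ card U * of_bool (R \<subseteq> U) :: complex"
  have "?f (g U) = - ?f U" for U
  proof (cases "x \<in> U")
    case True
    then obtain V where V: "U = insert x V" "x \<notin> V" by (rule mk_disjoint_insert[THEN exE]) auto
    then have "g U = V" "R \<subseteq> U \<longleftrightarrow> R \<subseteq> V" using x by (auto simp: g_def)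
    then show ?thesis using V by simp
  qed (use x in \<open>auto simp: g_def\<close>)
  then have "(\<Sum>U\<in>UNIV. ?f U) = (\<Sum>U\<in>UNIV. - ?f U)"
    by (intro sum.reindex_bij_witness[of _ g g]) (simp_all add: g_def insert_absorb)
  then show ?thesis using False by (simp only: sum_negf) simp
qed

text \<open>Extended by 0 to all self-maps, so that Leibniz sums run over a whole function type and
  combine with \<open>prod_sum_UNIV\<close>.\<close>

definition perm_sign :: "('n::finite \<Rightarrow> 'n) \<Rightarrow> complex" where
  "perm_sign f = (if f permutes UNIV then of_int (sign f) else 0)"

lemma det_perm_sign: "det a = (\<Sum>\<rho>\<in>UNIV. perm_sign \<rho> * (\<Prod>p\<in>UNIV. a $ p $ \<rho> p))"
proof -
  have "(\<Sum>\<rho>\<in>UNIV. perm_sign \<rho> * (\<Prod>p\<in>UNIV. a $ p $ \<rho> p)) =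
    (\<Sum>\<rho>\<in>UNIV. if \<rho> permutes UNIV then of_int (sign \<rho>) * (\<Prod>p\<in>UNIV. a $ p $ \<rho> p) else 0)"
    by (intro sum.cong) (auto simp: perm_sign_def)
  then show ?thesis by (simp add: det_def sum.If_cases)
qed

text \<open>The 0/1 specializations of the matrix with entries
  \<open>s p * [r = \<sigma> p] + t p * [r = p]\<close>: \<open>U\<close> contains
  \<open>(True, p)\<close> when \<open>s p = 1\<close> and \<open>(False, p)\<close> when
  \<open>t p = 1\<close>.\<close>

definition partial_perm_mat :: "('e::finite \<Rightarrow> 'e) \<Rightarrow> (bool \<times> 'e) set \<Rightarrow> complex^'e^'e" where
  "partial_perm_mat \<sigma> U =
     (\<chi> p r. of_bool ((True, p) \<in> U \<and> r = \<sigma> p) + of_bool ((False, p) \<in> U \<and> r = p))"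

text \<open>
  The inner alternating sum is Ryser's formula: on homogeneous functions of degree \<open>2 * CARD('e)\<close>
  it extracts the coefficient of \<open>\<Prod>p. s p * t p\<close> at the matrix with entries
  \<open>s p * [r = \<sigma> p] + t p * [r = p]\<close>.
\<close>

definition alt_sum :: "(complex^'e^'e \<Rightarrow> complex) \<Rightarrow> complex" where
  "alt_sum G = (\<Sum>\<sigma> | \<sigma> permutes (UNIV :: 'e::finite set). of_int (sign \<sigma>) *
     (\<Sum>U\<in>UNIV. (-1) ^ card U * G (partial_perm_mat \<sigma> U)))"

lemma alt_sum_add: "alt_sum (\<lambda>a. F a + G a) = alt_sum F + alt_sum G"
  by (simp add: alt_sum_def sum.distrib algebra_simps)

lemma alt_sum_scale: "alt_sum (\<lambda>a. c * F a) = c * alt_sum F"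
  by (simp add: alt_sum_def sum_distrib_left algebra_simps)

lemma alt_sum_sum: "alt_sum (\<lambda>a. \<Sum>i\<in>I. F i a) = (\<Sum>i\<in>I. alt_sum (F i))"
proof (induction I rule: infinite_finite_induct)
  case (insert x I)
  then show ?case by (simp add: alt_sum_add)
qed (simp_all add: alt_sum_def)

text \<open>Expanding the product, each factor \<open>j\<close> picks by \<open>\<beta> j\<close>
  one of the two summands in its row \<open>P j\<close>. The alternating sum over \<open>U\<close>
  keeps the choices that hit every pair \<open>(b, p)\<close>, and there are exactly as many factors
  as pairs.\<close>

lemma alt_sum_multilinear:
  fixes P :: "'j::finite \<Rightarrow> 'e::finite" and T :: "('j \<Rightarrow> 'e) \<Rightarrow> complex"
  assumes card: "CARD('j) = 2 * CARD('e)"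
  shows "alt_sum (\<lambda>a. \<Sum>\<kappa>\<in>UNIV. T \<kappa> * (\<Prod>j\<in>UNIV. a $ P j $ \<kappa> j)) =
    (\<Sum>\<beta> | bij (\<lambda>j. (\<beta> j, P j)). \<Sum>\<sigma> | \<sigma> permutes UNIV.
       of_int (sign \<sigma>) * T (\<lambda>j. if \<beta> j then \<sigma> (P j) else P j))"
proof -
  let ?k = "\<lambda>\<sigma> \<beta> j. if \<beta> j then \<sigma> (P j) else P j"
  have 1: "(\<Prod>j\<in>UNIV. partial_perm_mat \<sigma> U $ P j $ \<kappa> j) =
      (\<Sum>\<beta>\<in>UNIV. of_bool (range (\<lambda>j. (\<beta> j, P j)) \<subseteq> U) * of_bool (\<kappa> = ?k \<sigma> \<beta>))" for \<sigma> U \<kappa>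
  proof -
    have "(\<Prod>j\<in>UNIV. partial_perm_mat \<sigma> U $ P j $ \<kappa> j) =
      (\<Prod>j\<in>UNIV. \<Sum>b\<in>UNIV. of_bool ((b, P j) \<in> U \<and> \<kappa> j = (if b then \<sigma> (P j) else P j)))"
      by (simp add: partial_perm_mat_def UNIV_bool add.commute del: sum_of_bool_eq)
    also have "\<dots> = (\<Sum>\<beta>\<in>UNIV. \<Prod>j\<in>UNIV. of_bool ((\<beta> j, P j) \<in> U \<and> \<kappa> j = ?k \<sigma> \<beta> j))"
      by (rule prod_sum_UNIV)
    also have "\<dots> = (\<Sum>\<beta>\<in>UNIV. of_bool (range (\<lambda>j. (\<beta> j, P j)) \<subseteq> U) * of_bool (\<kappa> = ?k \<sigma> \<beta>))"
      by (intro sum.cong refl) (simp add: prod_of_bool image_subset_iff fun_eq_iff all_conj_distrib flip: of_bool_conj)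
    finally show ?thesis .
  qed
  have 2: "(\<Sum>\<kappa>\<in>UNIV. T \<kappa> * (\<Prod>j\<in>UNIV. partial_perm_mat \<sigma> U $ P j $ \<kappa> j)) =
      (\<Sum>\<beta>\<in>UNIV. of_bool (range (\<lambda>j. (\<beta> j, P j)) \<subseteq> U) * T (?k \<sigma> \<beta>))" for \<sigma> U
  proof -
    have "(\<Sum>\<kappa>\<in>UNIV. T \<kappa> * (\<Prod>j\<in>UNIV. partial_perm_mat \<sigma> U $ P j $ \<kappa> j)) =
      (\<Sum>\<beta>\<in>UNIV. \<Sum>\<kappa>\<in>UNIV. if \<kappa> = ?k \<sigma> \<beta> then of_bool (range (\<lambda>j. (\<beta> j, P j)) \<subseteq> U) * T \<kappa> else 0)"
      unfolding 1 sum_distrib_left by (subst sum.swap) (intro sum.cong refl, auto)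
    then show ?thesis by (simp only: sum.delta[OF finite] UNIV_I if_True)
  qed
  have 3: "(\<Sum>U\<in>UNIV. (-1) ^ card U *
      (\<Sum>\<kappa>\<in>UNIV. T \<kappa> * (\<Prod>j\<in>UNIV. partial_perm_mat \<sigma> U $ P j $ \<kappa> j))) =
      (\<Sum>\<beta> | bij (\<lambda>j. (\<beta> j, P j)). T (?k \<sigma> \<beta>))" for \<sigma>
  proof -
    have "(\<Sum>U\<in>UNIV. (-1) ^ card U *
      (\<Sum>\<kappa>\<in>UNIV. T \<kappa> * (\<Prod>j\<in>UNIV. partial_perm_mat \<sigma> U $ P j $ \<kappa> j))) =
      (\<Sum>\<beta>\<in>UNIV. (\<Sum>U\<in>UNIV. (-1) ^ card U * of_bool (range (\<lambda>j. (\<beta> j, P j)) \<subseteq> U)) * T (?k \<sigma> \<beta>))"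
      unfolding 2 sum_distrib_left sum_distrib_right
      by (subst sum.swap) (simp add: mult.assoc)
    also have "\<dots> = (\<Sum>\<beta>\<in>UNIV. if bij (\<lambda>j. (\<beta> j, P j)) then T (?k \<sigma> \<beta>) else 0)"
    proof (intro sum.cong refl)
      fix \<beta> :: "'j \<Rightarrow> bool"
      have "bij (\<lambda>j. (\<beta> j, P j)) \<longleftrightarrow> range (\<lambda>j. (\<beta> j, P j)) = UNIV"
        using card by (auto simp: bij_def intro!: eq_card_imp_inj_on)
      then show "(\<Sum>U\<in>UNIV. (-1) ^ card U * of_bool (range (\<lambda>j. (\<beta> j, P j)) \<subseteq> U)) * T (?k \<sigma> \<beta>) =
          (if bij (\<lambda>j. (\<beta> j, P j)) then T (?k \<sigma> \<beta>) else 0)"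
        \<comment> \<open>The remaining sign is \<open>-1\<close> to the even power
          \<open>CARD(bool \<times> 'e)\<close>.\<close>
        unfolding sum_alternating_supersets by (simp add: power_mult)
    qed
    finally show ?thesis by (simp add: sum.If_cases)
  qed
  show ?thesis
    unfolding alt_sum_def 3 unfolding sum_distrib_left by (rule sum.swap)
qed

text \<open>
  Two factors in the same class whose rows both carry \<open>\<sigma>\<close> exist by the pigeonhole principle;
  composing \<open>\<sigma>\<close> with the transposition of the two rows flips the sign of the summand.
\<close>

lemma alt_sum_multilinear_eq_0:
  fixes P :: "'j::finite \<Rightarrow> 'e::finite" and T :: "('j \<Rightarrow> 'e) \<Rightarrow> complex" and c :: "'j \<Rightarrow> 'k::finite"
  assumes card: "CARD('j) = 2 * CARD('e)" and small: "CARD('k) < CARD('e)"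
    and T: "\<And>\<kappa> j j'. c j = c j' \<Longrightarrow> T (\<kappa> \<circ> Transposition.transpose j j') = T \<kappa>"
  shows "alt_sum (\<lambda>a. \<Sum>\<kappa>\<in>UNIV. T \<kappa> * (\<Prod>j\<in>UNIV. a $ P j $ \<kappa> j)) = 0"
  unfolding alt_sum_multilinear[OF card]
proof (rule sum.neutral, rule ballI)
  fix \<beta> :: "'j \<Rightarrow> bool" assume "\<beta> \<in> {\<beta>. bij (\<lambda>j. (\<beta> j, P j))}"
  then have b: "bij (\<lambda>j. (\<beta> j, P j))" by simp
  \<comment> \<open>The unique factor in row \<open>p\<close> that picks the entry at column
    \<open>\<sigma> p\<close>.\<close>
  define g where "g p = inv_into UNIV (\<lambda>j. (\<beta> j, P j)) (True, p)" for p
  have g: "\<beta> (g p)" "P (g p) = p" for p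
    using surj_f_inv_f[OF bij_is_surj[OF b], of "(True, p)"] by (auto simp: g_def)
  have g_eq: "j = g p" if "\<beta> j" "P j = p" for j p
    using inv_f_f[OF bij_is_inj[OF b], of j] unfolding g_def that(2) by (simp add: that(1))
  have "\<not> inj (\<lambda>p. c (g p))"
    using small card_inj_on_le[OF _ subset_UNIV finite, of "\<lambda>p. c (g p)" UNIV] by linarith
  then have "\<exists>p p'. p \<noteq> p' \<and> c (g p) = c (g p')"
    by (rule contrapos_np) (rule injI, blast)
  then obtain p p' where p: "p \<noteq> p'" "c (g p) = c (g p')" by (elim exE conjE)
  let ?t = "Transposition.transpose p p'"
  let ?f = "\<lambda>\<sigma>. of_int (sign \<sigma>) * T (\<lambda>j. if \<beta> j then \<sigma> (P j) else P j)"
  have "?f (\<sigma> \<circ> ?t) = - ?f \<sigma>" if "\<sigma> permutes UNIV" for \<sigma>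
  proof -
    \<comment> \<open>Among the factors that see \<open>\<sigma>\<close>, only \<open>g p\<close>
      and \<open>g p'\<close> lie in the rows \<open>p\<close> and \<open>p'\<close>, so the new
      permutation exchanges the columns of just these two.\<close>
    have "(\<lambda>j. if \<beta> j then (\<sigma> \<circ> ?t) (P j) else P j) =
        (\<lambda>j. if \<beta> j then \<sigma> (P j) else P j) \<circ> Transposition.transpose (g p) (g p')"
      (is "?l = ?r")
    proof
      fix j
      consider "j = g p" | "j = g p'" | "j \<noteq> g p" "j \<noteq> g p'" by blast
      then show "?l j = ?r j"
      proof cases
        case 3
        then have "P j \<noteq> p \<and> P j \<noteq> p'" if "\<beta> j" using g_eq that by blast
        then show ?thesis using 3 by (simp add: Transposition.transpose_def)
      qed (simp_all add: g)
    qed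
    then have "T (\<lambda>j. if \<beta> j then (\<sigma> \<circ> ?t) (P j) else P j) = T (\<lambda>j. if \<beta> j then \<sigma> (P j) else P j)"
      using T[OF p(2)] by metis
    moreover have "sign (\<sigma> \<circ> ?t) = - sign \<sigma>"
      using p(1) sign_compose[OF permutes_imp_permutation[OF finite that] permutation_swap_id, of p p']
      by (simp add: sign_swap_id)
    ultimately show ?thesis by simp
  qed
  then have "(\<Sum>\<sigma> | \<sigma> permutes UNIV. ?f \<sigma>) = (\<Sum>\<sigma> | \<sigma> permutes UNIV. - ?f \<sigma>)"
    by (intro sum.reindex_bij_witness[of _ "\<lambda>\<sigma>. \<sigma> \<circ> ?t" "\<lambda>\<sigma>. \<sigma> \<circ> ?t"])
      (auto simp: comp_assoc intro!: permutes_compose permutes_swap_id)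
  then show "(\<Sum>\<sigma> | \<sigma> permutes UNIV. ?f \<sigma>) = 0" by (simp only: sum_negf) simp
qed

text \<open>No cancellation can occur: every summand left by \<open>alt_sum_multilinear\<close> is 0
  or 1, and \<open>\<sigma> = id\<close> produces a 1.\<close>

lemma alt_sum_det_square: "alt_sum (\<lambda>a :: complex^'e^'e. (det a)\<^sup>2) \<noteq> 0"
proof -
  \<comment> \<open>\<open>True\<close> and \<open>False\<close> tag the entries taken from the two
    copies of the determinant.\<close>
  define T where "T \<kappa> = perm_sign (\<lambda>p. \<kappa> (True, p)) * perm_sign (\<lambda>p. \<kappa> (False, p))" for \<kappa> :: "bool \<times> 'e \<Rightarrow> 'e"
  have sq: "(det a)\<^sup>2 = (\<Sum>\<kappa>\<in>UNIV. T \<kappa> * (\<Prod>j\<in>UNIV. a $ snd j $ \<kappa> j))" for a :: "complex^'e^'e"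
  proof -
    have "(det a)\<^sup>2 = (\<Sum>x\<in>UNIV \<times> UNIV. perm_sign (fst x) * perm_sign (snd x) *
        ((\<Prod>p\<in>UNIV. a $ p $ fst x p) * (\<Prod>p\<in>UNIV. a $ p $ snd x p)))"
      unfolding power2_eq_square det_perm_sign sum_product sum.cartesian_product case_prod_unfold
      by (intro sum.cong refl) (simp only: mult_ac)
    also have "\<dots> = (\<Sum>\<kappa>\<in>UNIV. T \<kappa> * (\<Prod>j\<in>UNIV \<times> UNIV. a $ snd j $ \<kappa> j))"
      by (rule sum.reindex_bij_witness[of _ "\<lambda>\<kappa>. (\<lambda>p. \<kappa> (True, p), \<lambda>p. \<kappa> (False, p))"
          "\<lambda>x y. if fst y then fst x (snd y) else snd x (snd y)"])
        (simp_all add: T_def prod.cartesian_product' UNIV_bool mult_ac fun_eq_iff del: UNIV_Times_UNIV)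
    finally show ?thesis by simp
  qed
  let ?k = "\<lambda>\<sigma> \<beta> j. if \<beta> j then \<sigma> (snd j) else snd j :: 'e"
  have T01: "of_int (sign \<sigma>) * T (?k \<sigma> \<beta>) = of_bool ((\<lambda>p. ?k \<sigma> \<beta> (True, p)) permutes UNIV \<and> (\<lambda>p. ?k \<sigma> \<beta> (False, p)) permutes UNIV)"
    if \<sigma>: "\<sigma> permutes UNIV" and b: "bij (\<lambda>j. (\<beta> j, snd j))" for \<sigma> \<beta>
  proof (cases "(\<lambda>p. ?k \<sigma> \<beta> (True, p)) permutes UNIV \<and> (\<lambda>p. ?k \<sigma> \<beta> (False, p)) permutes UNIV")
    case True
    define f g where "f p = ?k \<sigma> \<beta> (True, p)" and "g p = ?k \<sigma> \<beta> (False, p)" for p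
    \<comment> \<open>Bijectivity of the choice means that, of the two copies of row
      \<open>p\<close>, exactly one follows \<open>\<sigma>\<close>. So \<open>f\<close> is
      \<open>\<sigma>\<close> on \<open>I\<close> and the identity elsewhere, and \<open>g\<close>
      the other way round.\<close>
    define I where "I = {p. \<beta> (True, p)}"
    have F: "\<beta> (False, p) \<longleftrightarrow> p \<notin> I" for p
    proof -
      have "\<beta> (True, p) \<noteq> \<beta> (False, p)"
        using bij_is_inj[OF b] by (auto simp: inj_def)
      then show ?thesis by (simp add: I_def)
    qed
    have f: "f p = (if p \<in> I then \<sigma> p else p)" for p by (simp add: I_def f_def)
    have g: "g p = (if p \<in> I then p else \<sigma> p)" for p by (simp add: F g_def)
    have fp: "f permutes UNIV" and gp: "g permutes UNIV"
      using True unfolding f_def[abs_def] g_def[abs_def] by blast+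
    have injs: "inj \<sigma>" using \<sigma> by (auto simp: permutes_inj)
    \<comment> \<open>A point of \<open>I\<close> sent outside \<open>I\<close> would have the same
      value under \<open>f\<close> as its image, against injectivity.\<close>
    have sub: "\<sigma> ` I \<subseteq> I"
    proof clarify
      fix p assume p: "p \<in> I"
      show "\<sigma> p \<in> I"
      proof (rule ccontr)
        assume n: "\<sigma> p \<notin> I"
        then have "f (\<sigma> p) = f p" using p by (simp add: f)
        then have "\<sigma> p = p" using permutes_inj[OF fp] by (rule injD[rotated])
        then show False using p n by simp
      qed
    qed
    moreover have "card (\<sigma> ` I) = card I" using injs by (simp add: card_image inj_on_subset)
    ultimately have "\<sigma> ` I = I" by (simp add: card_subset_eq)
    then have n: "\<sigma> p \<notin> I" if "p \<notin> I" for p using that inj_image_mem_iff[OF injs, of p I] by simp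
    have "f (g p) = \<sigma> p" for p
      by (cases "p \<in> I") (use n in \<open>simp_all add: f g\<close>)
    \<comment> \<open>As \<open>\<sigma>\<close> preserves \<open>I\<close>, it is the product of
      its two restrictions. The signs multiply, and the summand becomes the square of a
      sign.\<close>
    then have "f \<circ> g = \<sigma>" by (simp add: fun_eq_iff)
    then have "sign \<sigma> = sign f * sign g"
      using sign_compose[OF permutes_imp_permutation[OF finite fp] permutes_imp_permutation[OF finite gp]]
      by simp
    then have "of_int (sign \<sigma>) * T (?k \<sigma> \<beta>) = of_int (sign \<sigma> * sign \<sigma>)"
      using fp gp by (simp add: T_def perm_sign_def f_def[abs_def] g_def[abs_def])
    then show ?thesis using True by (simp add: sign_idempotent)
  qed (auto simp: T_def perm_sign_def)
  define B :: "(bool \<times> 'e \<Rightarrow> bool) set" where "B = {\<beta>. bij (\<lambda>j. (\<beta> j, snd j))}"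
  define S where "S = {\<sigma>. \<sigma> permutes (UNIV :: 'e set)}"
  define good where "good \<beta> \<sigma> \<longleftrightarrow> (\<lambda>p. ?k \<sigma> \<beta> (True, p)) permutes UNIV \<and>
    (\<lambda>p. ?k \<sigma> \<beta> (False, p)) permutes UNIV" for \<beta> \<sigma>
  have "alt_sum (\<lambda>a :: complex^'e^'e. (det a)\<^sup>2) = (\<Sum>\<beta>\<in>B. \<Sum>\<sigma>\<in>S. of_int (sign \<sigma>) * T (?k \<sigma> \<beta>))"
    unfolding sq B_def S_def by (rule alt_sum_multilinear) simp
  also have "\<dots> = (\<Sum>\<beta>\<in>B. \<Sum>\<sigma>\<in>S. of_bool (good \<beta> \<sigma>))"
    by (intro sum.cong refl) (simp only: T01 B_def S_def good_def mem_Collect_eq)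
  also have "\<dots> = (\<Sum>x\<in>B \<times> S. of_bool (good (fst x) (snd x)))"
    by (simp only: sum.cartesian_product case_prod_unfold)
  also have "\<dots> = of_nat (card (B \<times> S \<inter> {x. good (fst x) (snd x)}))"
    by (rule sum_of_bool_eq) simp_all
  finally have "alt_sum (\<lambda>a :: complex^'e^'e. (det a)\<^sup>2) =
    of_nat (card (B \<times> S \<inter> {x. good (fst x) (snd x)}))" .
  \<comment> \<open>The choice \<open>fst\<close> lets the first determinant follow
    \<open>\<sigma>\<close> and the second one the diagonal.\<close>
  moreover have "(fst, id) \<in> B \<times> S \<inter> {x. good (fst x) (snd x)}"
    using permutes_id[of "UNIV :: 'e set"] bij_id[where 'a = "bool \<times> 'e"]
    by (simp add: B_def S_def good_def id_def)
  then have "card (B \<times> S \<inter> {x. good (fst x) (snd x)}) \<noteq> 0"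
    using card_0_eq[OF finite, of "B \<times> S \<inter> {x. good (fst x) (snd x)}"] by blast
  ultimately show ?thesis by simp
qed

section \<open>Homogeneous polynomial functions and the orbit of the determinant\<close>

text \<open>Products are taken over lists, so that multiplying two of them is concatenation. As
  linear forms are constrained only on \<open>V\<close>, homogeneity as a function holds only
  there.\<close>

inductive_set hom_poly_funs ::
    "(complex \<Rightarrow> 'v \<Rightarrow> 'v) \<Rightarrow> 'v set \<Rightarrow> nat \<Rightarrow> ('v::ab_group_add \<Rightarrow> complex) set"
  for s :: "complex \<Rightarrow> 'v \<Rightarrow> 'v" and V :: "'v set" and d :: nat where
  zero: "(\<lambda>_. 0) \<in> hom_poly_funs s V d"
| prod: "length \<phi>s = d \<Longrightarrow> (\<And>\<phi>. \<phi> \<in> set \<phi>s \<Longrightarrow> linear_form s V \<phi>) \<Longrightarrow>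
    (\<lambda>q. c * prod_list (map (\<lambda>\<phi>. \<phi> q) \<phi>s)) \<in> hom_poly_funs s V d"
| add: "F \<in> hom_poly_funs s V d \<Longrightarrow> G \<in> hom_poly_funs s V d \<Longrightarrow>
    (\<lambda>q. F q + G q) \<in> hom_poly_funs s V d"

lemma hom_poly_funs_sum:
  "(\<And>i. i \<in> I \<Longrightarrow> F i \<in> hom_poly_funs s V d) \<Longrightarrow> (\<lambda>q. \<Sum>i\<in>I. F i q) \<in> hom_poly_funs s V d"
  by (induction I rule: infinite_finite_induct) (auto intro: hom_poly_funs.intros)

lemma hom_poly_funs_mult:
  assumes "F \<in> hom_poly_funs s V d" "G \<in> hom_poly_funs s V e"
  shows "(\<lambda>q. F q * G q) \<in> hom_poly_funs s V (d + e)"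
  using assms(1)
proof induction
  case zero
  then show ?case by (simp add: hom_poly_funs.zero)
next
  case (add F F')
  then show ?case by (simp add: distrib_right hom_poly_funs.add)
next
  case (prod \<phi>s c)
  show ?case using assms(2)
  proof induction
    case zero
    then show ?case by (simp add: hom_poly_funs.zero)
  next
    case (add G G')
    then show ?case by (simp add: distrib_left hom_poly_funs.add)
  next
    case (prod \<psi>s c')
    have "(\<lambda>q. c * c' * prod_list (map (\<lambda>\<phi>. \<phi> q) (\<phi>s @ \<psi>s))) \<in> hom_poly_funs s V (d + e)"
      using prod \<open>length \<phi>s = d\<close> \<open>\<And>\<phi>. \<phi> \<in> set \<phi>s \<Longrightarrow> linear_form s V \<phi>\<close>
      by (intro hom_poly_funs.prod) auto
    then show ?case by (simp add: mult_ac)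
  qed
qed

lemma hom_poly_funs_scale:
  assumes "F \<in> hom_poly_funs s V d" "q \<in> V"
  shows "F (s t q) = t ^ d * F q"
  using assms(1)
proof induction
  case (prod \<phi>s c)
  have "prod_list (map (\<lambda>\<phi>. \<phi> (s t q)) \<phi>s) = t ^ length \<phi>s * prod_list (map (\<lambda>\<phi>. \<phi> q) \<phi>s)"
    using prod(2) by (induction \<phi>s) (use assms(2) in \<open>auto simp: linear_form_def\<close>)
  then show ?case by (simp add: prod(1))
qed (simp_all add: distrib_left)

text \<open>Induction on the construction of \<open>f\<close>. Extending the components by 0 beyond
  \<open>N\<close> allows two sums to be padded to a common length and multiplied as a Cauchy
  product.\<close>

lemma poly_funs_hom_decomposition:
  assumes "f \<in> poly_funs s V"
  obtains F N where "\<And>j. F j \<in> hom_poly_funs s V j" "\<And>j. j > N \<Longrightarrow> F j = (\<lambda>_. 0)"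
    "\<And>q. f q = (\<Sum>j\<le>N. F j q)"
proof -
  have "\<exists>F N. (\<forall>j. F j \<in> hom_poly_funs s V j) \<and> (\<forall>j>N. F j = (\<lambda>_. 0)) \<and> (\<forall>q. f q = (\<Sum>j\<le>N. F j q))"
    using assms
  proof induction
    case (const c)
    have "(\<lambda>q. c) \<in> hom_poly_funs s V 0" using hom_poly_funs.prod[of "[]" 0 s V c] by simp
    then show ?case
      by (intro exI[of _ "\<lambda>j. if j = 0 then \<lambda>q. c else (\<lambda>_. 0)"] exI[of _ 0])
        (simp add: hom_poly_funs.zero)
  next
    case (linear f)
    then have "f \<in> hom_poly_funs s V 1" using hom_poly_funs.prod[of "[f]" 1 s V 1] by simp
    then show ?case
      by (intro exI[of _ "\<lambda>j. if j = 1 then f else (\<lambda>_. 0)"] exI[of _ 1])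
        (simp add: hom_poly_funs.zero)
  next
    case (add f g)
    then obtain F N G M where F: "\<And>j. F j \<in> hom_poly_funs s V j" "\<And>j. j > N \<Longrightarrow> F j = (\<lambda>_. 0)"
        "\<And>q. f q = (\<Sum>j\<le>N. F j q)"
      and G: "\<And>j. G j \<in> hom_poly_funs s V j" "\<And>j. j > M \<Longrightarrow> G j = (\<lambda>_. 0)"
        "\<And>q. g q = (\<Sum>j\<le>M. G j q)"
      by (elim exE conjE) metis
    have "f q = (\<Sum>j\<le>max N M. F j q)" "g q = (\<Sum>j\<le>max N M. G j q)" for q
      unfolding F(3) G(3) by (intro sum.mono_neutral_left; simp add: F(2) G(2))+
    then show ?case
      by (intro exI[of _ "\<lambda>j q. F j q + G j q"] exI[of _ "max N M"])
        (auto simp: sum.distrib F G intro: hom_poly_funs.add)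
  next
    case (mult f g)
    then obtain F N G M where F: "\<And>j. F j \<in> hom_poly_funs s V j" "\<And>j. j > N \<Longrightarrow> F j = (\<lambda>_. 0)"
        "\<And>q. f q = (\<Sum>j\<le>N. F j q)"
      and G: "\<And>j. G j \<in> hom_poly_funs s V j" "\<And>j. j > M \<Longrightarrow> G j = (\<lambda>_. 0)"
        "\<And>q. g q = (\<Sum>j\<le>M. G j q)"
      by (elim exE conjE) metis
    define H where "H r q = (\<Sum>k\<le>r. F k q * G (r - k) q)" for r q
    have "f q * g q = (\<Sum>r\<le>N + M. H r q)" for q
      \<comment> \<open>The Cauchy product, read off from a product of polynomials evaluated at
        1.\<close>
      using polynomial_product[of N "\<lambda>j. F j q" M "\<lambda>j. G j q" 1] F(2) G(2)
      by (simp add: F(3) G(3) H_def)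
    moreover have "H r \<in> hom_poly_funs s V r" for r
    proof -
      have "(\<lambda>q. F k q * G (r - k) q) \<in> hom_poly_funs s V r" if "k \<le> r" for k
        using hom_poly_funs_mult[OF F(1)[of k] G(1)[of "r - k"]] that by simp
      then show ?thesis unfolding H_def[abs_def] by (intro hom_poly_funs_sum) auto
    qed
    moreover have "H r = (\<lambda>_. 0)" if "r > N + M" for r
    proof -
      have "F k q * G (r - k) q = 0" for k q
        using F(2)[of k] G(2)[of "r - k"] that by (cases "k > N") auto
      then have "H r q = 0" for q unfolding H_def by (intro sum.neutral ballI)
      then show ?thesis by (rule ext)
    qed
    ultimately show ?case by (intro exI[of _ H] exI[of _ "N + M"]) simp
  qed
  then show ?thesis using that by blast
qed

section \<open>Endomorphisms of E as matrices indexed by pairs, and the orbit\<close>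

definition flat :: "complex^'n^'n \<Rightarrow> complex^('n \<times> 'n)" where
  "flat x = (\<chi> p. x $ fst p $ snd p)"

definition unflat :: "complex^('n \<times> 'n) \<Rightarrow> complex^'n^'n" where
  "unflat v = (\<chi> i j. v $ (i, j))"

lemma flat_unflat [simp]: "flat (unflat v) = v" and unflat_flat [simp]: "unflat (flat x) = x"
  by (simp_all add: flat_def unflat_def vec_eq_iff)

definition lin_map :: "complex^('n \<times> 'n)^('n \<times> 'n) \<Rightarrow> complex^'n^'n \<Rightarrow> complex^'n^'n" where
  "lin_map M x = unflat (M *v flat x)"

lemma lin_map_nth: "lin_map M x $ i $ j = (\<Sum>r\<in>UNIV. M $ (i, j) $ r * x $ fst r $ snd r)"
  by (simp add: lin_map_def unflat_def flat_def matrix_vector_mult_def)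

lemma lin_map_add: "lin_map M (x + y) = lin_map M x + lin_map M y"
  by (simp add: vec_eq_iff lin_map_nth algebra_simps sum.distrib)

lemma lin_map_mat_scale: "lin_map M (mat_scale c x) = mat_scale c (lin_map M x)"
  by (simp add: vec_eq_iff lin_map_nth mat_scale_def algebra_simps sum_distrib_left)

lemma lin_map_mult: "lin_map (A ** B) x = lin_map A (lin_map B x)"
  by (simp add: lin_map_def matrix_vector_mul_assoc)

lemma lin_map_1: "lin_map (mat 1) x = x"
  by (simp add: lin_map_def)

lemma lin_map_inject: "lin_map A = lin_map B \<Longrightarrow> A = B"
proof -
  assume "lin_map A = lin_map B"
  then have "lin_map A (unflat v) = lin_map B (unflat v)" for v by simp
  then have "flat (lin_map A (unflat v)) = flat (lin_map B (unflat v))" for v by simp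
  then have "A *v v = B *v v" for v by (simp add: lin_map_def)
  then show "A = B" by (simp add: matrix_eq)
qed

lemma linear_lin_map: "Vector_Spaces.linear mat_scale mat_scale (lin_map M)"
proof -
  interpret vector_space mat_scale by (rule vector_space_mat_scale)
  show ?thesis by unfold_locales (simp_all add: lin_map_add lin_map_mat_scale)
qed

lemma linear_imp_lin_map:
  assumes "Vector_Spaces.linear mat_scale mat_scale (g :: complex^'n^'n \<Rightarrow> complex^'n^'n)"
  shows "\<exists>M. g = lin_map M"
proof -
  interpret g: Vector_Spaces.linear mat_scale mat_scale g by fact
  have fs: "unflat (c *s v) = mat_scale c (unflat v)" "flat (mat_scale c x) = c *s flat x"
      "unflat (v + w) = unflat v + unflat w" "flat (x + y) = flat x + flat y"
    for c v w and x y :: "complex^'n^'n"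
    by (simp_all add: flat_def unflat_def mat_scale_def vec_eq_iff)
  have "Vector_Spaces.linear (*s) (*s) (\<lambda>v. flat (g (unflat v)))"
    by unfold_locales (simp_all add: fs g.add g.scale)
  from matrix_works[OF this] have "flat (g x) = matrix (\<lambda>v. flat (g (unflat v))) *v flat x" for x
    by (metis unflat_flat)
  then have "g x = lin_map (matrix (\<lambda>v. flat (g (unflat v)))) x" for x
    by (metis lin_map_def unflat_flat)
  then show ?thesis by blast
qed

definition pull_det :: "complex^('n::finite \<times> 'n)^('n \<times> 'n) \<Rightarrow> complex^'n^'n \<Rightarrow> complex" where
  "pull_det M = (\<lambda>x. det (lin_map M x))"

text \<open>\<open>act g\<close> composes with the inverse of \<open>g\<close>, and these inverses
  run over all invertible maps as well, so the orbit is parametrized by invertible matrices without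
  an inverse in the formula.\<close>

lemma det_orbit_eq: "(det_orbit :: (complex^'n^'n \<Rightarrow> complex) set) = pull_det ` {M. det M \<noteq> 0}"
proof (intro equalityI subsetI)
  fix q :: "complex^'n^'n \<Rightarrow> complex" assume "q \<in> det_orbit"
  then obtain g where g: "g \<in> GL_E" "q = act g det" by (auto simp: det_orbit_def)
  let ?k = "inv_into UNIV g"
  interpret L: Vector_Spaces.linear mat_scale mat_scale g using g(1) by (simp add: GL_E_def)
  have gk: "g (?k x) = x" and kg: "?k (g x) = x" for x
    using g(1) by (auto simp: GL_E_def bij_is_surj surj_f_inv_f bij_is_inj)
  have k: "?k (x + y) = ?k x + ?k y" "?k (mat_scale c x) = mat_scale c (?k x)" for x y c
    by (metis gk kg L.add, metis gk kg L.scale)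
  have "Vector_Spaces.linear mat_scale mat_scale ?k"
    by unfold_locales (rule k)+
  then obtain M where M: "?k = lin_map M" using linear_imp_lin_map by blast
  obtain A where A: "g = lin_map A" using linear_imp_lin_map L.linear_axioms by blast
  have "lin_map (A ** M) x = lin_map (mat 1) x" for x
    using gk[of x] by (simp add: lin_map_mult lin_map_1 M flip: A)
  then have "A ** M = mat 1" by (intro lin_map_inject) auto
  then have "det A * det M = 1" by (metis det_mul det_I)
  then have "det M \<noteq> 0" by auto
  moreover have "q = pull_det M" by (simp add: g(2) act_def pull_det_def M)
  ultimately show "q \<in> pull_det ` {M. det M \<noteq> 0}" by blast
next
  fix q :: "complex^'n^'n \<Rightarrow> complex" assume "q \<in> pull_det ` {M. det M \<noteq> 0}"
  then obtain M where M: "det M \<noteq> 0" "q = pull_det M" by blast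
  then obtain A where A: "A ** M = mat 1" "M ** A = mat 1"
    by (metis invertible_det_nz invertible_def)
  have inv: "lin_map A (lin_map M x) = x" "lin_map M (lin_map A x) = x" for x
    by (simp_all add: A lin_map_1 flip: lin_map_mult)
  have "bij (lin_map A)" by (rule bij_betw_byWitness[of _ "lin_map M"]) (auto simp: inv)
  then have "lin_map A \<in> GL_E" by (simp add: GL_E_def linear_lin_map)
  moreover have "inv_into UNIV (lin_map A) = lin_map M" by (rule inv_equality) (simp_all add: inv)
  then have "q = act (lin_map A) det" by (simp add: M act_def pull_det_def)
  ultimately show "q \<in> det_orbit" by (auto simp: det_orbit_def)
qed

section \<open>Monomials, the space Q and linear forms on it\<close>

definition monomial_fun :: "('n::finite \<Rightarrow> 'n \<times> 'n) \<Rightarrow> complex^'n^'n \<Rightarrow> complex" where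
  "monomial_fun \<kappa> x = (\<Prod>i\<in>UNIV. x $ fst (\<kappa> i) $ snd (\<kappa> i))"


lemma monomial_fun_in_Q_space: "monomial_fun \<kappa> \<in> (Q_space :: (complex^'n^'n \<Rightarrow> complex) set)"
proof -
  interpret vector_space "fun_scale :: complex \<Rightarrow> (complex^'n^'n \<Rightarrow> complex) \<Rightarrow> _"
    by (rule vector_space_fun_scale)
  obtain h where h: "bij_betw h {..<CARD('n)} (UNIV :: 'n set)"
    by (metis atLeast0LessThan ex_bij_betw_nat_finite finite)
  have "monomial_fun \<kappa> = (\<lambda>x. \<Prod>i<CARD('n). x $ fst (\<kappa> (h i)) $ snd (\<kappa> (h i)))"
    unfolding monomial_fun_def by (rule ext, rule prod.reindex_bij_betw[OF h, symmetric])
  moreover have "linear_form mat_scale UNIV (\<lambda>x. x $ fst (\<kappa> (h i)) $ snd (\<kappa> (h i)))" for i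
    by (simp add: linear_form_def mat_scale_def)
  ultimately have "monomial_fun \<kappa> \<in> {(\<lambda>A. \<Prod>i<CARD('n). l i A) | l. \<forall>i<CARD('n). linear_form mat_scale UNIV (l i)}"
    by (intro CollectI exI[of _ "\<lambda>i x. x $ fst (\<kappa> (h i)) $ snd (\<kappa> (h i))"]) simp
  then show ?thesis unfolding Q_space_def hom_polys_E_def by (rule span_base)
qed

lemma
  shows zero_in_Q_space: "(\<lambda>_. 0) \<in> Q_space"
    and add_in_Q_space: "f \<in> Q_space \<Longrightarrow> g \<in> Q_space \<Longrightarrow> (\<lambda>x. f x + g x) \<in> Q_space"
    and scale_in_Q_space: "f \<in> Q_space \<Longrightarrow> (\<lambda>x. c * f x) \<in> Q_space"
proof -
  interpret vector_space "fun_scale :: complex \<Rightarrow> (complex^'n^'n \<Rightarrow> complex) \<Rightarrow> _"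
    by (rule vector_space_fun_scale)
  show "(\<lambda>_. 0) \<in> (Q_space :: (complex^'n^'n \<Rightarrow> complex) set)"
    using span_zero by (simp add: Q_space_def hom_polys_E_def zero_fun_def)
  show "(\<lambda>x. f x + g x) \<in> Q_space" if "f \<in> Q_space" "g \<in> Q_space" for f g :: "complex^'n^'n \<Rightarrow> complex"
    using span_add that by (simp add: Q_space_def hom_polys_E_def plus_fun_def)
  show "(\<lambda>x. c * f x) \<in> Q_space" if "f \<in> Q_space" for f :: "complex^'n^'n \<Rightarrow> complex"
    using span_scale that by (simp add: Q_space_def hom_polys_E_def fun_scale_def)
qed

lemma sum_in_Q_space:
  "(\<And>i. i \<in> I \<Longrightarrow> f i \<in> Q_space) \<Longrightarrow> (\<lambda>x. \<Sum>i\<in>I. c i * f i x) \<in> Q_space"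
proof (induction I rule: infinite_finite_induct)
  case (insert i I)
  then show ?case
    using add_in_Q_space[OF scale_in_Q_space[of "f i" "c i"], of "\<lambda>x. \<Sum>i\<in>I. c i * f i x"] by simp
qed (simp_all add: zero_in_Q_space)

lemma linear_form_sum:
  assumes \<phi>: "linear_form fun_scale Q_space \<phi>"
  shows "(\<And>i. i \<in> I \<Longrightarrow> f i \<in> Q_space) \<Longrightarrow>
    \<phi> (\<lambda>x. \<Sum>i\<in>I. c i * f i x) = (\<Sum>i\<in>I. c i * \<phi> (f i))"
proof (induction I rule: infinite_finite_induct)
  case (insert i I)
  have "\<phi> ((\<lambda>x. c i * f i x) + (\<lambda>x. \<Sum>i\<in>I. c i * f i x)) =
      \<phi> (\<lambda>x. c i * f i x) + \<phi> (\<lambda>x. \<Sum>i\<in>I. c i * f i x)"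
    using \<phi> insert by (simp add: linear_form_def scale_in_Q_space sum_in_Q_space)
  moreover have "\<phi> (fun_scale (c i) (f i)) = c i * \<phi> (f i)"
    using \<phi> insert by (simp add: linear_form_def)
  then have "\<phi> (\<lambda>x. c i * f i x) = c i * \<phi> (f i)" by (simp only: fun_scale_def)
  ultimately show ?case using insert by (simp add: plus_fun_def)
next
  case empty
  have "\<phi> (fun_scale 0 (\<lambda>_. 0)) = 0 * \<phi> (\<lambda>_. 0)"
    using \<phi> zero_in_Q_space unfolding linear_form_def by blast
  then show ?case by (simp add: fun_scale_def)
next
  case (infinite I)
  have "\<phi> (fun_scale 0 (\<lambda>_. 0)) = 0 * \<phi> (\<lambda>_. 0)"
    using \<phi> zero_in_Q_space unfolding linear_form_def by blast
  then show ?case using infinite by (simp add: fun_scale_def)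
qed

text \<open>Coefficients of \<open>pull_det M\<close> with respect to the family
  \<open>monomial_fun\<close>, in which rearranged \<open>\<kappa>\<close> name the same monomial.
  This redundancy keeps each coefficient a plain sum of products of entries of
  \<open>M\<close>.\<close>

definition pull_coeff :: "complex^('n::finite \<times> 'n)^('n \<times> 'n) \<Rightarrow> ('n \<Rightarrow> 'n \<times> 'n) \<Rightarrow> complex" where
  "pull_coeff M \<kappa> = (\<Sum>\<rho>\<in>UNIV. perm_sign \<rho> * (\<Prod>i\<in>UNIV. M $ (i, \<rho> i) $ \<kappa> i))"

lemma pull_det_expand:
  "pull_det (M :: complex^('n::finite \<times> 'n)^('n \<times> 'n)) = (\<lambda>x. \<Sum>\<kappa>\<in>UNIV. pull_coeff M \<kappa> * monomial_fun \<kappa> x)"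
proof
  fix x :: "complex^'n^'n"
  have "pull_det M x = (\<Sum>\<rho>\<in>UNIV. \<Sum>\<kappa>\<in>UNIV. perm_sign \<rho> * ((\<Prod>i\<in>UNIV. M $ (i, \<rho> i) $ \<kappa> i) * monomial_fun \<kappa> x))"
    unfolding pull_det_def det_perm_sign lin_map_nth prod_sum_UNIV sum_distrib_left
    by (simp add: prod.distrib monomial_fun_def)
  also have "\<dots> = (\<Sum>\<kappa>\<in>UNIV. pull_coeff M \<kappa> * monomial_fun \<kappa> x)"
    unfolding pull_coeff_def sum_distrib_right by (subst sum.swap) (simp add: mult.assoc)
  finally show "pull_det M x = (\<Sum>\<kappa>\<in>UNIV. pull_coeff M \<kappa> * monomial_fun \<kappa> x)" .
qed

lemma pull_det_in_Q_space: "pull_det M \<in> Q_space"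
  unfolding pull_det_expand by (intro sum_in_Q_space monomial_fun_in_Q_space)

lemma linear_form_pull_det:
  "linear_form fun_scale Q_space \<phi> \<Longrightarrow>
   \<phi> (pull_det M) = (\<Sum>\<kappa>\<in>UNIV. pull_coeff M \<kappa> * \<phi> (monomial_fun \<kappa>))"
  unfolding pull_det_expand by (intro linear_form_sum monomial_fun_in_Q_space)

text \<open>A monomial forgets the order of its variables. This is the symmetry that the criterion
  \<open>alt_sum_multilinear_eq_0\<close> asks for.\<close>

lemma monomial_fun_transpose: "monomial_fun (\<kappa> \<circ> Transposition.transpose i j) = monomial_fun \<kappa>"
  unfolding monomial_fun_def comp_def
  by (rule ext, rule prod.reindex_bij_betw[of "Transposition.transpose i j"]) (simp add: permutes_imp_bij permutes_swap_id)

text \<open>With m = \<open>CARD('n)\<close>, a product of 2m linear forms at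
  \<open>pull_det M\<close> is a combination of products of 2 m^2 entries of \<open>M\<close>. These
  factors fall into 2m classes, one for each linear form, and within a class the columns may be
  permuted. Since 2m < m^2, \<open>alt_sum_multilinear_eq_0\<close> kills every term.\<close>

lemma alt_sum_hom_poly:
  fixes F :: "(complex^'n^'n \<Rightarrow> complex) \<Rightarrow> complex"
  assumes F: "F \<in> hom_poly_funs fun_scale Q_space (2 * CARD('n))" and m: "CARD('n) \<ge> 3"
  shows "alt_sum (\<lambda>M. F (pull_det M)) = 0"
  using F
proof induction
  case zero
  then show ?case by (simp add: alt_sum_def)
next
  case (add F G)
  then show ?case by (simp add: alt_sum_add)
next
  case (prod \<phi>s c)
  \<comment> \<open>The linear forms are indexed by a type of size 2m, because the class labels of
    the criterion have to form a finite type.\<close>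
  have "card (UNIV :: (bool \<times> 'n) set) = card {..<2 * CARD('n)}" by simp
  then obtain h where h: "bij_betw h (UNIV :: (bool \<times> 'n) set) {..<2 * CARD('n)}"
    using finite_same_card_bij[of "UNIV :: (bool \<times> 'n) set" "{..<2 * CARD('n)}"] by auto
  define \<phi> where "\<phi> k = \<phi>s ! h k" for k
  have \<phi>: "linear_form fun_scale Q_space (\<phi> k)" for k
  proof -
    have "h k < length \<phi>s" using prod(1) bij_betw_apply[OF h, of k] by simp
    then show ?thesis unfolding \<phi>_def by (intro prod(2) nth_mem)
  qed
  have pl: "prod_list (map (\<lambda>\<phi>. \<phi> q) \<phi>s) = (\<Prod>k\<in>UNIV. \<phi> k q)" for q
  proof -
    have "prod_list (map (\<lambda>\<phi>. \<phi> q) \<phi>s) = (\<Prod>i<2 * CARD('n). (\<phi>s ! i) q)"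
      using prod(1) by (simp add: prod.list_conv_set_nth atLeast0LessThan)
    then show ?thesis unfolding \<phi>_def by (simp add: prod.reindex_bij_betw[OF h, of "\<lambda>i. (\<phi>s ! i) q"])
  qed
  define T where "T R \<kappa> = (\<Prod>k\<in>UNIV. perm_sign (R k) * \<phi> k (monomial_fun (\<lambda>i. \<kappa> (k, i))))"
    for R :: "bool \<times> 'n \<Rightarrow> 'n \<Rightarrow> 'n" and \<kappa> :: "(bool \<times> 'n) \<times> 'n \<Rightarrow> 'n \<times> 'n"
  \<comment> \<open>The row of \<open>M\<close> read at position \<open>snd j\<close> by the linear
    form \<open>fst j\<close>, when \<open>R (fst j)\<close> is the self-map taken from the Leibniz
    expansion in that form.\<close>
  define P where "P R j = (snd j, R (fst j) (snd j))"
    for R :: "bool \<times> 'n \<Rightarrow> 'n \<Rightarrow> 'n" and j :: "(bool \<times> 'n) \<times> 'n"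
  have expand: "(\<Prod>k\<in>UNIV. \<phi> k (pull_det M)) =
      (\<Sum>R\<in>UNIV. \<Sum>\<kappa>\<in>UNIV. T R \<kappa> * (\<Prod>j\<in>UNIV. M $ P R j $ \<kappa> j))" for M
  proof -
    have "\<phi> k (pull_det M) = (\<Sum>\<rho>\<in>UNIV. \<Sum>\<kappa>\<in>UNIV. perm_sign \<rho> * \<phi> k (monomial_fun \<kappa>) *
        (\<Prod>i\<in>UNIV. M $ (i, \<rho> i) $ \<kappa> i))" for k
      unfolding linear_form_pull_det[OF \<phi>] pull_coeff_def sum_distrib_right
      by (subst sum.swap) (simp add: mult_ac)
    then have "(\<Prod>k\<in>UNIV. \<phi> k (pull_det M)) = (\<Sum>R\<in>UNIV. \<Sum>K\<in>UNIV.
        (\<Prod>k\<in>UNIV. perm_sign (R k) * \<phi> k (monomial_fun (K k))) *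
        (\<Prod>k\<in>UNIV. \<Prod>i\<in>UNIV. M $ (i, R k i) $ K k i))"
      by (simp only: prod_sum_UNIV prod.distrib)
    also have "\<dots> = (\<Sum>R\<in>UNIV. \<Sum>\<kappa>\<in>UNIV. T R \<kappa> * (\<Prod>j\<in>UNIV \<times> UNIV. M $ P R j $ \<kappa> j))"
      by (intro sum.cong refl, rule sum.reindex_bij_witness[of _ "\<lambda>\<kappa> k i. \<kappa> (k, i)" "\<lambda>K j. K (fst j) (snd j)"])
        (simp_all add: T_def P_def prod.cartesian_product' del: UNIV_Times_UNIV)
    finally show ?thesis by simp
  qed
  have "alt_sum (\<lambda>M. \<Sum>\<kappa>\<in>UNIV. T R \<kappa> * (\<Prod>j\<in>UNIV. M $ P R j $ \<kappa> j)) = 0" for R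
  proof (rule alt_sum_multilinear_eq_0[where c = fst])
    show "CARD((bool \<times> 'n) \<times> 'n) = 2 * CARD('n \<times> 'n)" by simp
    show "CARD(bool \<times> 'n) < CARD('n \<times> 'n)" using m by simp
    fix \<kappa> :: "(bool \<times> 'n) \<times> 'n \<Rightarrow> 'n \<times> 'n" and j j' :: "(bool \<times> 'n) \<times> 'n"
    assume eq: "fst j = fst j'"
    have "monomial_fun (\<lambda>i. (\<kappa> \<circ> Transposition.transpose j j') (k, i)) = monomial_fun (\<lambda>i. \<kappa> (k, i))" for k
    proof (cases "k = fst j")
      case True
      have "Transposition.transpose j j' (k, i) = (k, Transposition.transpose (snd j) (snd j') i)" for i
        using eq True by (auto simp: Transposition.transpose_def prod_eq_iff)
      then have "(\<lambda>i. (\<kappa> \<circ> Transposition.transpose j j') (k, i)) =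
          (\<lambda>i. \<kappa> (k, i)) \<circ> Transposition.transpose (snd j) (snd j')" by (simp add: comp_def)
      then show ?thesis by (simp only: monomial_fun_transpose)
    next
      case False
      then have "Transposition.transpose j j' (k, i) = (k, i)" for i
        using eq by (auto simp: Transposition.transpose_def)
      then show ?thesis by simp
    qed
    then show "T R (\<kappa> \<circ> Transposition.transpose j j') = T R \<kappa>" by (simp only: T_def)
  qed
  then show ?case by (simp only: pl expand alt_sum_scale alt_sum_sum) simp
qed

text \<open>The constant \<open>c\<close> leaves room for the value at the origin of the denominator
  of a local fraction.\<close>

lemma det_square_not_hom_poly:
  fixes F :: "(complex^'n^'n \<Rightarrow> complex) \<Rightarrow> complex"
  assumes F: "F \<in> hom_poly_funs fun_scale Q_space (2 * CARD('n))" and m: "CARD('n) \<ge> 3"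
    and eq: "\<And>M. c * (det M)\<^sup>2 = F (pull_det M)"
  shows "c = 0"
proof -
  have "c * alt_sum (\<lambda>M :: complex^('n \<times> 'n)^('n \<times> 'n). (det M)\<^sup>2) = 0"
    unfolding alt_sum_scale[symmetric] eq by (rule alt_sum_hom_poly[OF F m])
  then show ?thesis using alt_sum_det_square by auto
qed

section \<open>The Hessian\<close>

lemma poly_funs_sum:
  "(\<And>i. i \<in> I \<Longrightarrow> f i \<in> poly_funs s V) \<Longrightarrow> (\<lambda>q. \<Sum>i\<in>I. f i q) \<in> poly_funs s V"
  by (induction I rule: infinite_finite_induct) (auto intro: poly_funs.const poly_funs.add)

lemma poly_funs_prod:
  "(\<And>i. i \<in> I \<Longrightarrow> f i \<in> poly_funs s V) \<Longrightarrow> (\<lambda>q. \<Prod>i\<in>I. f i q) \<in> poly_funs s V"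
  by (induction I rule: infinite_finite_induct) (auto intro: poly_funs.const poly_funs.mult)

lemma poly_funs_scale: "f \<in> poly_funs s V \<Longrightarrow> (\<lambda>q. c * f q) \<in> poly_funs s V"
  by (rule poly_funs.mult[OF poly_funs.const])

lemma poly_funs_power: "f \<in> poly_funs s V \<Longrightarrow> (\<lambda>q. f q ^ n) \<in> poly_funs s V"
  by (induction n) (auto intro: poly_funs.const poly_funs.mult)

lemma poly_funs_det:
  fixes B :: "'k::finite \<Rightarrow> 'k \<Rightarrow> 'v::ab_group_add \<Rightarrow> complex"
  assumes "\<And>i j. B i j \<in> poly_funs s V"
  shows "(\<lambda>q. det (\<chi> i j. B i j q)) \<in> poly_funs s V"
  unfolding det_perm_sign vec_lambda_beta
  by (intro poly_funs_sum poly_funs_scale poly_funs_prod assms)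

text \<open>One Leibniz term of a characteristic polynomial: \<open>e i\<close> says that the factor
  is a diagonal one and so contains \<open>\<tau>\<close>. The top power survives only if all
  factors do.\<close>

lemma prod_linear_factors_expand:
  assumes b: "\<And>i. b i \<in> poly_funs s V" and "finite I"
  shows "\<exists>c. (\<forall>j. c j \<in> poly_funs s V) \<and> (\<forall>q. c (card I) q = of_bool (\<forall>i\<in>I. e i)) \<and>
    (\<forall>q \<tau>. (\<Prod>i\<in>I. of_bool (e i) * \<tau> - b i q) = (\<Sum>j\<le>card I. c j q * \<tau> ^ j))"
  using \<open>finite I\<close>
proof induction
  case empty
  show ?case by (intro exI[of _ "\<lambda>_ _. 1"]) (simp add: poly_funs.const)
next
  case (insert i I)
  then obtain c where c: "\<And>j. c j \<in> poly_funs s V" "\<And>q. c (card I) q = of_bool (\<forall>i\<in>I. e i)"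
    "\<And>q \<tau>. (\<Prod>i\<in>I. of_bool (e i) * \<tau> - b i q) = (\<Sum>j\<le>card I. c j q * \<tau> ^ j)" by blast
  \<comment> \<open>The guards exclude \<open>j = 0\<close>, where \<open>j - 1\<close> is again 0,
    and \<open>j > card I\<close>, where the induction hypothesis does not determine
    \<open>c j\<close>.\<close>
  define d where "d j = (\<lambda>q. of_bool (j \<noteq> 0 \<and> e i) * c (j - 1) q +
     (- of_bool (j \<le> card I)) * (b i q * c j q))" for j
  have "d j \<in> poly_funs s V" for j
    unfolding d_def by (intro poly_funs.add poly_funs_scale poly_funs.mult b c(1))
  moreover have "d (card (insert i I)) q = of_bool (\<forall>i\<in>insert i I. e i)" for q
    using insert(1,2) by (simp add: d_def c(2))
  moreover have "(\<Prod>i\<in>insert i I. of_bool (e i) * \<tau> - b i q) = (\<Sum>j\<le>card (insert i I). d j q * \<tau> ^ j)"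
    for q \<tau>
  proof -
    have "(\<Sum>j\<le>Suc (card I). d j q * \<tau> ^ j) =
        (\<Sum>j\<le>Suc (card I). (of_bool (j \<noteq> 0 \<and> e i) * c (j - 1) q) * \<tau> ^ j) +
        (\<Sum>j\<le>Suc (card I). ((- of_bool (j \<le> card I)) * (b i q * c j q)) * \<tau> ^ j)"
      by (simp only: d_def distrib_right sum.distrib)
    also have "(\<Sum>j\<le>Suc (card I). (of_bool (j \<noteq> 0 \<and> e i) * c (j - 1) q) * \<tau> ^ j) =
        of_bool (e i) * \<tau> * (\<Sum>j\<le>card I. c j q * \<tau> ^ j)"
      by (subst sum.atMost_Suc_shift) (simp add: sum_distrib_left mult_ac)
    also have "(\<Sum>j\<le>Suc (card I). ((- of_bool (j \<le> card I)) * (b i q * c j q)) * \<tau> ^ j) =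
        - b i q * (\<Sum>j\<le>card I. c j q * \<tau> ^ j)"
      by (simp add: sum_distrib_left mult_ac sum_negf)
    finally have "(\<Sum>j\<le>Suc (card I). d j q * \<tau> ^ j) =
        (of_bool (e i) * \<tau> - b i q) * (\<Sum>j\<le>card I. c j q * \<tau> ^ j)"
      by (simp only: left_diff_distrib mult_minus_left add_uminus_conv_diff)
    then show ?thesis
      by (simp only: prod.insert[OF insert(1,2)] card_insert_disjoint[OF insert(1,2)] c(3))
  qed
  ultimately show ?case by blast
qed

text \<open>Only the identity permutation reaches the top power of \<open>\<tau>\<close>, so the
  polynomial is monic, and its lower coefficients are again polynomial functions.\<close>

lemma char_poly_expand:
  fixes B :: "'k::finite \<Rightarrow> 'k \<Rightarrow> 'v::ab_group_add \<Rightarrow> complex"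
  assumes B: "\<And>i j. B i j \<in> poly_funs s V"
  shows "\<exists>c. (\<forall>j. c j \<in> poly_funs s V) \<and> (\<forall>q. c CARD('k) q = 1) \<and>
    (\<forall>q \<tau>. det (\<chi> i j. of_bool (i = j) * \<tau> - B i j q) = (\<Sum>j\<le>CARD('k). c j q * \<tau> ^ j))"
proof -
  have "\<forall>\<pi>. \<exists>c. (\<forall>j. c j \<in> poly_funs s V) \<and> (\<forall>q. c (CARD('k)) q = of_bool (\<forall>i\<in>UNIV. i = \<pi> i)) \<and>
    (\<forall>q \<tau>. (\<Prod>i\<in>UNIV. of_bool (i = \<pi> i) * \<tau> - B i (\<pi> i) q) = (\<Sum>j\<le>CARD('k). c j q * \<tau> ^ j))"
    by (intro allI prod_linear_factors_expand B finite)
  then obtain c where c: "\<And>\<pi> j. c \<pi> j \<in> poly_funs s V"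
    "\<And>\<pi> q. c \<pi> CARD('k) q = of_bool (\<forall>i\<in>UNIV. i = \<pi> i)"
    "\<And>\<pi> q \<tau>. (\<Prod>i\<in>UNIV. of_bool (i = \<pi> i) * \<tau> - B i (\<pi> i) q) = (\<Sum>j\<le>CARD('k). c \<pi> j q * \<tau> ^ j)"
    by (subst (asm) choice_iff) blast
  show ?thesis
  proof (intro exI[of _ "\<lambda>j q. \<Sum>\<pi>\<in>UNIV. perm_sign \<pi> * c \<pi> j q"] conjI allI)
    show "(\<lambda>q. \<Sum>\<pi>\<in>UNIV. perm_sign \<pi> * c \<pi> j q) \<in> poly_funs s V" for j
      by (intro poly_funs_sum poly_funs_scale c)
    have "of_bool (\<forall>i\<in>UNIV. i = \<pi> i) = (\<Prod>i\<in>UNIV. (mat 1 :: complex^'k^'k) $ i $ \<pi> i)" for \<pi>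
      by (simp add: mat_def prod_of_bool flip: of_bool_def)
    then show "(\<Sum>\<pi>\<in>UNIV. perm_sign \<pi> * c \<pi> CARD('k) q) = 1" for q
      unfolding c(2) using det_perm_sign[of "mat 1 :: complex^'k^'k"] by simp
    show "det (\<chi> i j. of_bool (i = j) * \<tau> - B i j q) =
        (\<Sum>j\<le>CARD('k). (\<Sum>\<pi>\<in>UNIV. perm_sign \<pi> * c \<pi> j q) * \<tau> ^ j)" for q \<tau>
      unfolding det_perm_sign vec_lambda_beta c(3) sum_distrib_left sum_distrib_right
      by (subst sum.swap) (simp only: mult.assoc)
  qed
qed

section \<open>Passing from generic to all matrices by continuity\<close>

lemma eventually_at_notin_finite: "finite A \<Longrightarrow> \<forall>\<^sub>F t in at (a :: 'a::t1_space). t \<notin> A"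
proof -
  assume "finite A"
  then have "open (- (A - {a}))" by (intro open_Compl finite_imp_closed) simp
  then have "\<forall>\<^sub>F t in nhds a. t \<in> - (A - {a})" by (rule eventually_nhds_in_open) simp
  then show ?thesis unfolding eventually_at_filter by (rule eventually_mono) auto
qed

text \<open>The determinant is a monic polynomial in \<open>\<tau>\<close> and has finitely many
  zeros. Together with \<open>continuous_eq_at_0\<close> this extends identities from invertible
  matrices to all matrices along the line \<open>M + mat \<tau>\<close>.\<close>

lemma eventually_det_add_mat_nonzero:
  "\<forall>\<^sub>F \<tau> in at 0. det (M + mat \<tau> :: complex^'k^'k) \<noteq> 0"
proof -
  obtain c where c: "\<forall>q :: complex. c CARD('k) q = 1"
    "\<forall>q \<tau>. det (\<chi> i j. of_bool (i = j) * \<tau> - (\<lambda>_. - M $ i $ j) q) = (\<Sum>j\<le>CARD('k). c j q * \<tau> ^ j)"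
    \<comment> \<open>The matrix is constant here, so the vector space is an arbitrary choice. The
      minus sign turns the characteristic polynomial of \<open>- M\<close> into
      \<open>det (M + mat \<tau>)\<close>.\<close>
    using char_poly_expand[of "\<lambda>i j _. - M $ i $ j" "(*)" UNIV, OF poly_funs.const] by (elim exE conjE)
  have "(\<chi> i j. of_bool (i = j) * \<tau> - (\<lambda>_. - M $ i $ j) 0) = M + mat \<tau>" for \<tau>
    by (simp add: vec_eq_iff mat_def)
  then have d: "det (M + mat \<tau>) = (\<Sum>j\<le>CARD('k). c j 0 * \<tau> ^ j)" for \<tau>
    using spec[OF spec[OF c(2), of 0], of \<tau>] by simp
  have "finite {\<tau>. (\<Sum>j\<le>CARD('k). c j 0 * \<tau> ^ j) = 0}"
    using c(1) by (subst polyfun_finite_roots) (auto intro!: exI[of _ "CARD('k)"])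
  then have "\<forall>\<^sub>F \<tau> in at 0. \<tau> \<notin> {\<tau>. (\<Sum>j\<le>CARD('k). c j 0 * \<tau> ^ j) = 0}"
    by (rule eventually_at_notin_finite)
  then show ?thesis by (simp add: d)
qed

lemma continuous_eq_at_0:
  fixes f g :: "complex \<Rightarrow> complex"
  assumes "continuous_on UNIV f" "continuous_on UNIV g" "\<forall>\<^sub>F \<tau> in at 0. f \<tau> = g \<tau>"
  shows "f 0 = g 0"
proof -
  have "(f \<longlongrightarrow> f 0) (at 0)" "(g \<longlongrightarrow> g 0) (at 0)"
    using assms(1,2) by (auto simp: continuous_on_def)
  moreover have "(f \<longlongrightarrow> g 0) (at 0)"
    using tendsto_cong[OF assms(3)] calculation(2) by simp
  ultimately show ?thesis using tendsto_unique[OF at_neq_bot] by blast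
qed

section \<open>Linear coefficients by a roots-of-unity filter\<close>

definition root_unity :: "nat \<Rightarrow> complex" where
  "root_unity n = exp (2 * of_real pi * \<i> / of_nat n)"

lemma root_unity_power_eq_1: "n > 0 \<Longrightarrow> root_unity n ^ j = 1 \<longleftrightarrow> n dvd j"
proof -
  assume n: "n > 0"
  have "root_unity n ^ j = exp (2 * of_real pi * \<i> * of_nat j / of_nat n)"
    by (simp add: root_unity_def exp_of_nat_mult[symmetric] mult_ac)
  then show ?thesis using complex_root_unity_eq_1[of n j] n by simp
qed

text \<open>
  Extracting the linear coefficient from finitely many values, instead of differentiating, makes it a linear
  form on all functions and keeps the Hessian a polynomial in evaluations.
\<close>

definition lin_coeff :: "nat \<Rightarrow> (complex \<Rightarrow> complex) \<Rightarrow> complex" where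
  "lin_coeff N f = (\<Sum>a<N+2. root_unity (N+2) ^ (a * (N+1)) / of_nat (N+2) * f (root_unity (N+2) ^ a))"

lemma lin_coeff_sum: "lin_coeff N (\<lambda>t. \<Sum>i\<in>I. c i * f i t) = (\<Sum>i\<in>I. c i * lin_coeff N (f i))"
  unfolding lin_coeff_def sum_distrib_left by (subst sum.swap) (simp add: mult_ac)

lemma lin_coeff_scale: "lin_coeff N (\<lambda>t. c * f t) = c * lin_coeff N f"
  using lin_coeff_sum[of N "\<lambda>_. c" "\<lambda>_. f" "{()}"] by simp

text \<open>The weighted average over the roots of unity detects whether \<open>N + 2\<close>
  divides \<open>N + 1 + k\<close>, which for \<open>k \<le> N\<close> happens exactly at
  \<open>k = 1\<close>. The modulus \<open>N + 2\<close> makes this valid for \<open>N = 0\<close>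
  too.\<close>

lemma lin_coeff_power:
  assumes "k \<le> N"
  shows "lin_coeff N (\<lambda>t. t ^ k) = of_bool (k = 1)"
proof -
  let ?w = "root_unity (N+2)" and ?M = "N + 2"
  have "lin_coeff N (\<lambda>t. t ^ k) = (\<Sum>a<?M. (?w ^ (N + 1 + k)) ^ a) / of_nat ?M"
    unfolding lin_coeff_def sum_divide_distrib
    by (intro sum.cong refl) (simp add: power_mult[symmetric] power_add[symmetric] algebra_simps)
  moreover have "(\<Sum>a<?M. (?w ^ (N + 1 + k)) ^ a) = (if k = 1 then of_nat ?M else 0)"
  proof (cases "k = 1")
    case True
    then have "?w ^ (N + 1 + k) = 1" by (subst root_unity_power_eq_1) auto
    then show ?thesis using True by simp
  next
    case False
    have "\<not> ?M dvd N + 1 + k"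
    proof
      assume "?M dvd N + 1 + k"
      then obtain c where c: "N + 1 + k = ?M * c" by (elim dvdE)
      have "c = 0 \<or> c = 1 \<or> c \<ge> 2" by linarith
      moreover have "?M * 2 \<le> ?M * c" if "c \<ge> 2" using that by (intro mult_left_mono) auto
      ultimately show False using c False assms by auto
    qed
    define x where "x = ?w ^ (N + 1 + k)"
    have "x \<noteq> 1"
      unfolding x_def using \<open>\<not> ?M dvd N + 1 + k\<close> root_unity_power_eq_1[of ?M "N + 1 + k"] by auto
    moreover have "x ^ ?M = ?w ^ ((N + 1 + k) * ?M)" unfolding x_def by (simp only: power_mult)
    then have "x ^ ?M = 1" using iffD2[OF root_unity_power_eq_1 dvd_triv_right, of ?M "N + 1 + k"] by simp
    then have "(1 - x) * (\<Sum>a<?M. x ^ a) = 0" by (simp only: one_diff_power_eq[symmetric] diff_self)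
    ultimately show ?thesis using False by (simp only: x_def[symmetric] mult_eq_0_iff) simp
  qed
  ultimately have "lin_coeff N (\<lambda>t. t ^ k) = (if k = 1 then of_nat ?M else 0) / of_nat ?M"
    by (simp only:)
  moreover have "of_nat ?M \<noteq> (0 :: complex)" by (simp only: of_nat_eq_0_iff)
  ultimately show ?thesis by (simp del: of_nat_add)
qed

lemma lin_coeff_poly:
  assumes "Polynomial.degree p \<le> N"
  shows "lin_coeff N (poly p) = Polynomial.coeff p 1"
proof -
  have "poly p = (\<lambda>t. \<Sum>k\<le>N. Polynomial.coeff p k * t ^ k)"
    by (rule ext, subst poly_altdef, rule sum.mono_neutral_left)
      (use assms in \<open>auto simp: coeff_eq_0\<close>)
  then have "lin_coeff N (poly p) = (\<Sum>k\<le>N. Polynomial.coeff p k * lin_coeff N (\<lambda>t. t ^ k))"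
    by (simp only: lin_coeff_sum)
  also have "\<dots> = (\<Sum>k\<le>N. if k = 1 then Polynomial.coeff p 1 else 0)"
    by (intro sum.cong refl) (simp add: lin_coeff_power)
  also have "\<dots> = (if 1 \<le> N then Polynomial.coeff p 1 else 0)"
    by (subst sum.delta) auto
  also have "\<dots> = Polynomial.coeff p 1" using assms by (auto simp: coeff_eq_0)
  finally show ?thesis .
qed

lemma lin_coeff_prod:
  assumes "finite I" "card I \<le> N"
  shows "lin_coeff N (\<lambda>t. \<Prod>i\<in>I. \<alpha> i + t * \<beta> i) = (\<Sum>i\<in>I. \<beta> i * (\<Prod>l\<in>I - {i}. \<alpha> l))"
proof -
  let ?p = "\<Prod>i\<in>I. [:\<alpha> i, \<beta> i:]"
  have "Polynomial.degree ?p \<le> (\<Sum>i\<in>I. Polynomial.degree [:\<alpha> i, \<beta> i:])"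
    using degree_prod_sum_le[OF assms(1), of "\<lambda>i. [:\<alpha> i, \<beta> i:]"] by (simp add: o_def)
  also have "\<dots> \<le> (\<Sum>i\<in>I. 1)" by (intro sum_mono) simp
  finally have "Polynomial.degree ?p \<le> N" using assms by simp
  moreover have "(\<lambda>t. \<Prod>i\<in>I. \<alpha> i + t * \<beta> i) = poly ?p" by (simp add: poly_prod fun_eq_iff)
  ultimately have "lin_coeff N (\<lambda>t. \<Prod>i\<in>I. \<alpha> i + t * \<beta> i) = Polynomial.coeff ?p 1"
    by (simp only: lin_coeff_poly)
  \<comment> \<open>The coefficient of degree 1 is the derivative at 0, so the product rule gives
    the sum.\<close>
  also have "\<dots> = poly (pderiv ?p) 0" by (simp add: coeff_pderiv poly_0_coeff_0)
  also have "\<dots> = (\<Sum>i\<in>I. \<beta> i * (\<Prod>l\<in>I - {i}. \<alpha> l))"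
    by (simp add: pderiv_prod poly_sum poly_prod pderiv_pCons mult.commute)
  finally show ?thesis .
qed


section \<open>The Hessian and its behaviour under linear substitutions\<close>

definition unit_mat :: "'n \<times> 'n \<Rightarrow> complex^'n^'n" where
  "unit_mat p = (\<chi> i j. of_bool (p = (i, j)))"

lemma unit_mat_expand: "(x :: complex^'n^'n) = (\<Sum>p\<in>UNIV. mat_scale (x $ fst p $ snd p) (unit_mat p))"
proof -
  have "(\<Sum>p\<in>UNIV. mat_scale (x $ fst p $ snd p) (unit_mat p)) $ i $ j = x $ i $ j" for i j
  proof -
    have "(\<Sum>p\<in>UNIV. mat_scale (x $ fst p $ snd p) (unit_mat p)) $ i $ j =
      (\<Sum>p\<in>UNIV. if p = (i, j) then x $ i $ j else 0)"
      by (simp add: mat_scale_def unit_mat_def)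
    then show ?thesis by simp
  qed
  then show ?thesis by (simp add: vec_eq_iff)
qed

lemma lin_map_unit_mat:
  "lin_map M (unit_mat r) = (\<Sum>p\<in>UNIV. mat_scale (M $ p $ r) (unit_mat (p :: 'n::finite \<times> 'n)))"
proof -
  have "lin_map M (unit_mat r) $ fst p $ snd p = M $ p $ r" for p
  proof -
    have "lin_map M (unit_mat r) $ fst p $ snd p = (\<Sum>r'\<in>UNIV. if r' = r then M $ p $ r else 0)"
      by (simp add: lin_map_nth unit_mat_def)
    then show ?thesis by simp
  qed
  then show ?thesis using unit_mat_expand[of "lin_map M (unit_mat r)"] by simp
qed

text \<open>For a polynomial \<open>q\<close> of degree at most \<open>CARD('n)\<close>, this is the
  coefficient of \<open>s * t\<close> in \<open>q (x + s u + t v)\<close>, that is, the second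
  derivative at \<open>x\<close> in the directions \<open>u\<close> and \<open>v\<close>.\<close>

definition mixed_coeff :: "(complex^'n^'n \<Rightarrow> complex) \<Rightarrow> complex^'n^'n \<Rightarrow> complex^'n^'n \<Rightarrow> complex^'n^'n \<Rightarrow> complex" where
  "mixed_coeff q x u v = lin_coeff CARD('n) (\<lambda>s. lin_coeff CARD('n) (\<lambda>t. q (x + mat_scale s u + mat_scale t v)))"

text \<open>The product rule applied twice to each Leibniz term. The formula makes bilinearity in
  \<open>u\<close> and \<open>v\<close> and continuity in \<open>x\<close> visible.\<close>

lemma mixed_coeff_det:
  fixes x u v :: "complex^'n^'n"
  shows "mixed_coeff det x u v = (\<Sum>\<rho>\<in>UNIV. perm_sign \<rho> * (\<Sum>k\<in>UNIV. v $ k $ \<rho> k *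
     (\<Sum>i\<in>UNIV - {k}. u $ i $ \<rho> i * (\<Prod>l\<in>UNIV - {k} - {i}. x $ l $ \<rho> l))))"
proof -
  have "lin_coeff CARD('n) (\<lambda>t. det (x + mat_scale s u + mat_scale t v)) =
    (\<Sum>\<rho>\<in>UNIV. perm_sign \<rho> * (\<Sum>k\<in>UNIV. v $ k $ \<rho> k * (\<Prod>i\<in>UNIV - {k}. x $ i $ \<rho> i + s * u $ i $ \<rho> i)))" for s
  proof -
    have "(\<lambda>t. det (x + mat_scale s u + mat_scale t v)) = (\<lambda>t. \<Sum>\<rho>\<in>UNIV. perm_sign \<rho> *
       (\<Prod>i\<in>UNIV. (x $ i $ \<rho> i + s * u $ i $ \<rho> i) + t * v $ i $ \<rho> i))"
      by (simp add: det_perm_sign mat_scale_def)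
    then show ?thesis by (simp only: lin_coeff_sum lin_coeff_prod[OF finite order_refl])
  qed
  then show ?thesis
    unfolding mixed_coeff_def
    by (simp only: lin_coeff_sum lin_coeff_prod[OF finite card_mono[OF finite subset_UNIV]])
qed

lemma mixed_coeff_det_sum_left:
  "mixed_coeff det x (\<Sum>p\<in>I. mat_scale (c p) (u p)) v = (\<Sum>p\<in>I. c p * mixed_coeff det x (u p) v)"
proof (induction I rule: infinite_finite_induct)
  case (insert p I)
  have "mixed_coeff det x (mat_scale a y + z) v = a * mixed_coeff det x y v + mixed_coeff det x z v"
    for a and y z :: "complex^'a^'a"
    by (simp add: mixed_coeff_det mat_scale_def sum.distrib sum_distrib_left distrib_left distrib_right mult_ac)
  then show ?case using insert by simp
qed (simp_all add: mixed_coeff_det)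

lemma mixed_coeff_det_sum_right:
  "mixed_coeff det x u (\<Sum>p\<in>I. mat_scale (c p) (v p)) = (\<Sum>p\<in>I. c p * mixed_coeff det x u (v p))"
proof (induction I rule: infinite_finite_induct)
  case (insert p I)
  have "mixed_coeff det x u (mat_scale a y + z) = a * mixed_coeff det x u y + mixed_coeff det x u z"
    for a and y z :: "complex^'a^'a"
    by (simp add: mixed_coeff_det mat_scale_def sum.distrib sum_distrib_left distrib_left distrib_right mult_ac)
  then show ?case using insert by simp
qed (simp_all add: mixed_coeff_det)

definition hess :: "(complex^'n^'n \<Rightarrow> complex) \<Rightarrow> complex^'n^'n \<Rightarrow> complex^('n \<times> 'n)^('n \<times> 'n)" where
  "hess q x = (\<chi> p r. mixed_coeff q x (unit_mat p) (unit_mat r))"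

text \<open>The chain rule for a linear substitution. Taking determinants, the two outer factors
  produce \<open>(det M)\<^sup>2\<close>.\<close>

lemma hess_pull_det:
  "hess (pull_det M) x = Finite_Cartesian_Product.transpose M ** hess det (lin_map M x) ** M"
proof -
  have "hess (pull_det M) x $ p $ r =
      (Finite_Cartesian_Product.transpose M ** hess det (lin_map M x) ** M) $ p $ r" for p r
  proof -
    have "mixed_coeff (pull_det M) x u v = mixed_coeff det (lin_map M x) (lin_map M u) (lin_map M v)" for u v
      by (simp add: mixed_coeff_def pull_det_def lin_map_add lin_map_mat_scale)
    then have "hess (pull_det M) x $ p $ r =
        (\<Sum>r'\<in>UNIV. M $ r' $ r * (\<Sum>p'\<in>UNIV. M $ p' $ p * hess det (lin_map M x) $ p' $ r'))"
      by (simp add: hess_def lin_map_unit_mat mixed_coeff_det_sum_left mixed_coeff_det_sum_right)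
    then show ?thesis
      by (simp add: matrix_matrix_mult_def Finite_Cartesian_Product.transpose_def mult.commute)
  qed
  then show ?thesis by (simp add: vec_eq_iff)
qed

lemma det_hess_pull_det: "det (hess (pull_det M) x) = (det M)\<^sup>2 * det (hess det (lin_map M x))"
  by (simp add: hess_pull_det det_mul power2_eq_square)

lemma det_hess_scale: "det (hess (\<lambda>x. c * q x) x) = c ^ (CARD('n) * CARD('n)) * det (hess q (x :: complex^'n^'n))"
proof -
  have "hess (\<lambda>x. c * q x) x = (\<chi> p. c *s (hess q x $ p))"
    by (simp add: vec_eq_iff hess_def mixed_coeff_def lin_coeff_scale)
  then show ?thesis by (simp add: det_rows_mul)
qed

text \<open>The matrix of left multiplication by \<open>y\<close>. It changes \<open>det\<close>
  only by the constant \<open>det y\<close>, so it carries the Hessian at the identity to the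
  Hessian at \<open>y\<close>.\<close>

definition left_mult_mat :: "complex^'n^'n \<Rightarrow> complex^('n \<times> 'n)^('n \<times> 'n)" where
  "left_mult_mat y = (\<chi> p r. if snd p = snd r then y $ fst p $ fst r else 0)"

lemma lin_map_left_mult_mat: "lin_map (left_mult_mat y) x = y ** (x :: complex^'n^'n)"
proof -
  have "lin_map (left_mult_mat y) x $ i $ j = (y ** x) $ i $ j" for i j
  proof -
    have "lin_map (left_mult_mat y) x $ i $ j = (\<Sum>r\<in>UNIV \<times> UNIV. if j = snd r then y $ i $ fst r * x $ fst r $ snd r else 0)"
      by (simp add: lin_map_nth left_mult_mat_def) (intro sum.cong, auto)
    also have "\<dots> = (y ** x) $ i $ j"
      by (simp add: sum.cartesian_product' matrix_matrix_mult_def del: UNIV_Times_UNIV)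
    finally show ?thesis .
  qed
  then show ?thesis by (simp add: vec_eq_iff)
qed

text \<open>Up to ordering, the matrix is block diagonal with the block \<open>y\<close> for column
  \<open>j\<close> and identity blocks for the others. Only permutations supported on column
  \<open>j\<close> contribute, and they correspond to permutations of \<open>'n\<close>.\<close>

lemma left_mult_mat_column:
  fixes y :: "complex^'n^'n" and j :: 'n
  shows "det (\<chi> p r. if snd p = snd r then (if snd p = j then y $ fst p $ fst r else of_bool (fst p = fst r)) else 0) = det y"
    (is "det ?B = _")
proof -
  let ?f = "\<lambda>i. (i, j) :: 'n \<times> 'n"
  have inj: "inj ?f" by (auto simp: inj_def)
  let ?h = "map_permutation UNIV ?f"
  have h: "?h \<sigma> p = (if snd p = j then (\<sigma> (fst p), j) else p)" for \<sigma> p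
    by (cases p) (auto simp: map_permutation_def restrict_id_def inv_into_f_f[OF inj])
  have "det ?B = (\<Sum>\<pi> | \<pi> permutes range ?f. of_int (sign \<pi>) * (\<Prod>p\<in>UNIV. ?B $ p $ \<pi> p))"
    unfolding det_def
  proof (rule sum.mono_neutral_right)
    show "\<forall>\<pi>\<in>{\<pi>. \<pi> permutes UNIV} - {\<pi>. \<pi> permutes range ?f}. of_int (sign \<pi>) * (\<Prod>p\<in>UNIV. ?B $ p $ \<pi> p) = 0"
    proof
      fix \<pi> assume \<pi>: "\<pi> \<in> {\<pi>. \<pi> permutes UNIV} - {\<pi>. \<pi> permutes range ?f}"
      then have "\<exists>p. p \<notin> range ?f \<and> \<pi> p \<noteq> p" using permutes_superset[of \<pi> UNIV "range ?f"] by auto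
      then obtain p where p: "p \<notin> range ?f" "\<pi> p \<noteq> p" by blast
      \<comment> \<open>Outside column \<open>j\<close>, the only nonzero entry in row
        \<open>p\<close> is the diagonal one.\<close>
      then have "?B $ p $ \<pi> p = 0" by (cases p; cases "\<pi> p") auto
      then have "(\<Prod>p\<in>UNIV. ?B $ p $ \<pi> p) = 0"
        by (intro prod_zero finite bexI[of _ p]) simp_all
      then show "of_int (sign \<pi>) * (\<Prod>p\<in>UNIV. ?B $ p $ \<pi> p) = 0" by simp
    qed
  qed (auto intro: permutes_subset)
  also have "\<dots> = (\<Sum>\<sigma> | \<sigma> permutes UNIV. of_int (sign (?h \<sigma>)) * (\<Prod>p\<in>UNIV. ?B $ p $ ?h \<sigma> p))"
  proof (rule sum.reindex_bij_betw[symmetric], rule bij_betw_byWitness[where f' = "map_permutation (range ?f) fst"])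
    have f: "bij_betw ?f UNIV (range ?f)" using inj by (simp add: bij_betw_def)
    have g: "bij_betw fst (range ?f) UNIV" by (auto simp: bij_betw_def inj_on_def image_image)
    show "\<forall>\<sigma>\<in>{\<sigma>. \<sigma> permutes UNIV}. map_permutation (range ?f) fst (?h \<sigma>) = \<sigma>"
      by (intro ballI map_permutation_compose_inv[OF f]) auto
    show "\<forall>\<pi>\<in>{\<pi>. \<pi> permutes range ?f}. ?h (map_permutation (range ?f) fst \<pi>) = \<pi>"
      by (intro ballI map_permutation_compose_inv[OF g]) auto
    show "?h ` {\<sigma>. \<sigma> permutes UNIV} \<subseteq> {\<pi>. \<pi> permutes range ?f}"
      using map_permutation_permutes[OF f] by auto
    show "map_permutation (range ?f) fst ` {\<pi>. \<pi> permutes range ?f} \<subseteq> {\<sigma>. \<sigma> permutes UNIV}"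
      using map_permutation_permutes[OF g] by auto
  qed
  also have "\<dots> = det y"
    unfolding det_def
  proof (intro sum.cong refl)
    fix \<sigma> :: "'n \<Rightarrow> 'n" assume "\<sigma> \<in> {\<sigma>. \<sigma> permutes UNIV}"
    then have "sign (?h \<sigma>) = sign \<sigma>" using inj by (intro sign_map_permutation) auto
    moreover have "(\<Prod>p\<in>UNIV. ?B $ p $ ?h \<sigma> p) = (\<Prod>p\<in>range ?f. ?B $ p $ ?h \<sigma> p)"
      by (rule prod.mono_neutral_right) (auto simp: h)
    moreover have "\<dots> = (\<Prod>i\<in>UNIV. y $ i $ \<sigma> i)"
      by (subst prod.reindex[OF inj]) (simp add: h)
    ultimately show "of_int (sign (?h \<sigma>)) * (\<Prod>p\<in>UNIV. ?B $ p $ ?h \<sigma> p) = of_int (sign \<sigma>) * (\<Prod>i\<in>UNIV. y $ i $ \<sigma> i)"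
      by simp
  qed
  finally show ?thesis .
qed

text \<open>Left multiplication acts on each column separately. \<open>C S\<close> acts by
  \<open>y\<close> on the columns in \<open>S\<close> only, and splitting off one column at a time
  gives a factor \<open>det y\<close>.\<close>

lemma det_left_mult_mat: "det (left_mult_mat (y :: complex^'n^'n)) = det y ^ CARD('n)"
proof -
  define C where "C S = (\<chi> p r. if snd p = snd r then (if snd p \<in> S then y $ fst p $ fst r
    else of_bool (fst p = fst r)) else 0 :: complex^('n \<times> 'n)^('n \<times> 'n))" for S
  have "det (C S) = det y ^ card S" if "finite S" for S
    using that
  proof induction
    case empty
    have "C {} = mat 1" by (auto simp: C_def vec_eq_iff mat_def)
    then show ?case by simp
  next
    case (insert j S)
    let ?B = "\<chi> p r. if snd p = snd r then (if snd p = j then y $ fst p $ fst r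
      else of_bool (fst p = fst r)) else 0 :: complex^('n \<times> 'n)^('n \<times> 'n)"
    have "C (insert j S) $ p $ r = (?B ** C S) $ p $ r" for p r
    proof -
      obtain i b where p: "p = (i, b)" by (cases p)
      obtain k c where r: "r = (k, c)" by (cases r)
      have "(?B ** C S) $ p $ r = (\<Sum>a\<in>UNIV. \<Sum>d\<in>UNIV. if d = b then ?B $ p $ (a, b) * C S $ (a, b) $ r else 0)"
        unfolding matrix_matrix_mult_def UNIV_Times_UNIV[symmetric] vec_lambda_beta sum.cartesian_product'
        by (intro sum.cong refl) (auto simp: p)
      also have "\<dots> = (\<Sum>a\<in>UNIV. ?B $ p $ (a, b) * C S $ (a, b) $ r)"
        by simp
      also have "\<dots> = (\<Sum>a\<in>UNIV. if a = (if b = j then k else i) then C (insert j S) $ p $ r else 0)"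
        using insert(2) by (intro sum.cong refl) (auto simp: C_def p r)
      finally show ?thesis by simp
    qed
    then have "C (insert j S) = ?B ** C S" by (simp add: vec_eq_iff)
    then show ?case using insert by (simp add: det_mul left_mult_mat_column)
  qed
  moreover have "left_mult_mat y = C UNIV" by (simp add: left_mult_mat_def C_def vec_eq_iff)
  ultimately show ?thesis by simp
qed

text \<open>The second-order part of det(1 + x) is (tr(x)^2 - tr(x^2)) / 2, and its polarization is
  tr(u) tr(v) - tr(u v), evaluated here at unit matrices.\<close>

lemma hess_det_1:
  "hess det (mat 1 :: complex^'n^'n) $ p $ r =
    of_bool (fst p = snd p \<and> fst r = snd r) - of_bool (snd p = fst r \<and> fst p = snd r)"
proof -
  obtain i0 j0 where p: "p = (i0, j0)" by (cases p)
  obtain k0 l0 where r: "r = (k0, l0)" by (cases r)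
  \<comment> \<open>The condition for the Leibniz term of \<open>\<rho>\<close> to survive: it sends
    \<open>i0\<close> to \<open>j0\<close> and \<open>k0\<close> to \<open>l0\<close>, with
    \<open>i0\<close> and \<open>k0\<close> distinct, and fixes everything else.\<close>
  let ?g = "\<lambda>\<rho>. of_bool (l0 = \<rho> k0 \<and> i0 \<noteq> k0 \<and> j0 = \<rho> i0 \<and> (\<forall>l\<in>UNIV - {k0} - {i0}. l = \<rho> l)) :: complex"
  have pick: "(\<Sum>k\<in>A. of_bool ((a, b) = (k, \<rho> k)) * S k) = of_bool (a \<in> A \<and> b = \<rho> a) * S a"
    for A and a b :: 'n and \<rho> and S :: "'n \<Rightarrow> complex"
  proof -
    have "(\<Sum>k\<in>A. of_bool ((a, b) = (k, \<rho> k)) * S k) = (\<Sum>k\<in>A. if k = a then of_bool (b = \<rho> a) * S a else 0)"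
      by (intro sum.cong) auto
    then show ?thesis by simp
  qed
  have pr: "(\<Prod>l\<in>UNIV - {k0} - {i0}. (mat 1 :: complex^'n^'n) $ l $ \<rho> l) =
      of_bool (\<forall>l\<in>UNIV - {k0} - {i0}. l = \<rho> l)" for \<rho>
    by (simp add: mat_def prod_of_bool flip: of_bool_def)
  have "(\<Sum>k\<in>UNIV. of_bool ((k0, l0) = (k, \<rho> k)) * (\<Sum>i\<in>UNIV - {k}. of_bool ((i0, j0) = (i, \<rho> i)) *
      (\<Prod>l\<in>UNIV - {k} - {i}. (mat 1 :: complex^'n^'n) $ l $ \<rho> l))) = ?g \<rho>" for \<rho>
    unfolding pick pr by (cases "l0 = \<rho> k0"; cases "i0 = k0"; cases "j0 = \<rho> i0") simp_all
  moreover have "unit_mat a $ i $ j = of_bool (a = (i, j))" for a and i j :: 'n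
    by (simp add: unit_mat_def)
  ultimately have "hess det (mat 1 :: complex^'n^'n) $ p $ r = (\<Sum>\<rho>\<in>UNIV. perm_sign \<rho> * ?g \<rho>)"
    by (simp only: hess_def mixed_coeff_det vec_lambda_beta p r)
  also have "\<dots> = (if i0 = k0 then 0 else of_bool (l0 = k0 \<and> j0 = i0) - of_bool (l0 = i0 \<and> j0 = k0))"
  proof (cases "i0 = k0")
    case False
    \<comment> \<open>Besides the identity, this is the only permutation that fixes all indices
      except \<open>i0\<close> and \<open>k0\<close>.\<close>
    let ?t = "Transposition.transpose i0 k0"
    have nt: "id \<noteq> ?t" using False by (auto simp: fun_eq_iff Transposition.transpose_def)
    have "(\<Sum>\<rho>\<in>UNIV. perm_sign \<rho> * ?g \<rho>) = (\<Sum>\<rho>\<in>{id, ?t}. perm_sign \<rho> * ?g \<rho>)"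
    proof (rule sum.mono_neutral_right)
      show "\<forall>\<rho>\<in>UNIV - {id, ?t}. perm_sign \<rho> * ?g \<rho> = 0"
      proof
        fix \<rho> assume \<rho>: "\<rho> \<in> UNIV - {id, ?t}"
        have "\<not> (\<rho> permutes UNIV \<and> (\<forall>l\<in>UNIV - {k0} - {i0}. l = \<rho> l))"
        proof
          assume a: "\<rho> permutes UNIV \<and> (\<forall>l\<in>UNIV - {k0} - {i0}. l = \<rho> l)"
          have "\<rho> permutes {i0, k0}"
            by (rule permutes_superset[of _ UNIV]) (use a in auto)
          then show False using \<rho> by (simp add: permutes_doubleton_iff)
        qed
        then show "perm_sign \<rho> * ?g \<rho> = 0" by (auto simp: perm_sign_def)
      qed
    qed auto
    also have "\<dots> = ?g id - ?g ?t"
      using nt False by (simp add: perm_sign_def permutes_id permutes_swap_id sign_swap_id)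
    finally show ?thesis using False by (auto simp: Transposition.transpose_def)
  qed simp
  finally show ?thesis by (auto simp: p r)
qed

text \<open>A kernel vector, read as a matrix with trace \<open>t\<close>, has to be
  \<open>t\<close> times the identity. Comparing traces gives \<open>t = m t\<close> with m =
  \<open>CARD('n)\<close> different from 1, so it vanishes.\<close>

lemma det_hess_det_1_nonzero:
  assumes "CARD('n) \<ge> 2"
  shows "det (hess det (mat 1 :: complex^'n^'n)) \<noteq> 0"
proof -
  let ?K = "hess det (mat 1 :: complex^'n^'n)"
  have "v = 0" if v: "?K *v v = 0" for v
  proof -
    define t where "t = (\<Sum>k\<in>UNIV. v $ (k, k))"
    have K: "(?K *v v) $ (i, j) = of_bool (i = j) * t - v $ (j, i)" for i j
    proof -
      have "(?K *v v) $ (i, j) = (\<Sum>k\<in>UNIV. \<Sum>l\<in>UNIV. (of_bool (i = j) * of_bool (k = l)) * v $ (k, l)) -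
          (\<Sum>k\<in>UNIV. \<Sum>l\<in>UNIV. of_bool (j = k) * of_bool (i = l) * v $ (k, l))"
        unfolding matrix_vector_mult_def UNIV_Times_UNIV[symmetric] vec_lambda_beta sum.cartesian_product'
          hess_det_1 by (simp add: left_diff_distrib sum_subtractf of_bool_conj)
      also have "(\<Sum>k\<in>UNIV. \<Sum>l\<in>UNIV. (of_bool (i = j) * of_bool (k = l)) * v $ (k, l)) = of_bool (i = j) * t"
        by (simp add: t_def of_bool_def if_distrib[of "\<lambda>x. x * _"] cong: if_cong)
      also have "(\<Sum>k\<in>UNIV. \<Sum>l\<in>UNIV. of_bool (j = k) * of_bool (i = l) * v $ (k, l)) =
          (\<Sum>k\<in>UNIV. \<Sum>l\<in>UNIV. if l = i then (if k = j then v $ (j, i) else 0) else 0)"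
        by (intro sum.cong refl) auto
      also have "\<dots> = v $ (j, i)" by simp
      finally show ?thesis .
    qed
    have e: "v $ (j, i) = of_bool (i = j) * t" for i j using K[of i j] v by simp
    have "t = (\<Sum>k\<in>(UNIV :: 'n set). t)" by (subst t_def) (simp only: e of_bool_eq simp_thms mult_1_left)
    then have "t = of_nat CARD('n) * t" by simp
    then have "(of_nat CARD('n) - 1) * t = 0" by (simp add: algebra_simps)
    moreover have "of_nat CARD('n) \<noteq> (1 :: complex)"
    proof
      assume "of_nat CARD('n) = (1 :: complex)"
      then have "CARD('n) = 1" by (simp only: of_nat_eq_1_iff)
      then show False using assms by simp
    qed
    ultimately have "t = 0" by simp
    then show "v = 0" using e by (auto simp: vec_eq_iff)
  qed
  then have "invertible ?K"
    using matrix_left_invertible_ker[of ?K] invertible_left_inverse[of ?K] by blast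
  then show ?thesis by (simp add: invertible_det_nz)
qed

text \<open>For invertible \<open>y\<close>, the Hessian determinant of
  \<open>\<lambda>x. det (y ** x)\<close> at the identity is computed twice: as a rescaling of
  \<open>det\<close> and by the chain rule. Singular \<open>y\<close> follow by continuity.\<close>

lemma det_hess_det:
  fixes y :: "complex^'n^'n"
  assumes m: "CARD('n) \<ge> 2"
  shows "det (hess det y) = det (hess det (mat 1 :: complex^'n^'n)) * det y ^ (CARD('n) * CARD('n) - 2 * CARD('n))"
proof -
  let ?H1 = "det (hess det (mat 1 :: complex^'n^'n))" and ?N = "CARD('n) * CARD('n) - 2 * CARD('n)"
  have N: "CARD('n) * CARD('n) = 2 * CARD('n) + ?N"
    using mult_le_mono1[OF m, of "CARD('n)"] by linarith
  have inv: "det (hess det y) = ?H1 * det y ^ ?N" if "det y \<noteq> 0" for y :: "complex^'n^'n"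
  proof -
    have "pull_det (left_mult_mat y) = (\<lambda>x. det y * det x)"
      by (simp add: pull_det_def lin_map_left_mult_mat det_mul)
    then have "det y ^ (CARD('n) * CARD('n)) * ?H1 = (det y ^ CARD('n))\<^sup>2 * det (hess det y)"
      using det_hess_pull_det[of "left_mult_mat y" "mat 1"] det_hess_scale[of "det y" det "mat 1 :: complex^'n^'n"]
      by (simp add: det_left_mult_mat lin_map_left_mult_mat)
    moreover have "det y ^ (CARD('n) * CARD('n)) = (det y ^ CARD('n))\<^sup>2 * det y ^ ?N"
      by (subst N) (simp only: power_add power_mult mult.commute[of 2])
    ultimately show ?thesis using that by (auto simp: mult.commute)
  qed
  have comp: "(y + mat \<tau>) $ i $ j = y $ i $ j + \<tau> * of_bool (i = j)" for \<tau> i j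
    by (simp add: mat_def)
  let ?f = "\<lambda>\<tau>. det (hess det (y + mat \<tau>))" and ?g = "\<lambda>\<tau>. ?H1 * det (y + mat \<tau>) ^ ?N"
  have "continuous_on UNIV ?f"
    unfolding det_perm_sign hess_def mixed_coeff_det vec_lambda_beta comp by (intro continuous_intros)
  moreover have "continuous_on UNIV ?g"
    unfolding det_perm_sign[of "y + _"] comp by (intro continuous_intros)
  moreover have "\<forall>\<^sub>F \<tau> in at 0. ?f \<tau> = ?g \<tau>"
    using eventually_det_add_mat_nonzero[of y] by (rule eventually_mono) (rule inv)
  ultimately have "?f 0 = ?g 0" by (rule continuous_eq_at_0)
  moreover have "mat 0 = (0 :: complex^'n^'n)" by (simp add: mat_def vec_eq_iff)
  ultimately show ?thesis by simp
qed

section \<open>Spanning all evaluations on Q by finitely many\<close>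

lemma linear_form_mat_expand:
  assumes "linear_form mat_scale UNIV l"
  shows "l x = (\<Sum>p\<in>UNIV. l (unit_mat p) * x $ fst p $ snd (p :: 'n::finite \<times> 'n))"
proof -
  have l: "l (y + z) = l y + l z" "l (mat_scale c y) = c * l y" for y z c
    using assms by (auto simp: linear_form_def)
  have 0: "l 0 = 0" using l(1)[of 0 0] by simp
  have "l (\<Sum>p\<in>I. mat_scale (c p) (u p)) = (\<Sum>p\<in>I. l (u p) * c p)" for I :: "('n \<times> 'n) set" and c u
    by (induction I rule: infinite_finite_induct) (auto simp: l 0)
  then show ?thesis using arg_cong[OF unit_mat_expand[of x], of l] by (simp only:)
qed

lemma Q_space_expand:
  assumes "q \<in> (Q_space :: (complex^'n^'n \<Rightarrow> complex) set)"
  shows "\<exists>c. \<forall>x. q x = (\<Sum>\<kappa>\<in>UNIV. c \<kappa> * monomial_fun \<kappa> x)"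
proof -
  interpret vector_space "fun_scale :: complex \<Rightarrow> (complex^'n^'n \<Rightarrow> complex) \<Rightarrow> _"
    by (rule vector_space_fun_scale)
  obtain h where h: "bij_betw h (UNIV :: 'n set) {..<CARD('n)}"
    by (metis atLeast0LessThan ex_bij_betw_finite_nat finite)
  show ?thesis
    using assms unfolding Q_space_def hom_polys_E_def
  proof (induct rule: span_induct_alt)
    case base
    show ?case by (intro exI[of _ "\<lambda>_. 0"]) simp
  next
    case (step a f q)
    then obtain l where l: "f = (\<lambda>x. \<Prod>i<CARD('n). l i x)"
      "\<forall>i<CARD('n). linear_form mat_scale UNIV (l i)" by auto
    obtain c where c: "\<forall>x. q x = (\<Sum>\<kappa>\<in>UNIV. c \<kappa> * monomial_fun \<kappa> x)" using step(2) by blast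
    have "f x = (\<Sum>\<kappa>\<in>UNIV. (\<Prod>i\<in>UNIV. l (h i) (unit_mat (\<kappa> i))) * monomial_fun \<kappa> x)" for x
    proof -
      have "f x = (\<Prod>i\<in>UNIV. l (h i) x)"
        unfolding l(1) by (rule prod.reindex_bij_betw[OF h, symmetric])
      also have "\<dots> = (\<Prod>i\<in>UNIV. \<Sum>p\<in>UNIV. l (h i) (unit_mat p) * x $ fst p $ snd p)"
        using l(2) bij_betw_apply[OF h] by (intro prod.cong refl linear_form_mat_expand) auto
      also have "\<dots> = (\<Sum>\<kappa>\<in>UNIV. (\<Prod>i\<in>UNIV. l (h i) (unit_mat (\<kappa> i))) * monomial_fun \<kappa> x)"
        unfolding prod_sum_UNIV by (simp only: prod.distrib monomial_fun_def)
      finally show ?thesis .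
    qed
    then show ?case
      by (intro exI[of _ "\<lambda>\<kappa>. a * (\<Prod>i\<in>UNIV. l (h i) (unit_mat (\<kappa> i))) + c \<kappa>"])
        (simp add: c fun_scale_def distrib_right sum.distrib sum_distrib_left mult.assoc)
  qed
qed

text \<open>An evaluation at \<open>y\<close> depends only on the vector \<open>ver y\<close> of
  monomial values. A basis of the span of these vectors can be chosen among them, and its preimages
  are the sample points.\<close>

lemma evaluations_finitely_spanned:
  "\<exists>(x :: ('n \<Rightarrow> 'n \<times> 'n) \<Rightarrow> complex^'n^'n) l.
    \<forall>q\<in>Q_space. \<forall>y. q y = (\<Sum>k\<in>UNIV. l y k * q (x k))"
proof -
  define ver :: "complex^'n^'n \<Rightarrow> complex^('n \<Rightarrow> 'n \<times> 'n)" where "ver y = (\<chi> \<kappa>. monomial_fun \<kappa> y)" for y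
  obtain B where B: "B \<subseteq> range ver" "vec.independent B" "range ver \<subseteq> vec.span B" "card B = vec.dim (range ver)"
    using vec.basis_exists[of "range ver"] by blast
  have fin: "finite B" using B(2) by (rule vec.finiteI_independent)
  have "card B \<le> CARD('n \<Rightarrow> 'n \<times> 'n)"
    unfolding B(4) by (rule dim_subset_UNIV_cart_gen)
  then obtain h where h: "inj_on h B" "h ` B \<subseteq> (UNIV :: ('n \<Rightarrow> 'n \<times> 'n) set)"
    using card_le_inj[OF fin finite] by blast
  have "\<forall>b\<in>B. \<exists>y. ver y = b" using B(1) by auto
  then obtain pre where pre: "\<And>b. b \<in> B \<Longrightarrow> ver (pre b) = b" by metis
  have "\<forall>y. \<exists>u. ver y = (\<Sum>b\<in>B. u b *s b)"
    using B(3) vec.span_finite[OF fin] by auto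
  then obtain u where u: "\<And>y. ver y = (\<Sum>b\<in>B. u y b *s b)" by metis
  \<comment> \<open>Indices outside the image of \<open>h\<close> are padding and get the
    coefficient 0.\<close>
  let ?l = "\<lambda>y k. if k \<in> h ` B then u y (inv_into B h k) else 0"
  let ?x = "\<lambda>k. pre (inv_into B h k)"
  have ver: "ver y = (\<Sum>k\<in>UNIV. ?l y k *s ver (?x k))" for y
  proof -
    have "(\<Sum>k\<in>UNIV. ?l y k *s ver (?x k)) = (\<Sum>k\<in>h ` B. u y (inv_into B h k) *s ver (?x k))"
      by (intro sum.mono_neutral_cong_right) auto
    also have "\<dots> = (\<Sum>b\<in>B. u y b *s b)"
      by (subst sum.reindex[OF h(1)]) (intro sum.cong refl, simp add: h(1) pre)
    finally show ?thesis using u by simp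
  qed
  show ?thesis
  proof (intro exI[of _ ?x] exI[of _ ?l] ballI allI)
    fix q :: "complex^'n^'n \<Rightarrow> complex" and y assume "q \<in> Q_space"
    then obtain c where c: "\<And>y. q y = (\<Sum>\<kappa>\<in>UNIV. c \<kappa> * ver y $ \<kappa>)"
      using Q_space_expand unfolding ver_def vec_lambda_beta by blast
    have "q y = (\<Sum>\<kappa>\<in>UNIV. \<Sum>k\<in>UNIV. c \<kappa> * (?l y k * ver (?x k) $ \<kappa>))"
      unfolding c[of y] by (subst ver) (simp only: sum_component vector_smult_component sum_distrib_left)
    also have "\<dots> = (\<Sum>k\<in>UNIV. ?l y k * q (?x k))"
      unfolding c[of "?x _"] sum_distrib_left by (subst sum.swap) (simp only: mult_ac)
    finally show "q y = (\<Sum>k\<in>UNIV. ?l y k * q (?x k))" .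
  qed
qed

section \<open>Integral closedness of localizations\<close>

text \<open>
  \<open>homog_eval R a b [c\<^sub>k, \<dots>, c\<^sub>0]\<close> is \<open>c\<^sub>k a\<^sup>k + c\<^sub>k\<^sub>-\<^sub>1 a\<^sup>k\<^sup>-\<^sup>1 b + \<dots> + c\<^sub>0 b\<^sup>k\<close>.
\<close>

fun homog_eval :: "('a, 'b) ring_scheme \<Rightarrow> 'a \<Rightarrow> 'a \<Rightarrow> 'a list \<Rightarrow> 'a" where
  "homog_eval R a b [] = \<zero>\<^bsub>R\<^esub>"
| "homog_eval R a b (c # cs) = c \<otimes>\<^bsub>R\<^esub> (a [^]\<^bsub>R\<^esub> length cs) \<oplus>\<^bsub>R\<^esub> b \<otimes>\<^bsub>R\<^esub> homog_eval R a b cs"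

lemma homog_eval_closed:
  assumes "cring R" "a \<in> carrier R" "b \<in> carrier R"
  shows "set cs \<subseteq> carrier R \<Longrightarrow> homog_eval R a b cs \<in> carrier R"
proof -
  interpret cring R by fact
  show "set cs \<subseteq> carrier R \<Longrightarrow> homog_eval R a b cs \<in> carrier R"
    by (induction cs) (use assms in auto)
qed

definition multiplicative_set :: "('a, 'b) ring_scheme \<Rightarrow> 'a set \<Rightarrow> bool" where
  "multiplicative_set R S \<longleftrightarrow> S \<subseteq> carrier R \<and> \<one>\<^bsub>R\<^esub> \<in> S \<and> (\<forall>s\<in>S. \<forall>t\<in>S. s \<otimes>\<^bsub>R\<^esub> t \<in> S)"

lemma
  assumes R: "cring R" and S: "multiplicative_set R S"
  shows localization_is_cring: "cring (localization R S)"
    and mk_frac_mult: "\<And>a s b t. \<lbrakk>a \<in> carrier R; s \<in> S; b \<in> carrier R; t \<in> S\<rbrakk> \<Longrightarrow>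
      mk_frac R S a s \<otimes>\<^bsub>localization R S\<^esub> mk_frac R S b t = mk_frac R S (a \<otimes>\<^bsub>R\<^esub> b) (s \<otimes>\<^bsub>R\<^esub> t)"
    and mk_frac_add: "\<And>a s b t. \<lbrakk>a \<in> carrier R; s \<in> S; b \<in> carrier R; t \<in> S\<rbrakk> \<Longrightarrow>
      mk_frac R S a s \<oplus>\<^bsub>localization R S\<^esub> mk_frac R S b t =
      mk_frac R S (t \<otimes>\<^bsub>R\<^esub> a \<oplus>\<^bsub>R\<^esub> s \<otimes>\<^bsub>R\<^esub> b) (s \<otimes>\<^bsub>R\<^esub> t)"
    and mk_frac_eq_iff: "\<And>a s b t. \<lbrakk>a \<in> carrier R; s \<in> S; b \<in> carrier R; t \<in> S\<rbrakk> \<Longrightarrow>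
      mk_frac R S a s = mk_frac R S b t \<longleftrightarrow>
      (\<exists>u\<in>S. u \<otimes>\<^bsub>R\<^esub> (t \<otimes>\<^bsub>R\<^esub> a) = u \<otimes>\<^bsub>R\<^esub> (s \<otimes>\<^bsub>R\<^esub> b))"
proof -
  have S': "S \<subseteq> carrier R" "\<one>\<^bsub>R\<^esub> \<in> S" "\<And>s t. s \<in> S \<Longrightarrow> t \<in> S \<Longrightarrow> s \<otimes>\<^bsub>R\<^esub> t \<in> S"
    using S by (auto simp: multiplicative_set_def)
  show "cring (localization R S)" using R S' by (rule cring_localization)
  show "mk_frac R S a s \<otimes>\<^bsub>localization R S\<^esub> mk_frac R S b t = mk_frac R S (a \<otimes>\<^bsub>R\<^esub> b) (s \<otimes>\<^bsub>R\<^esub> t)"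
    if "a \<in> carrier R" "s \<in> S" "b \<in> carrier R" "t \<in> S" for a s b t
    using R S' that by (rule mult_mk_frac)
  show "mk_frac R S a s \<oplus>\<^bsub>localization R S\<^esub> mk_frac R S b t =
      mk_frac R S (t \<otimes>\<^bsub>R\<^esub> a \<oplus>\<^bsub>R\<^esub> s \<otimes>\<^bsub>R\<^esub> b) (s \<otimes>\<^bsub>R\<^esub> t)"
    if "a \<in> carrier R" "s \<in> S" "b \<in> carrier R" "t \<in> S" for a s b t
    using R S' that by (rule add_mk_frac)
  have eq: "equiv (carrier R \<times> S) (frac_rel R S)" using R S' by (rule equiv_frac_rel)
  show "mk_frac R S a s = mk_frac R S b t \<longleftrightarrow>
      (\<exists>u\<in>S. u \<otimes>\<^bsub>R\<^esub> (t \<otimes>\<^bsub>R\<^esub> a) = u \<otimes>\<^bsub>R\<^esub> (s \<otimes>\<^bsub>R\<^esub> b))"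
    if "a \<in> carrier R" "s \<in> S" "b \<in> carrier R" "t \<in> S" for a s b t
    unfolding mk_frac_def using eq_equiv_class_iff[OF eq, of "(a, s)" "(b, t)"] that
    by (auto simp: frac_rel_def)
qed

lemma frac_in_carrier: "a \<in> carrier R \<Longrightarrow> s \<in> S \<Longrightarrow> mk_frac R S a s \<in> carrier (localization R S)"
  by (auto simp: localization_def mk_frac_def intro: quotientI)

lemma localization_cases:
  assumes "x \<in> carrier (localization R S)"
  obtains a s where "a \<in> carrier R" "s \<in> S" "x = mk_frac R S a s"
  using assms by (auto simp: localization_def mk_frac_def elim: quotientE)

lemma localization_hom:
  assumes R: "cring R" and S: "multiplicative_set R S"
  shows "(\<lambda>a. mk_frac R S a \<one>\<^bsub>R\<^esub>) \<in> ring_hom R (localization R S)"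
proof -
  interpret cring R by fact
  have "\<one>\<^bsub>R\<^esub> \<in> S" using S by (simp add: multiplicative_set_def)
  then show ?thesis
    by (intro ring_hom_memI)
      (simp_all add: frac_in_carrier mk_frac_mult[OF R S] mk_frac_add[OF R S], simp add: localization_def)
qed

text \<open>The hypothesis on \<open>b\<close> makes its image in the localization nonzero, so a/b
  exists in the fraction field. The relation is the monic equation for a/b with denominators
  cleared, hence a/b lies in the localization and equals some f/s.\<close>

lemma integrally_closed_localization_dest:
  fixes R (structure)
  assumes R: "cring R" and S: "multiplicative_set R S"
    and closed: "integrally_closed_domain (localization R S)"
    and a: "a \<in> carrier R" and b: "b \<in> carrier R" and nz: "\<forall>u\<in>S. u \<otimes> b \<noteq> \<zero>"
    and cs: "set cs \<subseteq> carrier R" "cs \<noteq> []" "hd cs = \<one>" and rel: "b \<otimes> homog_eval R a b cs = \<zero>"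
  obtains f s u where "f \<in> carrier R" "s \<in> S" "u \<in> S" "u \<otimes> (s \<otimes> a) = u \<otimes> (b \<otimes> f)"
proof -
  interpret R: cring R by fact
  have SR: "S \<subseteq> carrier R" "\<one> \<in> S" "\<And>s t. s \<in> S \<Longrightarrow> t \<in> S \<Longrightarrow> s \<otimes> t \<in> S"
    using S by (auto simp: multiplicative_set_def)
  define L where "L = localization R S"
  define j where "j a = mk_frac R S a \<one>" for a
  interpret L: cring L unfolding L_def by (rule localization_is_cring[OF R S])
  have j_hom: "j \<in> ring_hom R L" unfolding j_def L_def by (rule localization_hom[OF R S])
  have dom: "domain L" using closed by (simp add: integrally_closed_domain_def L_def)
  interpret L: domain L by fact
  define S' where "S' = carrier L - {\<zero>\<^bsub>L\<^esub>}"
  have S': "multiplicative_set L S'"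
    using L.integral by (auto simp: S'_def multiplicative_set_def)
  have oneS': "\<one>\<^bsub>L\<^esub> \<in> S'" by (simp add: S'_def)
  define F where "F = fraction_field L"
  have F: "F = localization L S'" by (simp add: F_def fraction_field_def S'_def)
  interpret F: cring F unfolding F by (rule localization_is_cring[OF L.is_cring S'])
  define i where "i = in_fraction_field L"
  have i: "i x = mk_frac L S' x \<one>\<^bsub>L\<^esub>" for x by (simp add: i_def in_fraction_field_def S'_def)
  have i_hom: "i \<in> ring_hom L F"
    using localization_hom[OF L.is_cring S'] by (simp add: F i[abs_def])
  define h where "h = i \<circ> j"
  have h_hom: "h \<in> ring_hom R F" unfolding h_def by (rule ring_hom_trans[OF j_hom i_hom])
  note h_closed = ring_hom_closed[OF h_hom]
  have zero: "\<zero>\<^bsub>L\<^esub> = j \<zero>" by (simp add: L_def j_def localization_def)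
  have jb: "j b \<in> S'"
  proof -
    have "j b \<noteq> j \<zero>"
    proof
      assume "j b = j \<zero>"
      then obtain u where "u \<in> S" "u \<otimes> (\<one> \<otimes> b) = u \<otimes> (\<one> \<otimes> \<zero>)"
        unfolding j_def using mk_frac_eq_iff[OF R S b SR(2) R.zero_closed SR(2)] by blast
      then show False using nz b SR(1) by auto
    qed
    then show ?thesis using ring_hom_closed[OF j_hom b] by (simp add: S'_def zero)
  qed
  then have jbL: "j b \<in> carrier L" by (simp add: S'_def)
  have jaL: "j a \<in> carrier L" using ring_hom_closed[OF j_hom a] .
  define z where "z = mk_frac L S' (j a) (j b)"
  have zF: "z \<in> carrier F" unfolding z_def F by (rule frac_in_carrier[OF jaL jb])
  have bz: "h b \<otimes>\<^bsub>F\<^esub> z = h a"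
    unfolding z_def h_def comp_def i F mk_frac_mult[OF L.is_cring S' jbL oneS' jaL jb]
    using oneS' jaL jbL jb
    by (subst mk_frac_eq_iff[OF L.is_cring S']) (auto intro!: bexI[of _ "\<one>\<^bsub>L\<^esub>"])
  \<comment> \<open>The inverse of \<open>h b\<close>, used to cancel the power of \<open>b\<close>
    that clears denominators.\<close>
  define v where "v = mk_frac L S' \<one>\<^bsub>L\<^esub> (j b)"
  have vF: "v \<in> carrier F" unfolding v_def F by (rule frac_in_carrier[OF L.one_closed jb])
  have oneF: "\<one>\<^bsub>F\<^esub> = mk_frac L S' \<one>\<^bsub>L\<^esub> \<one>\<^bsub>L\<^esub>" by (simp add: F localization_def)
  have vb: "v \<otimes>\<^bsub>F\<^esub> h b = \<one>\<^bsub>F\<^esub>"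
    unfolding v_def h_def comp_def i F[symmetric] oneF
    unfolding F mk_frac_mult[OF L.is_cring S' L.one_closed jb jbL oneS']
    using oneS' jbL jb
    by (subst mk_frac_eq_iff[OF L.is_cring S']) (auto intro!: bexI[of _ "\<one>\<^bsub>L\<^esub>"])
  \<comment> \<open>The extra factor \<open>h b\<close> on the right lets the induction start at the
    empty list, where \<open>homog_eval\<close> has no degree.\<close>
  have eval: "(h b [^]\<^bsub>F\<^esub> length ds) \<otimes>\<^bsub>F\<^esub> F.eval (map h ds) z = h b \<otimes>\<^bsub>F\<^esub> h (homog_eval R a b ds)"
    if "set ds \<subseteq> carrier R" for ds
    using that
  proof (induction ds)
    case Nil
    have "h \<zero> = \<zero>\<^bsub>F\<^esub>" using ring_hom_zero[OF h_hom R.ring_axioms F.ring_axioms] .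
    then show ?case using h_closed[OF b] by simp
  next
    case (Cons d ds)
    let ?n = "length ds" and ?e = "F.eval (map h ds) z" and ?u = "homog_eval R a b ds"
    have d: "d \<in> carrier R" "h d \<in> carrier F" and ds: "set ds \<subseteq> carrier R" using Cons.prems h_closed by auto
    have u: "?u \<in> carrier R" "h ?u \<in> carrier F" using homog_eval_closed[OF R a b ds] h_closed by auto
    have hb: "h b \<in> carrier F" using h_closed b .
    have e: "?e \<in> carrier F" using ds h_closed zF by (intro F.eval_in_carrier) auto
    have pow: "h (a [^] n) = h a [^]\<^bsub>F\<^esub> n" for n :: nat
      using ring_hom_closed[OF h_hom] a
      by (induction n) (simp_all add: ring_hom_one[OF h_hom] ring_hom_mult[OF h_hom])
    have zb: "(h b [^]\<^bsub>F\<^esub> ?n) \<otimes>\<^bsub>F\<^esub> (z [^]\<^bsub>F\<^esub> ?n) = h a [^]\<^bsub>F\<^esub> ?n"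
      using F.nat_pow_distrib[OF hb zF, of ?n] bz by simp
    have "(h b [^]\<^bsub>F\<^esub> length (d # ds)) \<otimes>\<^bsub>F\<^esub> F.eval (map h (d # ds)) z =
        (h b [^]\<^bsub>F\<^esub> ?n \<otimes>\<^bsub>F\<^esub> h b) \<otimes>\<^bsub>F\<^esub> (h d \<otimes>\<^bsub>F\<^esub> (z [^]\<^bsub>F\<^esub> ?n) \<oplus>\<^bsub>F\<^esub> ?e)"
      by simp
    also have "\<dots> = h b \<otimes>\<^bsub>F\<^esub> (h d \<otimes>\<^bsub>F\<^esub> ((h b [^]\<^bsub>F\<^esub> ?n) \<otimes>\<^bsub>F\<^esub> (z [^]\<^bsub>F\<^esub> ?n)) \<oplus>\<^bsub>F\<^esub> (h b [^]\<^bsub>F\<^esub> ?n) \<otimes>\<^bsub>F\<^esub> ?e)"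
      using hb d e zF by (simp add: F.r_distr F.m_ac)
    also have "\<dots> = h b \<otimes>\<^bsub>F\<^esub> (h d \<otimes>\<^bsub>F\<^esub> h (a [^] ?n) \<oplus>\<^bsub>F\<^esub> h b \<otimes>\<^bsub>F\<^esub> h ?u)"
      unfolding zb Cons.IH[OF ds] pow ..
    also have "\<dots> = h b \<otimes>\<^bsub>F\<^esub> h (homog_eval R a b (d # ds))"
      using a b d u by (simp add: ring_hom_add[OF h_hom] ring_hom_mult[OF h_hom])
    finally show ?case .
  qed
  have ev: "F.eval (map h cs) z \<in> carrier F"
    using cs(1) h_closed zF by (intro F.eval_in_carrier) auto
  have "(h b [^]\<^bsub>F\<^esub> length cs) \<otimes>\<^bsub>F\<^esub> F.eval (map h cs) z = h (b \<otimes> homog_eval R a b cs)"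
    using eval[OF cs(1)] ring_hom_mult[OF h_hom b homog_eval_closed[OF R a b cs(1)]] by simp
  also have "\<dots> = \<zero>\<^bsub>F\<^esub>"
    unfolding rel by (rule ring_hom_zero[OF h_hom R.ring_axioms F.ring_axioms])
  finally have "(v [^]\<^bsub>F\<^esub> length cs) \<otimes>\<^bsub>F\<^esub> ((h b [^]\<^bsub>F\<^esub> length cs) \<otimes>\<^bsub>F\<^esub> F.eval (map h cs) z) = \<zero>\<^bsub>F\<^esub>"
    using vF by simp
  moreover have "(v [^]\<^bsub>F\<^esub> length cs) \<otimes>\<^bsub>F\<^esub> (h b [^]\<^bsub>F\<^esub> length cs) = \<one>\<^bsub>F\<^esub>"
    using F.nat_pow_distrib[OF vF h_closed[OF b], of "length cs"] vb F.nat_pow_one by simp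
  ultimately have eval0: "F.eval (map h cs) z = \<zero>\<^bsub>F\<^esub>"
    using ev vF h_closed[OF b] F.m_assoc[of "v [^]\<^bsub>F\<^esub> length cs" "h b [^]\<^bsub>F\<^esub> length cs" "F.eval (map h cs) z"]
    by simp
  have h1: "h \<one> = \<one>\<^bsub>F\<^esub>" by (rule ring_hom_one[OF h_hom])
  \<comment> \<open>\<open>polynomial\<close> demands a nonzero leading coefficient.\<close>
  have F10: "\<one>\<^bsub>F\<^esub> \<noteq> \<zero>\<^bsub>F\<^esub>"
  proof -
    have zeroF: "\<zero>\<^bsub>F\<^esub> = mk_frac L S' \<zero>\<^bsub>L\<^esub> \<one>\<^bsub>L\<^esub>" by (simp add: F localization_def)
    show ?thesis
    proof
      assume "\<one>\<^bsub>F\<^esub> = \<zero>\<^bsub>F\<^esub>"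
      then obtain u where "u \<in> S'" "u \<otimes>\<^bsub>L\<^esub> (\<one>\<^bsub>L\<^esub> \<otimes>\<^bsub>L\<^esub> \<one>\<^bsub>L\<^esub>) = u \<otimes>\<^bsub>L\<^esub> (\<one>\<^bsub>L\<^esub> \<otimes>\<^bsub>L\<^esub> \<zero>\<^bsub>L\<^esub>)"
        unfolding oneF zeroF
        using mk_frac_eq_iff[OF L.is_cring S' L.one_closed oneS' L.zero_closed oneS'] by blast
      then show False by (auto simp: S'_def)
    qed
  qed
  have hd: "hd (map h cs) = \<one>\<^bsub>F\<^esub>" using cs(2,3) h1 by (simp add: hd_map)
  have "integral_over F (i ` carrier L) z"
    unfolding integral_over_def
  proof (intro exI conjI)
    show "polynomial\<^bsub>F\<^esub> (i ` carrier L) (map h cs)"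
      using cs(1) hd F10 ring_hom_closed[OF j_hom] by (auto simp: polynomial_def h_def)
  qed (use cs(2) hd eval0 in auto)
  then have "z \<in> i ` carrier L"
    using closed zF unfolding integrally_closed_domain_def L_def[symmetric] F_def i_def by blast
  then obtain y where y: "y \<in> carrier L" "z = mk_frac L S' y \<one>\<^bsub>L\<^esub>" by (auto simp: i)
  then obtain w where w: "w \<in> S'" "w \<otimes>\<^bsub>L\<^esub> (\<one>\<^bsub>L\<^esub> \<otimes>\<^bsub>L\<^esub> j a) = w \<otimes>\<^bsub>L\<^esub> (j b \<otimes>\<^bsub>L\<^esub> y)"
    using mk_frac_eq_iff[OF L.is_cring S' jaL jb y(1) oneS'] by (auto simp: z_def)
  then have "j a = j b \<otimes>\<^bsub>L\<^esub> y"
    using L.m_lcancel[of w "j a" "j b \<otimes>\<^bsub>L\<^esub> y"] jaL jbL y(1) by (auto simp: S'_def)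
  moreover obtain f s where f: "f \<in> carrier R" "s \<in> S" "y = mk_frac R S f s"
    using y(1) unfolding L_def by (rule localization_cases)
  ultimately have "mk_frac R S a \<one> = mk_frac R S (b \<otimes> f) (\<one> \<otimes> s)"
    unfolding j_def L_def using mk_frac_mult[OF R S b SR(2) f(1,2)] by simp
  then obtain u where "u \<in> S" "u \<otimes> ((\<one> \<otimes> s) \<otimes> a) = u \<otimes> (\<one> \<otimes> (b \<otimes> f))"
    using mk_frac_eq_iff[OF R S a SR(2) R.m_closed[OF b f(1)] SR(3)[OF SR(2) f(2)]] by blast
  then show ?thesis using that[of f s u] f a b SR(1) by auto
qed

section \<open>Integrality of the squared determinant\<close>

lemma mixed_coeff_sum:
  "mixed_coeff (\<lambda>y. \<Sum>i\<in>I. c i * f i y) x u v = (\<Sum>i\<in>I. c i * mixed_coeff (f i) x u v)"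
  unfolding mixed_coeff_def by (simp only: lin_coeff_sum)

lemma linear_form_evaluation: "linear_form fun_scale V (\<lambda>q. q y)"
  by (simp add: linear_form_def fun_scale_def)

lemma poly_funs_evaluation: "(\<lambda>q. q y) \<in> poly_funs fun_scale V"
  by (rule poly_funs.linear[OF linear_form_evaluation])

lemma prod_Compl_split:
  fixes g :: "'a::finite \<Rightarrow> 'b::comm_monoid_mult"
  shows "(\<Prod>t\<in>UNIV. g t) = (\<Prod>t\<in>S. g t) * (\<Prod>t\<in>- S. g t)"
  using prod.union_disjoint[OF finite finite, of S "- S" g] by simp

lemma det_mult_kernel:
  fixes A :: "complex^'k^'k"
  assumes "A *v w = 0" "w \<noteq> 0"
  shows "det A = 0"
  using assms matrix_left_invertible_ker[of A] invertible_left_inverse[of A] invertible_det_nz[of A] by blast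

text \<open>The identity that exhibits \<open>(det M)\<^sup>2\<close> as a quotient of polynomial
  functions of \<open>pull_det M\<close>, wherever the power of \<open>pull_det M y\<close> is
  nonzero.\<close>

lemma det_hess_pull_det_eq:
  fixes M :: "complex^('n::finite \<times> 'n)^('n \<times> 'n)"
  assumes "CARD('n) \<ge> 2"
  shows "det (hess (pull_det M) y) = (det M)\<^sup>2 *
    (det (hess det (mat 1 :: complex^'n^'n)) * pull_det M y ^ (CARD('n) * CARD('n) - 2 * CARD('n)))"
  unfolding det_hess_pull_det det_hess_det[OF assms, of "lin_map M y"] by (simp add: pull_det_def)

text \<open>
  By the Hessian identity, \<open>(det M)\<^sup>2\<close> maps the ideal spanned by the products \<open>\<Prod>t. q (x (f t))\<close>
  of sufficiently many evaluations into itself; the coefficients come from the characteristic polynomial.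
\<close>

lemma det_square_integral:
  assumes m: "CARD('n::finite) \<ge> 2"
  obtains c K where "\<And>j. c j \<in> poly_funs fun_scale (Q_space :: (complex^'n^'n \<Rightarrow> complex) set)"
    "\<And>q. c K q = 1"
    "\<And>M. det M \<noteq> 0 \<Longrightarrow> (\<Sum>j\<le>K. c j (pull_det M) * ((det M)\<^sup>2) ^ j) = 0"
proof -
  let ?H1 = "det (hess det (mat 1 :: complex^'n^'n))"
  define N where "N = CARD('n) * CARD('n) - 2 * CARD('n)"
  have H1: "?H1 \<noteq> 0" using det_hess_det_1_nonzero m by blast
  obtain x :: "('n \<Rightarrow> 'n \<times> 'n) \<Rightarrow> complex^'n^'n" and l
    where l': "\<forall>q\<in>Q_space. \<forall>y. q y = (\<Sum>k\<in>UNIV. l y k * q (x k))"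
    using evaluations_finitely_spanned by (elim exE)
  then have l: "q y = (\<Sum>k\<in>UNIV. l y k * q (x k))" if "q \<in> Q_space" for q y using that by (elim ballE allE) auto
  let ?V = "Q_space :: (complex^'n^'n \<Rightarrow> complex) set"
  \<comment> \<open>With r sample points and m = \<open>CARD('n)\<close>, a product has r m^2
    factors, so some sample point occurs at least m^2 times, which is at least
    \<open>N\<close>.\<close>
  define w where "w f q = (\<Prod>t\<in>UNIV. q (x (f t)))"
    for f :: "('n \<Rightarrow> 'n \<times> 'n) \<times> ('n \<times> 'n) \<Rightarrow> ('n \<Rightarrow> 'n \<times> 'n)" and q :: "complex^'n^'n \<Rightarrow> complex"
  \<comment> \<open>\<open>mixed_coeff\<close> is linear on arbitrary functions, so it may be
    applied to the coefficient functions of \<open>l\<close>. This writes each Hessian entry as a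
    combination of the sample values of \<open>q\<close>.\<close>
  define \<mu> where "\<mu> k0 p r k = mixed_coeff (\<lambda>y. l y k) (x k0) (unit_mat p) (unit_mat r)" for k0 p r k
  define A where "A k0 p r q = (\<Sum>k\<in>UNIV. \<mu> k0 p r k * q (x k))" for k0 p r and q :: "complex^'n^'n \<Rightarrow> complex"
  have A: "hess q (x k0) $ p $ r = A k0 p r q" if "q \<in> ?V" for q k0 p r
  proof -
    have e: "q = (\<lambda>y. \<Sum>k\<in>UNIV. q (x k) * l y k)"
      by (rule ext) (rule trans[OF l[OF that] sum.cong[OF refl mult.commute]])
    have "mixed_coeff q (x k0) (unit_mat p) (unit_mat r) =
        mixed_coeff (\<lambda>y. \<Sum>k\<in>UNIV. q (x k) * l y k) (x k0) (unit_mat p) (unit_mat r)"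
      by (rule arg_cong[OF e, of "\<lambda>q. mixed_coeff q (x k0) (unit_mat p) (unit_mat r)"])
    also have "\<dots> = A k0 p r q"
      unfolding mixed_coeff_sum A_def \<mu>_def by (intro sum.cong refl mult.commute)
    finally show ?thesis by (simp add: hess_def)
  qed
  have A_poly: "A k0 p r \<in> poly_funs fun_scale ?V" for k0 p r
    unfolding A_def[abs_def] by (intro poly_funs_sum poly_funs_scale poly_funs_evaluation)
  have ex: "\<exists>b. (\<forall>f'. b f' \<in> poly_funs fun_scale ?V) \<and>
      (\<forall>M. (det M)\<^sup>2 * w f (pull_det M) = (\<Sum>f'\<in>UNIV. b f' (pull_det M) * w f' (pull_det M)))" for f
  proof -
    have "\<exists>k0. card {t. f t = k0} \<ge> CARD('n \<times> 'n)"
    proof (rule ccontr)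
      assume "\<not> ?thesis"
      then have "\<And>k. card {t. f t = k} < CARD('n \<times> 'n)" by (simp add: not_le)
      then have "(\<Sum>k\<in>UNIV. card {t. f t = k}) < (\<Sum>k\<in>(UNIV :: ('n \<Rightarrow> 'n \<times> 'n) set). CARD('n \<times> 'n))"
        by (intro sum_strict_mono) auto
      moreover have "card (\<Union>k\<in>UNIV. {t. f t = k}) = (\<Sum>k\<in>UNIV. card {t. f t = k})"
        by (rule card_UN_disjoint) auto
      moreover have "(\<Union>k\<in>UNIV. {t. f t = k}) = UNIV" by auto
      ultimately show False by simp
    qed
    then obtain k0 where k0: "card {t. f t = k0} \<ge> CARD('n \<times> 'n)" by blast
    have "N \<le> CARD('n \<times> 'n)" by (simp add: N_def)
    then have "N \<le> card {t. f t = k0}" using k0 by (rule le_trans)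
    then obtain S where S: "S \<subseteq> {t. f t = k0}" "card S = N"
      by (rule obtain_subset_with_card_n)
    have "card S \<le> card (UNIV :: ('n \<times> 'n) set)" unfolding S(2) by fact
    then obtain \<iota> :: "('n \<Rightarrow> 'n \<times> 'n) \<times> 'n \<times> 'n \<Rightarrow> 'n \<times> 'n" where \<iota>: "inj_on \<iota> S"
      using card_le_inj[OF finite finite, of S "UNIV :: ('n \<times> 'n) set"] by blast
    \<comment> \<open>In the Leibniz term of \<open>\<pi>\<close>, the \<open>N\<close> factors at
      the positions \<open>S\<close> are traded for the Hessian entries in the rows
      \<open>\<iota> t\<close>, and the other factors are kept. Each is a combination of sample
      values, so expanding gives products \<open>w f'\<close> again. The remaining Hessian rows go
      into the coefficient \<open>b\<close>.\<close>
    define \<nu> where "\<nu> \<pi> t k = (if t \<in> S then \<mu> k0 (\<iota> t) (\<pi> (\<iota> t)) k else of_bool (k = f t))" for \<pi> t k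
    define b where "b f' q = (\<Sum>\<pi>\<in>UNIV. (perm_sign \<pi> / ?H1 * (\<Prod>t\<in>UNIV. \<nu> \<pi> t (f' t))) *
        (\<Prod>p\<in>- \<iota> ` S. A k0 p (\<pi> p) q))" for f' q
    have "b f' \<in> poly_funs fun_scale ?V" for f'
      unfolding b_def[abs_def] by (intro poly_funs_sum poly_funs_scale poly_funs_prod A_poly)
    moreover have "(det M)\<^sup>2 * w f (pull_det M) = (\<Sum>f'\<in>UNIV. b f' (pull_det M) * w f' (pull_det M))" for M
    proof -
      define q where "q = pull_det M"
      have q: "q \<in> ?V" by (simp add: q_def pull_det_in_Q_space)
      define R where "R = (\<Prod>t\<in>- S. q (x (f t)))"
      have "w f q = (\<Prod>t\<in>S. q (x (f t))) * R"
        unfolding w_def R_def by (rule prod_Compl_split)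
      also have "(\<Prod>t\<in>S. q (x (f t))) = q (x k0) ^ N"
        using S by (subst prod.cong[OF refl, of _ _ "\<lambda>_. q (x k0)"]) auto
      finally have "?H1 * ((det M)\<^sup>2 * w f q) = det (hess q (x k0)) * R"
        unfolding q_def det_hess_pull_det_eq[OF m] N_def by simp
      also have "\<dots> = (\<Sum>\<pi>\<in>UNIV. perm_sign \<pi> * ((\<Prod>p\<in>UNIV. A k0 p (\<pi> p) q) * R))"
        by (simp add: det_perm_sign A[OF q] sum_distrib_right mult.assoc)
      also have "\<dots> = (\<Sum>\<pi>\<in>UNIV. perm_sign \<pi> * ((\<Prod>p\<in>- \<iota> ` S. A k0 p (\<pi> p) q) *
          (\<Sum>f'\<in>UNIV. (\<Prod>t\<in>UNIV. \<nu> \<pi> t (f' t)) * w f' q)))"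
      proof (intro sum.cong refl arg_cong[of _ _ "\<lambda>z. _ * z"])
        fix \<pi> :: "'n \<times> 'n \<Rightarrow> 'n \<times> 'n"
        have "(\<Prod>p\<in>UNIV. A k0 p (\<pi> p) q) = (\<Prod>p\<in>\<iota> ` S. A k0 p (\<pi> p) q) * (\<Prod>p\<in>- \<iota> ` S. A k0 p (\<pi> p) q)"
          by (rule prod_Compl_split)
        also have "(\<Prod>p\<in>\<iota> ` S. A k0 p (\<pi> p) q) = (\<Prod>t\<in>S. \<Sum>k\<in>UNIV. \<nu> \<pi> t k * q (x k))"
          by (subst prod.reindex[OF \<iota>]) (simp add: A_def \<nu>_def)
        finally have e1: "(\<Prod>p\<in>UNIV. A k0 p (\<pi> p) q) =
            (\<Prod>t\<in>S. \<Sum>k\<in>UNIV. \<nu> \<pi> t k * q (x k)) * (\<Prod>p\<in>- \<iota> ` S. A k0 p (\<pi> p) q)" .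
        have e2: "R = (\<Prod>t\<in>- S. \<Sum>k\<in>UNIV. \<nu> \<pi> t k * q (x k))"
          unfolding R_def
        proof (intro prod.cong refl)
          fix t assume "t \<in> - S"
          then have "(\<Sum>k\<in>UNIV. \<nu> \<pi> t k * q (x k)) = (\<Sum>k\<in>UNIV. if k = f t then q (x k) else 0)"
            by (intro sum.cong) (auto simp: \<nu>_def)
          then show "q (x (f t)) = (\<Sum>k\<in>UNIV. \<nu> \<pi> t k * q (x k))" by simp
        qed
        have "(\<Prod>p\<in>UNIV. A k0 p (\<pi> p) q) * R = (\<Prod>p\<in>- \<iota> ` S. A k0 p (\<pi> p) q) *
            ((\<Prod>t\<in>S. \<Sum>k\<in>UNIV. \<nu> \<pi> t k * q (x k)) * (\<Prod>t\<in>- S. \<Sum>k\<in>UNIV. \<nu> \<pi> t k * q (x k)))"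
          unfolding e1 e2 by (simp only: mult_ac)
        also have "(\<Prod>t\<in>S. \<Sum>k\<in>UNIV. \<nu> \<pi> t k * q (x k)) * (\<Prod>t\<in>- S. \<Sum>k\<in>UNIV. \<nu> \<pi> t k * q (x k)) =
            (\<Prod>t\<in>UNIV. \<Sum>k\<in>UNIV. \<nu> \<pi> t k * q (x k))"
          by (rule prod_Compl_split[symmetric])
        also have "\<dots> = (\<Sum>f'\<in>UNIV. (\<Prod>t\<in>UNIV. \<nu> \<pi> t (f' t)) * w f' q)"
          unfolding prod_sum_UNIV w_def by (simp only: prod.distrib)
        finally show "(\<Prod>p\<in>UNIV. A k0 p (\<pi> p) q) * R = (\<Prod>p\<in>- \<iota> ` S. A k0 p (\<pi> p) q) *
          (\<Sum>f'\<in>UNIV. (\<Prod>t\<in>UNIV. \<nu> \<pi> t (f' t)) * w f' q)" .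
      qed
      also have "\<dots> = ?H1 * (\<Sum>f'\<in>UNIV. b f' q * w f' q)"
        unfolding b_def sum_distrib_left sum_distrib_right
        by (subst sum.swap) (use H1 in \<open>simp add: mult_ac\<close>)
      finally show ?thesis using H1 by (simp add: q_def)
    qed
    ultimately show ?thesis by blast
  qed
  have "\<exists>B. \<forall>f. (\<forall>f'. B f f' \<in> poly_funs fun_scale ?V) \<and>
      (\<forall>M. (det M)\<^sup>2 * w f (pull_det M) = (\<Sum>f'\<in>UNIV. B f f' (pull_det M) * w f' (pull_det M)))"
    using ex by (intro choice allI)
  then obtain B where B: "\<And>f f'. B f f' \<in> poly_funs fun_scale ?V"
    "\<And>f M. (det M)\<^sup>2 * w f (pull_det M) = (\<Sum>f'\<in>UNIV. B f f' (pull_det M) * w f' (pull_det M))"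
    by blast
  obtain c where c: "\<forall>j. c j \<in> poly_funs fun_scale ?V"
    "\<forall>q. c CARD(('n \<Rightarrow> 'n \<times> 'n) \<times> ('n \<times> 'n) \<Rightarrow> ('n \<Rightarrow> 'n \<times> 'n)) q = 1"
    "\<forall>q \<tau>. det (\<chi> i j. of_bool (i = j) * \<tau> - B i j q) =
      (\<Sum>j\<le>CARD(('n \<Rightarrow> 'n \<times> 'n) \<times> ('n \<times> 'n) \<Rightarrow> ('n \<Rightarrow> 'n \<times> 'n)). c j q * \<tau> ^ j)"
    using char_poly_expand[of B, OF B(1)] by (elim exE conjE)
  have "(\<Sum>j\<le>CARD(('n \<Rightarrow> 'n \<times> 'n) \<times> ('n \<times> 'n) \<Rightarrow> ('n \<Rightarrow> 'n \<times> 'n)). c j (pull_det M) * ((det M)\<^sup>2) ^ j) = 0"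
    if M: "det M \<noteq> 0" for M
  proof -
    let ?q = "pull_det M"
    obtain M' where M': "M ** M' = mat 1" using M unfolding invertible_det_nz[symmetric] invertible_def by blast
    \<comment> \<open>Since \<open>?q\<close> is not the zero function, some sample value is
      nonzero, and so is the product that repeats this sample point throughout.\<close>
    have "?q (lin_map M' (mat 1)) = 1"
      by (simp add: pull_det_def M' lin_map_1 flip: lin_map_mult)
    then have "(\<Sum>k\<in>UNIV. l (lin_map M' (mat 1)) k * ?q (x k)) \<noteq> 0"
      using l[OF pull_det_in_Q_space[of M], of "lin_map M' (mat 1)"] by simp
    then have "\<exists>k. ?q (x k) \<noteq> 0" by (rule contrapos_np) simp
    then obtain k where "?q (x k) \<noteq> 0" by blast
    then have "(\<chi> f. w f ?q) $ (\<lambda>_. k) \<noteq> 0" by (simp add: w_def)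
    then have "(\<chi> f. w f ?q) \<noteq> 0" by (rule contrapos_nn) (simp only: zero_index)
    \<comment> \<open>The products form an eigenvector of \<open>B\<close> with eigenvalue
      \<open>(det M)\<^sup>2\<close>.\<close>
    moreover have "(\<chi> i j. of_bool (i = j) * (det M)\<^sup>2 - B i j ?q) *v (\<chi> f. w f ?q) = 0"
    proof -
      have "(\<Sum>j\<in>UNIV. (of_bool (i = j) * (det M)\<^sup>2 - B i j ?q) * w j ?q) = 0" for i
      proof -
        have "(\<Sum>j\<in>UNIV. (of_bool (i = j) * (det M)\<^sup>2 - B i j ?q) * w j ?q) =
            (\<Sum>j\<in>UNIV. (if j = i then (det M)\<^sup>2 * w i ?q else 0) - B i j ?q * w j ?q)"
          by (intro sum.cong) (auto simp: algebra_simps)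
        then show ?thesis by (simp add: sum_subtractf B(2))
      qed
      then show ?thesis by (simp add: matrix_vector_mult_def vec_eq_iff)
    qed
    ultimately have "det (\<chi> i j. of_bool (i = j) * (det M)\<^sup>2 - B i j ?q) = 0" by (intro det_mult_kernel)
    then show ?thesis by (simp only: c(3))
  qed
  then show ?thesis using that[of c] c(1,2) by blast
qed

section \<open>Non-normality\<close>

lemma poly_eq_if_eventually_eq:
  assumes "\<forall>\<^sub>F t in at 0. poly p t = poly p' (t :: complex)"
  shows "p = p'"
proof (rule ccontr)
  assume "p \<noteq> p'"
  then have "finite {t. poly (p - p') t = 0}" by (intro poly_roots_finite) simp
  then have "\<forall>\<^sub>F t in at 0. t \<notin> {t. poly (p - p') t = 0}" by (rule eventually_at_notin_finite)
  then have "\<forall>\<^sub>F t in at (0 :: complex). False"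
    using assms by (rule eventually_elim2) simp
  then show False by simp
qed

lemma det_mat_scale: "det (mat_scale c (y :: complex^'n^'n)) = c ^ CARD('n) * det y"
proof -
  have "mat_scale c y = (\<chi> i. c *s y $ i)" by (simp add: mat_scale_def vec_eq_iff)
  then show ?thesis by (simp add: det_rows_mul)
qed

lemma det_orbit_subset_Q_space: "det_orbit \<subseteq> Q_space"
  using pull_det_in_Q_space by (auto simp: det_orbit_eq)

text \<open>Multiplying \<open>M\<close> by an m-th root of \<open>t\<close>, where m =
  \<open>CARD('n)\<close>, multiplies \<open>pull_det M\<close> by \<open>t\<close>.\<close>

lemma det_orbit_scale:
  assumes "q \<in> (det_orbit :: (complex^'n^'n \<Rightarrow> complex) set)" "t \<noteq> 0"
  shows "fun_scale t q \<in> det_orbit"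
proof -
  obtain M where M: "det M \<noteq> 0" "q = pull_det M" using assms(1) by (auto simp: det_orbit_eq)
  obtain \<tau> where \<tau>: "\<tau> \<noteq> 0" "t = \<tau> ^ CARD('n)"
    using exists_complex_root_nonzero[OF assms(2), of "CARD('n)"] by auto
  let ?M = "\<chi> p. \<tau> *s M $ p"
  have "det ?M \<noteq> 0" using M(1) \<tau>(1) by (simp add: det_rows_mul)
  moreover have "lin_map ?M x = mat_scale \<tau> (lin_map M x)" for x
    by (simp add: vec_eq_iff lin_map_nth mat_scale_def sum_distrib_left mult.assoc)
  then have "fun_scale t q = pull_det ?M"
    by (simp add: fun_scale_def pull_det_def M(2) det_mat_scale \<tau>(2))
  ultimately show ?thesis by (auto simp: det_orbit_eq)
qed

lemma fun_scale_0: "fun_scale 0 q = (\<lambda>_. 0)"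
  by (simp add: fun_scale_def)

lemma poly_funs_continuous_scale:
  assumes "f \<in> poly_funs fun_scale V" "q \<in> V"
  shows "continuous_on UNIV (\<lambda>t. f (fun_scale t q))"
  using assms(1)
proof induction
  case (linear f)
  then have "f (fun_scale t q) = t * f q" for t using assms(2) by (simp add: linear_form_def)
  then show ?case by (simp only:) (intro continuous_intros)
next
  case (add f g)
  then show ?case by (intro continuous_on_add)
next
  case (mult f g)
  then show ?case by (intro continuous_on_mult)
qed (rule continuous_on_const)

lemma poly_funs_eventually_nonzero:
  assumes "f \<in> poly_funs fun_scale V" "q \<in> V" "f (\<lambda>_. 0) \<noteq> 0"
  shows "\<forall>\<^sub>F t in at 0. f (fun_scale t q) \<noteq> 0"
proof (rule tendsto_imp_eventually_ne)
  show "filterlim (\<lambda>t. f (fun_scale t q)) (nhds (f (\<lambda>_. 0))) (at 0)"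
    using poly_funs_continuous_scale[OF assms(1,2)]
    unfolding continuous_on_def by (elim ballE[of _ _ 0]) (simp_all only: fun_scale_0 UNIV_I not_True_eq_False)
qed (rule assms(3))

lemma det_orbit_closure_vanish:
  assumes "f \<in> poly_funs fun_scale Q_space" "\<And>q. q \<in> det_orbit \<Longrightarrow> f q = 0" "q \<in> det_orbit_closure"
  shows "f q = 0"
proof -
  let ?Z = "{q \<in> Q_space. f q = 0}"
  have "zariski_closed fun_scale Q_space ?Z"
    unfolding zariski_closed_def using assms(1) by (intro exI[of _ "{f}"]) auto
  then have "det_orbit_closure \<subseteq> ?Z"
    unfolding det_orbit_closure_def zariski_closure_def
    using assms(2) det_orbit_subset_Q_space by (intro Inter_lower) auto
  then show ?thesis using assms(3) by auto
qed

text \<open>A polynomial function that is nonzero at the origin stays nonzero at small multiples of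
  \<open>det\<close>, which lie in the orbit.\<close>

lemma zero_in_det_orbit_closure: "(\<lambda>_. 0) \<in> (det_orbit_closure :: (complex^'n^'n \<Rightarrow> complex) set)"
  unfolding det_orbit_closure_def zariski_closure_def
proof (intro InterI, clarify)
  fix Z :: "(complex^'n^'n \<Rightarrow> complex) set"
  assume "zariski_closed fun_scale Q_space Z" "det_orbit \<subseteq> Z"
  then obtain F where F: "F \<subseteq> poly_funs fun_scale Q_space" "Z = {x \<in> Q_space. \<forall>f\<in>F. f x = 0}"
    "det_orbit \<subseteq> Z" by (auto simp: zariski_closed_def)
  have q: "pull_det (mat 1) \<in> (det_orbit :: (complex^'n^'n \<Rightarrow> complex) set)" by (auto simp: det_orbit_eq)
  have "f (\<lambda>_. 0) = 0" if "f \<in> F" for f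
  proof (rule ccontr)
    assume "f (\<lambda>_. 0) \<noteq> 0"
    then have "\<forall>\<^sub>F t in at 0. f (fun_scale t (pull_det (mat 1))) \<noteq> 0"
      using F(1) that pull_det_in_Q_space by (intro poly_funs_eventually_nonzero) auto
    moreover have "\<forall>\<^sub>F t in at (0 :: complex). t \<noteq> 0" by (rule eventually_neq_at_within)
    ultimately have "\<forall>\<^sub>F t in at (0 :: complex). False"
    proof (rule eventually_elim2)
      fix t :: complex assume "f (fun_scale t (pull_det (mat 1))) \<noteq> 0" "t \<noteq> 0"
      then show False using det_orbit_scale[OF q] F(2,3) that by blast
    qed
    then show False by simp
  qed
  then show "(\<lambda>_. 0) \<in> Z" using zero_in_Q_space by (simp add: F(2))
qed

text \<open>A linear form on \<open>Q_space\<close> is a bare function. Continuity comes from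
  \<open>linear_form_pull_det\<close>, by which its value at \<open>pull_det M\<close> is a
  polynomial in the entries of \<open>M\<close>.\<close>

lemma hom_poly_funs_continuous_pull_det:
  fixes M :: "complex^('n::finite \<times> 'n)^('n \<times> 'n)"
  assumes "G \<in> hom_poly_funs fun_scale Q_space d"
  shows "continuous_on UNIV (\<lambda>\<tau>. G (pull_det (M + mat \<tau>)))"
  using assms
proof induction
  case (prod \<phi>s c)
  have comp: "(M + mat \<tau>) $ p $ r = M $ p $ r + \<tau> * of_bool (p = r)" for \<tau> p r
    by (simp add: mat_def)
  have "continuous_on UNIV (\<lambda>\<tau>. \<phi> (pull_det (M + mat \<tau>)))" if "\<phi> \<in> set \<phi>s" for \<phi>
    unfolding linear_form_pull_det[OF prod(2)[OF that]] pull_coeff_def comp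
    by (intro continuous_intros)
  then have "continuous_on UNIV (\<lambda>\<tau>. prod_list (map (\<lambda>\<phi>. \<phi> (pull_det (M + mat \<tau>))) \<phi>s))"
  proof (induction \<phi>s)
    case (Cons \<phi> \<phi>s)
    have "continuous_on UNIV (\<lambda>\<tau>. \<phi> (pull_det (M + mat \<tau>)))"
      "continuous_on UNIV (\<lambda>\<tau>. prod_list (map (\<lambda>\<phi>. \<phi> (pull_det (M + mat \<tau>))) \<phi>s))"
      by (rule Cons.prems, simp, rule Cons.IH, rule Cons.prems, simp)
    then show ?case by (simp only: list.map prod_list.Cons) (rule continuous_on_mult)
  qed simp
  then show ?case by (rule continuous_on_mult[OF continuous_on_const])
next
  case (add F G)
  then show ?case by (intro continuous_on_add)
qed (rule continuous_on_const)

lemma poly_funs_det_hess: "(\<lambda>q. det (hess q x)) \<in> poly_funs fun_scale V"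
  unfolding hess_def
  by (intro poly_funs_det)
    (simp only: mixed_coeff_def lin_coeff_def, intro poly_funs_sum poly_funs_scale poly_funs_evaluation)

text \<open>Along a ray, \<open>eq\<close> reduces to
  \<open>s (t q) * (det M)\<^sup>2 * t ^ (2 m) = f (t q)\<close> with m = \<open>CARD('n)\<close>.
  Comparing the coefficients of \<open>t ^ (2 m)\<close> leaves the constant term of
  \<open>s\<close> on the left and a homogeneous component of \<open>f\<close> on the right, against
  \<open>det_square_not_hom_poly\<close>.\<close>

lemma det_square_not_local_fraction:
  fixes f s u :: "(complex^'n^'n \<Rightarrow> complex) \<Rightarrow> complex"
  assumes m: "CARD('n) \<ge> 3"
    and fsu: "f \<in> poly_funs fun_scale Q_space" "s \<in> poly_funs fun_scale Q_space" "u \<in> poly_funs fun_scale Q_space"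
    and s0: "s (\<lambda>_. 0) \<noteq> 0" and u0: "u (\<lambda>_. 0) \<noteq> 0"
    and eq: "\<And>q. q \<in> det_orbit \<Longrightarrow> u q * (s q * det (hess q (mat 1))) =
      u q * (det (hess det (mat 1 :: complex^'n^'n)) * q (mat 1) ^ (CARD('n) * CARD('n) - 2 * CARD('n)) * f q)"
  shows False
proof -
  let ?H1 = "det (hess det (mat 1 :: complex^'n^'n))"
  define N where "N = CARD('n) * CARD('n) - 2 * CARD('n)"
  have N: "CARD('n) * CARD('n) = N + 2 * CARD('n)"
    using mult_le_mono1[of 2 "CARD('n)" "CARD('n)"] m by (simp add: N_def)
  have H1: "?H1 \<noteq> 0" using m by (intro det_hess_det_1_nonzero) simp
  obtain F K where F: "\<And>j. F j \<in> hom_poly_funs fun_scale Q_space j" "\<And>j. j > K \<Longrightarrow> F j = (\<lambda>_. 0)"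
    "\<And>q. f q = (\<Sum>j\<le>K. F j q)" using poly_funs_hom_decomposition[OF fsu(1)] by blast
  obtain S L where S: "\<And>j. S j \<in> hom_poly_funs fun_scale Q_space j" "\<And>j. j > L \<Longrightarrow> S j = (\<lambda>_. 0)"
    "\<And>q. s q = (\<Sum>j\<le>L. S j q)" using poly_funs_hom_decomposition[OF fsu(2)] by blast
  \<comment> \<open>Scaling by 0 kills the components of positive degree, so the component of degree
    0 is constant on \<open>Q_space\<close>.\<close>
  have S0: "S 0 q = s (\<lambda>_. 0)" if "q \<in> Q_space" for q
  proof -
    have "s (\<lambda>_. 0) = (\<Sum>j\<le>L. 0 ^ j * S j q)"
      unfolding S(3) using hom_poly_funs_scale[OF S(1) that, of _ 0] by (simp add: fun_scale_0)
    also have "\<dots> = (\<Sum>j\<le>L. if j = 0 then S 0 q else 0)" by (intro sum.cong) auto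
    finally show ?thesis by simp
  qed
  have generic: "s (\<lambda>_. 0) * (det M)\<^sup>2 = F (2 * CARD('n)) (pull_det M)"
    if M: "det M \<noteq> 0" "pull_det M (mat 1) \<noteq> 0" for M :: "complex^('n \<times> 'n)^('n \<times> 'n)"
  proof -
    define q where "q = pull_det M"
    have qQ: "q \<in> Q_space" and qo: "q \<in> det_orbit"
      using M pull_det_in_Q_space by (auto simp: q_def det_orbit_eq)
    define P1 where "P1 = (\<Sum>j\<le>L. Polynomial.monom (S j q * (det M)\<^sup>2) (j + 2 * CARD('n)))"
    define P2 where "P2 = (\<Sum>j\<le>K. Polynomial.monom (F j q) j)"
    have "\<forall>\<^sub>F t in at 0. u (fun_scale t q) \<noteq> 0" by (rule poly_funs_eventually_nonzero[OF fsu(3) qQ u0])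
    moreover have "\<forall>\<^sub>F t in at (0 :: complex). t \<noteq> 0" by (rule eventually_neq_at_within)
    ultimately have "\<forall>\<^sub>F t in at 0. poly P1 t = poly P2 t"
    proof (rule eventually_elim2)
      fix t assume t: "u (fun_scale t q) \<noteq> 0" "t \<noteq> 0"
      have a: "det (hess (fun_scale t q) (mat 1)) = t ^ N * t ^ (2 * CARD('n)) * ((det M)\<^sup>2 * (?H1 * q (mat 1) ^ N))"
        unfolding fun_scale_def det_hess_scale N power_add q_def
        using det_hess_pull_det_eq[of M "mat 1"] m by (simp add: N_def)
      have b: "fun_scale t q (mat 1) ^ N = t ^ N * q (mat 1) ^ N"
        by (simp add: fun_scale_def power_mult_distrib)
      have "(u (fun_scale t q) * t ^ N * ?H1 * q (mat 1) ^ N) * (s (fun_scale t q) * (det M)\<^sup>2 * t ^ (2 * CARD('n))) =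
          (u (fun_scale t q) * t ^ N * ?H1 * q (mat 1) ^ N) * f (fun_scale t q)"
        using eq[OF det_orbit_scale[OF qo t(2)]] unfolding a b N_def[symmetric] by (simp only: mult_ac)
      then have "s (fun_scale t q) * (det M)\<^sup>2 * t ^ (2 * CARD('n)) = f (fun_scale t q)"
        using t H1 M(2) by (simp add: q_def)
      moreover have "s (fun_scale t q) * (det M)\<^sup>2 * t ^ (2 * CARD('n)) = poly P1 t"
        unfolding S(3) P1_def hom_poly_funs_scale[OF S(1) qQ] poly_sum poly_monom sum_distrib_right power_add
        by (simp only: mult_ac)
      moreover have "f (fun_scale t q) = poly P2 t"
        unfolding F(3) P2_def hom_poly_funs_scale[OF F(1) qQ] poly_sum poly_monom by (simp only: mult_ac)
      ultimately show "poly P1 t = poly P2 t" by simp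
    qed
    then have "Polynomial.coeff P1 (2 * CARD('n)) = Polynomial.coeff P2 (2 * CARD('n))"
      by (intro arg_cong2[of _ _ _ _ Polynomial.coeff] refl poly_eq_if_eventually_eq)
    moreover have "Polynomial.coeff P1 (2 * CARD('n)) = (\<Sum>j\<le>L. if j = 0 then S 0 q * (det M)\<^sup>2 else 0)"
      unfolding P1_def coeff_sum by (intro sum.cong) (auto simp: Polynomial.coeff_monom)
    moreover have "Polynomial.coeff P2 (2 * CARD('n)) = (\<Sum>j\<le>K. if j = 2 * CARD('n) then F (2 * CARD('n)) q else 0)"
      unfolding P2_def coeff_sum by (intro sum.cong) (auto simp: Polynomial.coeff_monom)
    moreover have "(\<Sum>j\<le>L. if j = 0 then S 0 q * (det M)\<^sup>2 else 0) = s (\<lambda>_. 0) * (det M)\<^sup>2"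
      by (simp add: S0[OF qQ])
    \<comment> \<open>If \<open>2 * CARD('n)\<close> exceeds \<open>K\<close>, both sides are
      0.\<close>
    moreover have "(\<Sum>j\<le>K. if j = 2 * CARD('n) then F (2 * CARD('n)) q else 0) = F (2 * CARD('n)) q"
      using F(2)[of "2 * CARD('n)"] by (cases "2 * CARD('n) \<le> K") simp_all
    ultimately show ?thesis by (simp only: q_def[symmetric])
  qed
  have "s (\<lambda>_. 0) * (det M)\<^sup>2 = F (2 * CARD('n)) (pull_det M)" for M :: "complex^('n \<times> 'n)^('n \<times> 'n)"
  proof -
    let ?f = "\<lambda>\<tau>. s (\<lambda>_. 0) * (det (M + mat \<tau>))\<^sup>2" and ?g = "\<lambda>\<tau>. F (2 * CARD('n)) (pull_det (M + mat \<tau>))"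
    have comp: "(M + mat \<tau>) $ p $ r = M $ p $ r + \<tau> * of_bool (p = r)" for \<tau> p r
      by (simp add: mat_def)
    have "continuous_on UNIV ?f" unfolding det_perm_sign comp by (intro continuous_intros)
    moreover have "continuous_on UNIV ?g" by (rule hom_poly_funs_continuous_pull_det[OF F(1)])
    moreover have "\<forall>\<^sub>F \<tau> in at 0. ?f \<tau> = ?g \<tau>"
    \<comment> \<open>\<open>generic\<close> requires two determinants to be nonzero. Moving
      \<open>M\<close> to \<open>M + mat \<tau>\<close> also moves \<open>lin_map M (mat 1)\<close>
      by \<open>mat \<tau>\<close>, so both hold for small nonzero \<open>\<tau>\<close>.\<close>
    proof (rule eventually_elim2[OF eventually_det_add_mat_nonzero eventually_det_add_mat_nonzero])
      fix \<tau> assume \<tau>: "det (M + mat \<tau>) \<noteq> 0" "det (lin_map M (mat 1) + mat \<tau>) \<noteq> 0"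
      have "lin_map (M + mat \<tau>) (mat 1) $ i $ j = (lin_map M (mat 1) + mat \<tau>) $ i $ j" for i j
      proof -
        have "lin_map (M + mat \<tau>) (mat 1) $ i $ j = lin_map M (mat 1) $ i $ j +
            (\<Sum>r\<in>UNIV. if r = (i, j) then \<tau> * mat 1 $ i $ j else 0)"
          unfolding lin_map_nth comp distrib_right sum.distrib by (intro arg_cong2[of _ _ _ _ "(+)"] refl sum.cong) auto
        then show ?thesis by (simp add: mat_def)
      qed
      then have "lin_map (M + mat \<tau>) (mat 1) = lin_map M (mat 1) + mat \<tau>" by (simp add: vec_eq_iff)
      then show "?f \<tau> = ?g \<tau>" using \<tau> by (intro generic) (simp_all add: pull_det_def)
    qed
    ultimately have "?f 0 = ?g 0" by (rule continuous_eq_at_0)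
    moreover have "mat 0 = (0 :: complex^('n \<times> 'n)^('n \<times> 'n))" by (simp add: mat_def vec_eq_iff)
    ultimately show ?thesis by simp
  qed
  then have "s (\<lambda>_. 0) = 0" by (rule det_square_not_hom_poly[OF F(1) m])
  then show False using s0 by simp
qed


section \<open>Pointwise computation in the coordinate ring, and the conclusion\<close>

lemma coord_ring_apply:
  assumes "q \<in> Z"
  shows "(f \<otimes>\<^bsub>coord_ring s V Z\<^esub> g) q = f q * g q"
    and "(f \<oplus>\<^bsub>coord_ring s V Z\<^esub> g) q = f q + g q"
    and "\<one>\<^bsub>coord_ring s V Z\<^esub> q = 1"
    and "\<zero>\<^bsub>coord_ring s V Z\<^esub> q = 0"
  using assms by (simp_all add: coord_ring_def)

lemma coord_ring_nat_pow_apply: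
  assumes "q \<in> Z" shows "(f [^]\<^bsub>coord_ring s V Z\<^esub> (n :: nat)) q = f q ^ n"
proof -
  interpret cring "coord_ring s V Z" by (rule cring_coord_ring)
  show ?thesis by (induction n) (simp_all add: coord_ring_apply[OF assms] mult.commute)
qed

lemma coord_ring_eqI:
  assumes "f \<in> carrier (coord_ring s V Z)" "g \<in> carrier (coord_ring s V Z)" "\<And>q. q \<in> Z \<Longrightarrow> f q = g q"
  shows "f = g"
proof
  fix q
  show "f q = g q" using assms by (cases "q \<in> Z") (auto simp: coord_ring_def restrict_def)
qed

lemma coord_ring_carrierE:
  assumes "f \<in> carrier (coord_ring s V Z)"
  obtains g where "g \<in> poly_funs s V" "\<And>q. q \<in> Z \<Longrightarrow> f q = g q"
  using assms by (auto simp: coord_ring_def)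

lemma restrict_in_coord_ring: "f \<in> poly_funs s V \<Longrightarrow> restrict f Z \<in> carrier (coord_ring s V Z)"
  by (simp add: coord_ring_def)

text \<open>At a point where \<open>a\<close> is \<open>h\<close> times \<open>b\<close>, the
  homogenized polynomial becomes a power of \<open>b\<close> times the polynomial at
  \<open>h\<close>. The reversed list puts the leading coefficient first.\<close>

lemma homog_eval_apply:
  assumes q: "q \<in> Z" and a: "a q = h * b q"
  shows "b q * homog_eval (coord_ring s V Z) a b (map c (rev [0..<n])) q =
    b q ^ n * (\<Sum>j<n. c j q * h ^ j)"
proof (induction n)
  case (Suc n)
  have "b q * homog_eval (coord_ring s V Z) a b (map c (rev [0..<Suc n])) q =
      b q * (c n q * a q ^ n) + b q * (b q * homog_eval (coord_ring s V Z) a b (map c (rev [0..<n])) q)"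
    by (simp add: coord_ring_apply[OF q] coord_ring_nat_pow_apply[OF q] distrib_left)
  also have "\<dots> = b q ^ Suc n * (\<Sum>j<Suc n. c j q * h ^ j)"
    unfolding Suc.IH a by (simp add: power_mult_distrib algebra_simps)
  finally show ?case .
qed (simp add: coord_ring_apply[OF q])

theorem theorem3p8:
  assumes "CARD('n::finite) \<ge> 3"
  shows "\<not> normal_variety fun_scale Q_space
           (det_orbit_closure :: (complex^'n^'n \<Rightarrow> complex) set)"
proof
  let ?Z = "det_orbit_closure :: (complex^'n^'n \<Rightarrow> complex) set"
  let ?V = "Q_space :: (complex^'n^'n \<Rightarrow> complex) set"
  let ?R = "coord_ring fun_scale ?V ?Z"
  let ?o = "(\<lambda>_. 0) :: complex^'n^'n \<Rightarrow> complex"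
  let ?S = "{f \<in> carrier ?R. f ?o \<noteq> 0}"
  assume "normal_variety fun_scale ?V ?Z"
  then have closed: "integrally_closed_domain (localization ?R ?S)"
    using zero_in_det_orbit_closure unfolding normal_variety_def local_ring_def by blast
  interpret R: cring ?R by (rule cring_coord_ring)
  have oZ: "?o \<in> ?Z" by (rule zero_in_det_orbit_closure)
  have orbit: "q \<in> ?Z" if "q \<in> det_orbit" for q using that zariski_closed_det_orbit_closure(2) by blast
  have S: "multiplicative_set ?R ?S"
    using R.m_closed R.one_closed by (auto simp: multiplicative_set_def coord_ring_apply[OF oZ])
  have m: "CARD('n) \<ge> 2" using assms by simp
  define N where "N = CARD('n) * CARD('n) - 2 * CARD('n)"
  define H1 where "H1 = det (hess det (mat 1 :: complex^'n^'n))"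
  have H1: "H1 \<noteq> 0" unfolding H1_def using m by (rule det_hess_det_1_nonzero)
  \<comment> \<open>On the orbit, \<open>a / b\<close> is \<open>(det M)\<^sup>2\<close>, by the
    Hessian identity at the point \<open>mat 1\<close>.\<close>
  define a where "a = restrict (\<lambda>q. det (hess q (mat 1))) ?Z"
  define b where "b = restrict (\<lambda>q. H1 * q (mat 1) ^ N) ?Z"
  have a: "a \<in> carrier ?R" unfolding a_def by (intro restrict_in_coord_ring poly_funs_det_hess)
  have b: "b \<in> carrier ?R"
    unfolding b_def by (intro restrict_in_coord_ring poly_funs_scale poly_funs_power poly_funs_evaluation)
  have ab: "a (pull_det M) = (det M)\<^sup>2 * b (pull_det M)" if "det M \<noteq> 0" for M
    using orbit[of "pull_det M"] that
    by (simp add: a_def b_def H1_def N_def det_hess_pull_det_eq[OF m] det_orbit_eq)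
  \<comment> \<open>On small nonzero multiples of \<open>det\<close> both factors are nonzero:
    \<open>u\<close> because it is nonzero at the origin, and \<open>b\<close> because
    \<open>det (mat 1) = 1\<close>.\<close>
  have nz: "\<forall>u\<in>?S. u \<otimes>\<^bsub>?R\<^esub> b \<noteq> \<zero>\<^bsub>?R\<^esub>"
  proof (intro ballI notI)
    fix u assume u: "u \<in> ?S" and ub: "u \<otimes>\<^bsub>?R\<^esub> b = \<zero>\<^bsub>?R\<^esub>"
    obtain g where g: "g \<in> poly_funs fun_scale ?V" "\<And>q. q \<in> ?Z \<Longrightarrow> u q = g q"
      using u by (auto elim: coord_ring_carrierE)
    have d: "pull_det (mat 1) \<in> (det_orbit :: (complex^'n^'n \<Rightarrow> complex) set)" by (auto simp: det_orbit_eq)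
    have "\<forall>\<^sub>F t in at 0. g (fun_scale t (pull_det (mat 1))) \<noteq> 0"
      using u g(2)[OF oZ] by (intro poly_funs_eventually_nonzero[OF g(1) pull_det_in_Q_space]) auto
    moreover have "\<forall>\<^sub>F t in at (0 :: complex). t \<noteq> 0" by (rule eventually_neq_at_within)
    ultimately have "\<forall>\<^sub>F t in at (0 :: complex). False"
    proof (rule eventually_elim2)
      fix t :: complex assume t: "g (fun_scale t (pull_det (mat 1))) \<noteq> 0" "t \<noteq> 0"
      let ?q = "fun_scale t (pull_det (mat 1)) :: complex^'n^'n \<Rightarrow> complex"
      have q: "?q \<in> ?Z" by (rule orbit[OF det_orbit_scale[OF d t(2)]])
      have "u ?q * b ?q = 0" using arg_cong[OF ub, of "\<lambda>f. f ?q"] by (simp only: coord_ring_apply[OF q])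
      moreover have "b ?q = H1 * t ^ N" using q by (simp add: b_def fun_scale_def pull_det_def lin_map_1)
      ultimately show False using t H1 g(2)[OF q] by simp
    qed
    then show False by simp
  qed
  obtain c K where c: "\<And>j. c j \<in> poly_funs fun_scale ?V" "\<And>q. c K q = 1"
    "\<And>M. det M \<noteq> 0 \<Longrightarrow> (\<Sum>j\<le>K. c j (pull_det M) * ((det M)\<^sup>2) ^ j) = 0"
    by (rule det_square_integral[OF m]) blast
  let ?cs = "map (\<lambda>j. restrict (c j) ?Z) (rev [0..<Suc K])"
  have cs: "set ?cs \<subseteq> carrier ?R" using restrict_in_coord_ring[OF c(1)] by auto
  have hd: "hd ?cs = \<one>\<^bsub>?R\<^esub>" by (simp add: c(2) coord_ring_def restrict_def fun_eq_iff)
  have e: "homog_eval ?R a b ?cs \<in> carrier ?R" by (rule homog_eval_closed[OF R.is_cring a b cs])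
  \<comment> \<open>The relation is known only on the orbit, where \<open>(det M)\<^sup>2\<close>
    makes sense. Both sides are polynomial functions, so it extends to the closure.\<close>
  have rel: "b \<otimes>\<^bsub>?R\<^esub> homog_eval ?R a b ?cs = \<zero>\<^bsub>?R\<^esub>"
  proof (rule coord_ring_eqI[OF R.m_closed[OF b e] R.zero_closed])
    fix q assume q: "q \<in> ?Z"
    obtain g where g: "g \<in> poly_funs fun_scale ?V"
      "\<And>q. q \<in> ?Z \<Longrightarrow> (b \<otimes>\<^bsub>?R\<^esub> homog_eval ?R a b ?cs) q = g q"
      using coord_ring_carrierE[OF R.m_closed[OF b e]] by blast
    have "g q = 0"
    proof (rule det_orbit_closure_vanish[OF g(1) _ q])
      fix q :: "complex^'n^'n \<Rightarrow> complex" assume q: "q \<in> det_orbit"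
      then obtain M where M: "det M \<noteq> 0" "q = pull_det M" by (auto simp: det_orbit_eq)
      have "g q = b q * homog_eval ?R a b ?cs q"
        using g(2)[OF orbit[OF q]] by (simp only: coord_ring_apply[OF orbit[OF q]])
      also have "\<dots> = b q ^ Suc K * (\<Sum>j<Suc K. restrict (c j) ?Z q * ((det M)\<^sup>2) ^ j)"
        using ab[OF M(1)] by (intro homog_eval_apply[OF orbit[OF q]]) (simp only: M(2))
      also have "\<dots> = b q ^ Suc K * (\<Sum>j\<le>K. c j q * ((det M)\<^sup>2) ^ j)"
        using orbit[OF q] by (simp only: lessThan_Suc_atMost restrict_apply if_True)
      finally show "g q = 0" using c(3)[OF M(1)] by (simp only: M(2)) simp
    qed
    then show "(b \<otimes>\<^bsub>?R\<^esub> homog_eval ?R a b ?cs) q = \<zero>\<^bsub>?R\<^esub> q"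
      using g(2)[OF q] by (simp only: coord_ring_apply(4)[OF q])
  qed
  have ne: "?cs \<noteq> []" by simp
  obtain f s u where fsu: "f \<in> carrier ?R" "s \<in> ?S" "u \<in> ?S"
    "u \<otimes>\<^bsub>?R\<^esub> (s \<otimes>\<^bsub>?R\<^esub> a) = u \<otimes>\<^bsub>?R\<^esub> (b \<otimes>\<^bsub>?R\<^esub> f)"
    by (rule integrally_closed_localization_dest[OF R.is_cring S closed a b nz cs ne hd rel]) blast
  obtain f' where f': "f' \<in> poly_funs fun_scale ?V" "\<And>q. q \<in> ?Z \<Longrightarrow> f q = f' q"
    using fsu(1) by (auto elim: coord_ring_carrierE)
  obtain s' where s': "s' \<in> poly_funs fun_scale ?V" "\<And>q. q \<in> ?Z \<Longrightarrow> s q = s' q"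
    using fsu(2) by (auto elim: coord_ring_carrierE)
  obtain u' where u': "u' \<in> poly_funs fun_scale ?V" "\<And>q. q \<in> ?Z \<Longrightarrow> u q = u' q"
    using fsu(3) by (auto elim: coord_ring_carrierE)
  show False
  proof (rule det_square_not_local_fraction[OF assms f'(1) s'(1) u'(1)])
    show "s' ?o \<noteq> 0" "u' ?o \<noteq> 0" using fsu(2,3) s'(2)[OF oZ] u'(2)[OF oZ] by auto
    fix q :: "complex^'n^'n \<Rightarrow> complex" assume "q \<in> det_orbit"
    then have q: "q \<in> ?Z" by (rule orbit)
    have "u q * (s q * a q) = u q * (b q * f q)"
      using arg_cong[OF fsu(4), of "\<lambda>f. f q"] by (simp only: coord_ring_apply[OF q])
    then show "u' q * (s' q * det (hess q (mat 1))) =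
        u' q * (det (hess det (mat 1 :: complex^'n^'n)) * q (mat 1) ^ (CARD('n) * CARD('n) - 2 * CARD('n)) * f' q)"
      using q by (simp add: a_def b_def f'(2) s'(2) u'(2) N_def H1_def)
  qed
qed

end
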